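(* The set $\mathcal S_{\mathbb P_{\mathbb N}}(\mathrm{CAR}(\mathbb N))$ of symmetric states is a Choquet simplex. Consequently, for each $\varphi\in\mathcal S_{\mathbb P_{\mathbb N}}(\mathrm{CAR}(\mathbb N))$ there exists a unique maximal Radon probability measure $\mu$ on $\mathcal S_{\mathbb P_{\mathbb N}}(\mathrm{CAR}(\mathbb N))$ such that $$\varphi(A)=\int\psi(A)\,d\mu(\psi)\,,\qquad A\in\mathrm{CAR}(\mathbb N),$$ and $\mu\big(\mathcal E(\mathcal S_{\mathbb P_{\mathbb N}}(\mathrm{CAR}(\mathbb N)))\big)=1$.
   Context: $\mathrm{CAR}(\mathbb N)$ is the unital $C^*$-algebra generated by $\{a_j,a_j^\dagger : j\in\mathbb N\}$ with $(a_j)^*=a_j^\dagger$, $\{a_j^\dagger,a_k\}=\delta_{jk}1$, $\{a_j,a_k\}=\{a_j^\dagger,a_k^\dagger\}=0$, where $\{a,b\}=ab+ba$. $\mathbb P_{\mathbb N}$ is the group of permutations of $\mathbb N$ moving only finitely many elements, acting on $\mathrm{CAR}(\mathbb N)$ by the automorphisms $\alpha_g$ with $\alpha_g(a_j)=a_{gj}$. A state $\varphi$ is symmetric if $\varphi\circ\alpha_g=\varphi$ for all $g\in\mathbb P_{\mathbb N}$; $\mathcal S_{\mathbb P_{\mathbb N}}(\mathrm{CAR}(\mathbb N))$ is the convex, $*$-weakly compact set of symmetric states and $\mathcal E(\mathcal S_{\mathbb P_{\mathbb N}}(\mathrm{CAR}(\mathbb N)))$ the set of its extreme points. "Maximal"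 refers to the Choquet ordering of Radon measures on the compact convex set $\mathcal S_{\mathbb P_{\mathbb N}}(\mathrm{CAR}(\mathbb N))$ with the $*$-weak topology. *)

theory Defs
  imports "HOL-Analysis.Analysis" "HOL-Probability.Probability" "HOL-Combinatorics.Perm"
begin

section \<open>Unital C*-algebras\<close>

text \<open>
  The real normed algebra structure comes from the parent classes; the complex one is added on
  top of it and is compatible with it by \<open>scaleR_eq_scaleC\<close>. Since the parent class demands
  \<open>norm 1 = 1\<close>, the zero algebra is excluded.
\<close>

class cstar_algebra = real_normed_algebra_1 + banach +
  fixes scaleC :: "complex \<Rightarrow> 'a \<Rightarrow> 'a"  (infixr \<open>*\<^sub>C\<close> 75)
    and star :: "'a \<Rightarrow> 'a"  (\<open>_\<^sup>\<star>\<close> [1000] 999)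
  assumes scaleC_add_right: "c *\<^sub>C (x + y) = c *\<^sub>C x + c *\<^sub>C y"
    and scaleC_add_left: "(c + d) *\<^sub>C x = c *\<^sub>C x + d *\<^sub>C x"
    and scaleC_scaleC: "c *\<^sub>C d *\<^sub>C x = (c * d) *\<^sub>C x"
    and scaleR_eq_scaleC: "r *\<^sub>R x = complex_of_real r *\<^sub>C x"
    and mult_scaleC_left: "(c *\<^sub>C x) * y = c *\<^sub>C (x * y)"
    and mult_scaleC_right: "x * (c *\<^sub>C y) = c *\<^sub>C (x * y)"
    and norm_scaleC: "norm (c *\<^sub>C x) = cmod c * norm x"
    and star_star: "(x\<^sup>\<star>)\<^sup>\<star> = x"
    and star_add: "(x + y)\<^sup>\<star> = x\<^sup>\<star> + y\<^sup>\<star>"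
    and star_scaleC: "(c *\<^sub>C x)\<^sup>\<star> = cnj c *\<^sub>C x\<^sup>\<star>"
    and star_mult: "(x * y)\<^sup>\<star> = y\<^sup>\<star> * x\<^sup>\<star>"
    and cstar_identity: "norm (x\<^sup>\<star> * x) = (norm x)\<^sup>2"

definition star_subalgebra :: "'a::cstar_algebra set \<Rightarrow> bool" where
  "star_subalgebra B \<longleftrightarrow> 1 \<in> B \<and>
     (\<forall>x\<in>B. \<forall>y\<in>B. x + y \<in> B \<and> x * y \<in> B) \<and>
     (\<forall>c. \<forall>x\<in>B. c *\<^sub>C x \<in> B) \<and>
     (\<forall>x\<in>B. x\<^sup>\<star> \<in> B)"

definition star_automorphism :: "('a::cstar_algebra \<Rightarrow> 'a) \<Rightarrow> bool" where
  "star_automorphism \<alpha> \<longleftrightarrow> bij \<alpha> \<and>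
     (\<forall>x y. \<alpha> (x + y) = \<alpha> x + \<alpha> y) \<and>
     (\<forall>c x. \<alpha> (c *\<^sub>C x) = c *\<^sub>C \<alpha> x) \<and>
     (\<forall>x y. \<alpha> (x * y) = \<alpha> x * \<alpha> y) \<and>
     (\<forall>x. \<alpha> (x\<^sup>\<star>) = (\<alpha> x)\<^sup>\<star>)"

text \<open>
  The type \<open>'a \<Rightarrow>\<^sub>L complex\<close> consists of the bounded real-linear functionals, so
  complex homogeneity is required explicitly.
\<close>

definition state :: "('a::cstar_algebra \<Rightarrow>\<^sub>L complex) \<Rightarrow> bool" where
  "state \<phi> \<longleftrightarrow> (\<forall>c x. blinfun_apply \<phi> (c *\<^sub>C x) = c * blinfun_apply \<phi> x) \<and>
     (\<forall>x. blinfun_apply \<phi> (x\<^sup>\<star> * x) \<in> \<real>\<^sub>\<ge>\<^sub>0) \<and>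
     blinfun_apply \<phi> 1 = 1"

text \<open>The weak-* topology is the topology of pointwise convergence.\<close>

abbreviation weak_star :: "('a::cstar_algebra \<Rightarrow>\<^sub>L complex) topology" where
  "weak_star \<equiv> strong_operator_topology"


section \<open>The CAR algebra and symmetric states\<close>

definition anticommutator :: "'a::ring \<Rightarrow> 'a \<Rightarrow> 'a" where
  "anticommutator x y = x * y + y * x"

text \<open>
  \<open>is_CAR a\<close>: the ambient C*-algebra, i.e. the whole type, is \<open>CAR(\<nat>)\<close> with annihilators
  \<open>a j\<close> and creators \<open>(a j)\<^sup>\<star>\<close>.
\<close>

definition is_CAR :: "(nat \<Rightarrow> 'a::cstar_algebra) \<Rightarrow> bool" where
  "is_CAR a \<longleftrightarrow>
     (\<forall>j k. anticommutator ((a j)\<^sup>\<star>) (a k) = (if j = k then 1 else 0) \<and>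
            anticommutator (a j) (a k) = 0 \<and>
            anticommutator ((a j)\<^sup>\<star>) ((a k)\<^sup>\<star>) = 0) \<and>
     (\<lambda>B. star_subalgebra B \<and> closed B) hull (range a \<union> range (\<lambda>j. (a j)\<^sup>\<star>)) = UNIV"

text \<open>
  The type \<open>nat perm\<close> is the group of permutations of \<open>nat\<close> that move only finitely many
  elements. When \<open>is_CAR a\<close> holds, the automorphism below exists, because a transposition of
  \<open>i\<close> and \<open>j\<close> is implemented by the self-adjoint unitary \<open>1 - (a i - a j)\<^sup>\<star> * (a i - a j)\<close>.
  It is unique, because *-automorphisms are isometric and \<open>a\<close> generates the algebra.
\<close>

definition perm_action :: "(nat \<Rightarrow> 'a::cstar_algebra) \<Rightarrow> nat perm \<Rightarrow> 'a \<Rightarrow> 'a" where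
  "perm_action a g = (THE \<alpha>. star_automorphism \<alpha> \<and> (\<forall>j. \<alpha> (a j) = a (perm.apply g j)))"

definition symmetric_states :: "(nat \<Rightarrow> 'a::cstar_algebra) \<Rightarrow> ('a \<Rightarrow>\<^sub>L complex) set" where
  "symmetric_states a =
     {\<phi>. state \<phi> \<and> (\<forall>g. blinfun_apply \<phi> \<circ> perm_action a g = blinfun_apply \<phi>)}"


section \<open>Choquet theory\<close>

text \<open>
  \<open>K\<close> is placed at height 1 in \<open>'v \<times> real\<close>, so that it is the base of a proper cone \<open>cone_over K\<close>
  regardless of its position in \<open>'v\<close>.
\<close>

definition cone_over :: "'v::real_vector set \<Rightarrow> ('v \<times> real) set" where
  "cone_over K = {(t *\<^sub>R x, t) |t x. 0 \<le> t \<and> x \<in> K}"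

definition cone_le :: "'w::ab_group_add set \<Rightarrow> 'w \<Rightarrow> 'w \<Rightarrow> bool" where
  "cone_le C u v \<longleftrightarrow> v - u \<in> C"

definition lattice_cone :: "'w::ab_group_add set \<Rightarrow> bool" where
  "lattice_cone C \<longleftrightarrow> (\<forall>u\<in>C. \<forall>v\<in>C.
     (\<exists>s\<in>C. cone_le C u s \<and> cone_le C v s \<and>
        (\<forall>w\<in>C. cone_le C u w \<and> cone_le C v w \<longrightarrow> cone_le C s w)) \<and>
     (\<exists>i\<in>C. cone_le C i u \<and> cone_le C i v \<and>
        (\<forall>w\<in>C. cone_le C w u \<and> cone_le C w v \<longrightarrow> cone_le C w i)))"

definition choquet_simplex :: "'v::real_vector topology \<Rightarrow> 'v set \<Rightarrow> bool" where
  "choquet_simplex T K \<longleftrightarrow> compactin T K \<and> convex K \<and> lattice_cone (cone_over K)"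

text \<open>Finite Radon measures on a Hausdorff space (on a compact space, Radon measures are finite).\<close>

definition radon_measure :: "'v topology \<Rightarrow> 'v measure \<Rightarrow> bool" where
  "radon_measure X M \<longleftrightarrow> finite_measure M \<and>
     sets M = sets (sigma (topspace X) {U. openin X U}) \<and>
     (\<forall>B\<in>sets M. emeasure M B = (SUP C\<in>{C. compactin X C \<and> C \<subseteq> B}. emeasure M C))"

definition choquet_le ::
    "'v::real_vector topology \<Rightarrow> 'v set \<Rightarrow> 'v measure \<Rightarrow> 'v measure \<Rightarrow> bool" where
  "choquet_le T K \<mu> \<nu> \<longleftrightarrow>
     (\<forall>f. continuous_map (subtopology T K) euclideanreal f \<and> convex_on K f \<longrightarrow>
        (LINT x|\<mu>. f x) \<le> (LINT x|\<nu>. f x))"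

text \<open>
  Applied to the convex functions 1 and -1, \<open>choquet_le\<close> forces equal total mass, so for
  probability measures it does not matter that \<open>\<nu>\<close> ranges over all Radon measures on \<open>K\<close>.
\<close>

definition maximal_radon_measure ::
    "'v::real_vector topology \<Rightarrow> 'v set \<Rightarrow> 'v measure \<Rightarrow> bool" where
  "maximal_radon_measure T K \<mu> \<longleftrightarrow> radon_measure (subtopology T K) \<mu> \<and>
     (\<forall>\<nu>. radon_measure (subtopology T K) \<nu> \<and> choquet_le T K \<mu> \<nu> \<longrightarrow> \<nu> = \<mu>)"

definition maximal_representing_measure ::
    "(nat \<Rightarrow> 'a::cstar_algebra) \<Rightarrow> ('a \<Rightarrow>\<^sub>L complex) \<Rightarrow> ('a \<Rightarrow>\<^sub>L complex) measure \<Rightarrow> bool" where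
  "maximal_representing_measure a \<phi> \<mu> \<longleftrightarrow>
     prob_space \<mu> \<and> maximal_radon_measure weak_star (symmetric_states a) \<mu> \<and>
     (\<forall>A. blinfun_apply \<phi> A = (LINT \<psi>|\<mu>. blinfun_apply \<psi> A))"

end

theory Submission
  imports Defs "HOL-Combinatorics.Permutations"
begin

text \<open>
  For a symmetric state \<open>\<phi>\<close> and a monomial \<open>X\<close> with an off-diagonal factor \<open>a j\<close>, symmetry allows
  one to replace \<open>a j\<close> by an average of \<open>n\<close> fresh annihilators, whose norm is at most \<open>1 / sqrt n\<close>;
  hence \<open>\<phi> X = 0\<close>. So \<open>\<phi>\<close> is determined by its values \<open>m k\<close> on products of \<open>k\<close> distinct number
  operators. These are commuting projections, so \<open>m\<close> is completely monotone and, by Hausdorff,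
  the moment sequence of a unique probability measure \<open>M\<close> on \<open>[0, 1]\<close>. Therefore
  \<open>\<phi> = \<integral> \<omega>\<^sub>l dM(l)\<close> for the even product states \<open>\<omega>\<^sub>l\<close>, and the cone over the symmetric states is the
  cone of finite measures on \<open>[0, 1]\<close>, a lattice.

  The variance of \<open>M\<close> is a concave continuous function of \<open>\<phi>\<close> that vanishes exactly at the \<open>\<omega>\<^sub>l\<close>,
  which are the extreme points. It shows that the image of \<open>M\<close> under \<open>l \<mapsto> \<omega>\<^sub>l\<close> is maximal. By
  Jensen's inequality this image dominates every measure representing \<open>\<phi>\<close>, so it is the only
  maximal one.
\<close>


section \<open>C*-algebras and their states\<close>

text \<open>The algebra is given only by generators and relations, so there is no representation
  from which to take the product states. They are built inside the algebra: a minimal projection of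
  the first \<open>n\<close> modes compresses every element of these modes to a scalar, and it is
  nonzero because conjugates of it add up to \<open>1\<close>. This scalar is a pure product state,
  and averaging it over occupation numbers gives \<open>\<omega>\<^sub>l\<close> on the dense
  algebra of finitely many modes. Contractivity of states is not deduced from positivity. Until the
  decomposition is known, only the boundedness built into the type of functionals is used;
  afterwards the norm bound is inherited from the product states, and weak-* compactness follows.
  Bernstein polynomials act three times: they show that moments determine a measure, they supply the
  discrete approximants for the moment problem, and they replace a measurable choice of representing
  measures in the Choquet comparison, because a Bernstein sum is affine in the state.\<close>

lemma scaleC_zero_right [simp]: "c *\<^sub>C (0::'a::cstar_algebra) = 0"
  using scaleC_add_right[of c 0 0] by simp

lemma scaleC_zero_left [simp]: "0 *\<^sub>C (x::'a::cstar_algebra) = 0"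
  using scaleC_add_left[of 0 0 x] by simp

lemma scaleC_one [simp]: "1 *\<^sub>C (x::'a::cstar_algebra) = x"
  using scaleR_eq_scaleC[of 1 x] by simp

lemma scaleC_minus_left: "(- c) *\<^sub>C x = - (c *\<^sub>C (x::'a::cstar_algebra))"
  using scaleC_add_left[of "-c" c x] by (simp add: eq_neg_iff_add_eq_0)

lemma scaleC_minus_right: "c *\<^sub>C (- x) = - (c *\<^sub>C (x::'a::cstar_algebra))"
  using scaleC_add_right[of c "-x" x] by (simp add: eq_neg_iff_add_eq_0)

lemma scaleC_diff_right: "c *\<^sub>C (x - y) = c *\<^sub>C x - c *\<^sub>C (y::'a::cstar_algebra)"
  using scaleC_add_right[of c x "-y"] by (simp add: scaleC_minus_right)

lemma scaleC_cancel: "c *\<^sub>C x = d *\<^sub>C (x::'a::cstar_algebra) \<longleftrightarrow> c = d \<or> x = 0"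
proof
  assume "c *\<^sub>C x = d *\<^sub>C x"
  then have "(c - d) *\<^sub>C x = 0"
    using scaleC_add_left[of "c - d" d x] by simp
  then have "cmod (c - d) * norm x = 0"
    by (metis norm_scaleC norm_zero)
  then show "c = d \<or> x = 0" by auto
qed auto

lemma bounded_linear_scaleC: "bounded_linear (\<lambda>x::'a::cstar_algebra. c *\<^sub>C x)"
  by (rule bounded_linear_intro[where K = "cmod c"])
     (simp_all add: scaleC_add_right scaleR_eq_scaleC scaleC_scaleC norm_scaleC mult.commute)

lemmas tendsto_scaleC = bounded_linear.tendsto[OF bounded_linear_scaleC]

lemma norm_star [simp]: "norm (x\<^sup>\<star>) = norm (x::'a::cstar_algebra)"
proof -
  have le: "norm y \<le> norm (y\<^sup>\<star>)" for y :: 'a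
  proof (cases "norm y = 0")
    case False
    have "(norm y)\<^sup>2 \<le> norm (y\<^sup>\<star>) * norm y"
      using norm_mult_ineq[of "y\<^sup>\<star>" y] by (simp add: cstar_identity)
    then show ?thesis using False by (simp add: power2_eq_square)
  qed simp
  show ?thesis using le[of x] le[of "x\<^sup>\<star>"] by (simp add: star_star)
qed

lemma bounded_linear_star: "bounded_linear (star :: 'a::cstar_algebra \<Rightarrow> 'a)"
  by (rule bounded_linear_intro[where K = 1])
     (simp_all add: star_add scaleR_eq_scaleC star_scaleC)

lemmas tendsto_star = bounded_linear.tendsto[OF bounded_linear_star]

lemma star_zero [simp]: "(0::'a::cstar_algebra)\<^sup>\<star> = 0"
  by (metis norm_eq_zero norm_star)

lemma star_one [simp]: "(1::'a::cstar_algebra)\<^sup>\<star> = 1"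
  by (metis mult_1_right star_mult star_star)

lemma star_diff: "(x - y)\<^sup>\<star> = x\<^sup>\<star> - (y::'a::cstar_algebra)\<^sup>\<star>"
  by (rule linear_diff[OF bounded_linear.linear[OF bounded_linear_star]])

lemma star_minus: "(- x)\<^sup>\<star> = - (x::'a::cstar_algebra)\<^sup>\<star>"
  using star_diff[of 0 x] by simp

lemma star_sum: "(sum f A)\<^sup>\<star> = (\<Sum>i\<in>A. ((f i)::'a::cstar_algebra)\<^sup>\<star>)"
  by (rule linear_sum[OF bounded_linear.linear[OF bounded_linear_star]])

lemma star_power: "(x ^ n)\<^sup>\<star> = (x\<^sup>\<star> ^ n :: 'a::cstar_algebra)"
  by (induction n) (simp_all add: star_mult power_commutes)

lemma norm_unitary:
  assumes "u\<^sup>\<star> * u = (1::'a::cstar_algebra)" shows "norm u = 1"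
  using cstar_identity[of u] assms by (simp add: power2_eq_1_iff) (use norm_ge_zero[of u] in linarith)

section \<open>Square roots and the continuity of automorphisms\<close>

text \<open>Lets a geometric series dominate the binomial series: consecutive coefficients have
  ratio \<open>(1/2 - k) / (k + 1)\<close>, of absolute value at most 1.\<close>

lemma abs_gbinomial_half_le_1: "\<bar>(1/2::real) gchoose k\<bar> \<le> 1"
proof (induction k)
  case (Suc k)
  have "real (Suc k) * ((1/2) gchoose Suc k) = (1/2 - real k) * ((1/2) gchoose k)"
    by (simp add: gbinomial_mult_1 algebra_simps)
  then have eq: "(1/2) gchoose Suc k = (1/2 - real k) / real (Suc k) * ((1/2::real) gchoose k)"
    by (simp add: field_simps)
  have "\<bar>1/2 - real k\<bar> / real (Suc k) \<le> 1" by (auto simp: abs_if field_simps)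
  with Suc.IH have "\<bar>1/2 - real k\<bar> / real (Suc k) * \<bar>(1/2) gchoose k\<bar> \<le> 1"
    by (intro mult_le_one) auto
  then show ?case unfolding eq abs_mult by simp
qed simp

text \<open>The square root is the binomial series of exponent \<open>1/2\<close>.\<close>

lemma sqrt_one_minus:
  fixes z :: "'a::cstar_algebra"
  assumes z: "norm z < 1" and sa: "z\<^sup>\<star> = z" and comm: "h * z = z * h"
  obtains k where "k * k = 1 - z" "k\<^sup>\<star> = k" "h * k = k * h"
proof -
  define f where "f k = ((1/2::real) gchoose k) *\<^sub>R (- z) ^ k" for k
  have nf: "norm (f k) \<le> norm z ^ k" for k
  proof -
    have "norm (f k) \<le> 1 * norm z ^ k"
      unfolding f_def norm_scaleR
      by (intro mult_mono) (use abs_gbinomial_half_le_1[of k] norm_power_ineq[of "-z" k] in auto)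
    then show ?thesis by simp
  qed
  have sn: "summable (\<lambda>k. norm (f k))"
    by (rule summable_comparison_test'[where g = "\<lambda>k. norm z ^ k" and N = 0])
       (use z nf in \<open>auto simp: summable_geometric\<close>)
  then have s: "summable f" by (rule summable_norm_cancel)
  define k where "k = suminf f"
  have "(\<lambda>n. \<Sum>i\<le>n. f i * f (n - i)) sums (k * k)"
    unfolding k_def by (rule Cauchy_product_sums[OF sn sn])
  \<comment> \<open>Vandermonde turns the coefficient into \<open>1 gchoose n\<close>: the squared
    series is the binomial series of exponent 1, which has two terms.\<close>
  moreover have "(\<Sum>i\<le>n. f i * f (n - i)) = (if n = 0 then 1 else if n = 1 then - z else 0)" for n
  proof -
    have "(\<Sum>i\<le>n. f i * f (n - i)) =
        (\<Sum>i\<le>n. (((1/2::real) gchoose i) * ((1/2) gchoose (n - i))) *\<^sub>R (- z) ^ n)"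
      by (rule sum.cong) (auto simp: f_def simp flip: power_add)
    also have "\<dots> = ((1::real) gchoose n) *\<^sub>R (- z) ^ n"
      using gbinomial_Vandermonde[of "1/2::real" "1/2" n]
      by (simp add: atLeast0AtMost flip: scaleR_left.sum)
    also have "(1::real) gchoose n = of_nat (1 choose n)"
      using binomial_gbinomial[of 1 n, where 'a = real] by simp
    finally show ?thesis by (cases n rule: nat.exhaust[case_names 0 Suc]) (auto simp: binomial_eq_0)
  qed
  moreover have "(\<lambda>n. if n = 0 then 1 else if n = 1 then - z else 0) sums (1 - z)"
    using sums_finite[of "{0,1::nat}" "\<lambda>n. if n = 0 then 1 else if n = 1 then - z else 0"] by simp
  ultimately have "k * k = 1 - z" by (simp add: sums_iff)
  moreover have "k\<^sup>\<star> = k"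
  proof -
    have "k\<^sup>\<star> = (\<Sum>i. (f i)\<^sup>\<star>)"
      unfolding k_def by (rule bounded_linear.suminf[OF bounded_linear_star s])
    also have "(\<lambda>i. (f i)\<^sup>\<star>) = f"
      by (simp add: f_def fun_eq_iff scaleR_eq_scaleC star_scaleC star_power star_minus sa)
    finally show ?thesis by (simp add: k_def)
  qed
  moreover have "h * k = k * h"
  proof -
    have "h * (- z) ^ i = (- z) ^ i * h" for i
      by (induction i) (auto simp: comm mult.assoc, metis comm mult.assoc)
    then have "(\<lambda>i. h * f i) = (\<lambda>i. f i * h)" by (simp add: f_def)
    then show ?thesis
      unfolding k_def using suminf_mult[OF s, of h] suminf_mult2[OF s, of h] by simp
  qed
  ultimately show ?thesis by (rule that)
qed

lemma star_automorphism_add: "star_automorphism \<alpha> \<Longrightarrow> \<alpha> (x + y) = \<alpha> x + \<alpha> y"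
  and star_automorphism_scaleC: "star_automorphism \<alpha> \<Longrightarrow> \<alpha> (c *\<^sub>C x) = c *\<^sub>C \<alpha> x"
  and star_automorphism_mult: "star_automorphism \<alpha> \<Longrightarrow> \<alpha> (x * y) = \<alpha> x * \<alpha> y"
  and star_automorphism_star: "star_automorphism \<alpha> \<Longrightarrow> \<alpha> (x\<^sup>\<star>) = (\<alpha> x)\<^sup>\<star>"
  and star_automorphism_bij: "star_automorphism \<alpha> \<Longrightarrow> bij \<alpha>"
  unfolding star_automorphism_def by auto

lemma star_automorphism_one:
  assumes "star_automorphism \<alpha>" shows "\<alpha> 1 = 1"
proof -
  obtain x where "\<alpha> x = 1" using star_automorphism_bij[OF assms] by (metis bij_pointE)
  then show ?thesis using star_automorphism_mult[OF assms, of 1 x] by simp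
qed

lemma star_automorphism_linear: "star_automorphism \<alpha> \<Longrightarrow> linear \<alpha>"
  by (rule linearI) (auto simp: star_automorphism_add scaleR_eq_scaleC star_automorphism_scaleC)

text \<open>
  A self-adjoint \<open>h\<close> with \<open>norm h < 1\<close> is the real part of the unitary \<open>h + \<i> (1 - h\<^sup>2)\<^sup>1\<^sup>/\<^sup>2\<close>,
  and an automorphism maps unitaries to unitaries.
\<close>

lemma star_automorphism_norm_le:
  fixes \<alpha> :: "'a::cstar_algebra \<Rightarrow> 'a"
  assumes "star_automorphism \<alpha>" shows "norm (\<alpha> x) \<le> norm x"
proof -
  note sa = star_automorphism_add[OF assms] star_automorphism_scaleC[OF assms]
    star_automorphism_mult[OF assms] star_automorphism_star[OF assms]
  have lin: "linear \<alpha>" by (rule star_automorphism_linear[OF assms])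
  have 1: "norm (\<alpha> h) \<le> 1" if h: "h\<^sup>\<star> = h" "norm h < 1" for h
  proof -
    have "norm (h * h) < 1"
      using cstar_identity[of h] h by (simp add: power_less_one_iff abs_square_less_1)
    then obtain k where k: "k * k = 1 - h * h" "k\<^sup>\<star> = k" "h * k = k * h"
      by (rule sqrt_one_minus[where h = h]) (auto simp: star_mult h mult.assoc)
    define u where "u = h + \<i> *\<^sub>C k"
    have us: "u\<^sup>\<star> = h - \<i> *\<^sub>C k"
      by (simp add: u_def star_add star_scaleC h k scaleC_minus_left)
    have "u\<^sup>\<star> * u = h * h + k * k"
      unfolding us by (simp add: u_def algebra_simps mult_scaleC_left mult_scaleC_right k(3) scaleC_scaleC
      scaleC_diff_right scaleC_add_right scaleC_minus_left)
    then have "u\<^sup>\<star> * u = 1" using k by simp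
    then have "(\<alpha> u)\<^sup>\<star> * \<alpha> u = 1" using star_automorphism_one[OF assms] by (metis sa(3,4))
    then have nu: "norm (\<alpha> u) = 1" by (rule norm_unitary)
    have "h + h = u + u\<^sup>\<star>" unfolding us by (simp add: u_def)
    then have "\<alpha> h + \<alpha> h = \<alpha> u + (\<alpha> u)\<^sup>\<star>" by (metis sa(1,4))
    then have "norm (2 *\<^sub>R \<alpha> h) \<le> norm (\<alpha> u) + norm ((\<alpha> u)\<^sup>\<star>)"
      by (metis norm_triangle_ineq scaleR_2)
    then show ?thesis using nu by simp
  qed
  have 2: "norm (\<alpha> h) \<le> norm h" if h: "h\<^sup>\<star> = h" for h
  proof (rule field_le_epsilon)
    fix e :: real assume e: "e > 0"
    \<comment> \<open>The margin \<open>e\<close> gives the strict bound that fact 1 asks for and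
      keeps \<open>t\<close> positive when \<open>h = 0\<close>.\<close>
    define t where "t = norm h + e"
    have t: "t > 0" "norm h < t" using e by (auto simp: t_def add_nonneg_pos)
    have "norm ((1/t) *\<^sub>R h) < 1" using t by (simp add: field_simps)
    then have "norm (\<alpha> ((1/t) *\<^sub>R h)) \<le> 1"
      by (intro 1) (use h in \<open>auto simp: scaleR_eq_scaleC star_scaleC\<close>)
    then show "norm (\<alpha> h) \<le> norm h + e"
      using t(1) by (simp add: linear_scale[OF lin] pos_divide_le_eq) (simp add: t_def)
  qed
  \<comment> \<open>The C*-identity reduces the general case to a self-adjoint element.\<close>
  have "(norm (\<alpha> x))\<^sup>2 = norm (\<alpha> (x\<^sup>\<star> * x))" by (simp add: sa cstar_identity)
  also have "\<dots> \<le> norm (x\<^sup>\<star> * x)" by (rule 2) (simp add: star_mult star_star)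
  finally show ?thesis by (simp add: cstar_identity)
qed

lemma star_automorphism_bounded_linear: "star_automorphism \<alpha> \<Longrightarrow> bounded_linear \<alpha>"
  by (rule bounded_linear_intro[where K = 1])
     (simp_all add: star_automorphism_norm_le star_automorphism_add scaleR_eq_scaleC star_automorphism_scaleC)

lemma star_automorphism_id: "star_automorphism id"
  by (simp add: star_automorphism_def)

lemma star_automorphism_comp: "star_automorphism \<alpha> \<Longrightarrow> star_automorphism \<beta> \<Longrightarrow> star_automorphism (\<alpha> \<circ> \<beta>)"
  by (auto simp: star_automorphism_def bij_comp)

lemma star_automorphism_conj:
  assumes u: "u\<^sup>\<star> = u" "u * u = (1::'a::cstar_algebra)"
  shows "star_automorphism (\<lambda>x. u * x * u)"
proof -
  have uu: "u * (u * x) = x" for x by (metis mult.assoc mult_1 u(2))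
  show ?thesis
    unfolding star_automorphism_def
    by (intro conjI allI o_bij[where f="\<lambda>x. u * x * u" and g = "\<lambda>x. u * x * u"])
       (simp_all add: fun_eq_iff uu u(2) distrib_left distrib_right mult_scaleC_left mult_scaleC_right star_mult u(1) mult.assoc)
qed

lemma state_scaleC: "state \<phi> \<Longrightarrow> blinfun_apply \<phi> (c *\<^sub>C x) = c * blinfun_apply \<phi> x"
  and state_pos: "state \<phi> \<Longrightarrow> blinfun_apply \<phi> (x\<^sup>\<star> * x) \<in> \<real>\<^sub>\<ge>\<^sub>0"
  and state_one: "state \<phi> \<Longrightarrow> blinfun_apply \<phi> 1 = 1"
  unfolding state_def by auto

lemma nonneg_Reals_eq_of_real: "z \<in> \<real>\<^sub>\<ge>\<^sub>0 \<Longrightarrow> z = of_real (Re z) \<and> 0 \<le> Re z"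
  by (auto elim!: nonneg_Reals_cases)

section \<open>Extension by density, and the weak-* topology\<close>

text \<open>Linearity is required on \<open>D\<close> only, because \<open>f\<close> will be a limit
  whose convergence is known only for local elements.\<close>

lemma bounded_linear_extension_dense:
  fixes f :: "'v::real_normed_vector \<Rightarrow> 'w::banach"
  assumes D: "subspace D" "closure D = UNIV"
    and add: "\<And>x y. x \<in> D \<Longrightarrow> y \<in> D \<Longrightarrow> f (x + y) = f x + f y"
    and scale: "\<And>r x. x \<in> D \<Longrightarrow> f (r *\<^sub>R x) = r *\<^sub>R f x"
    and bound: "\<And>x. x \<in> D \<Longrightarrow> norm (f x) \<le> K * norm x"
  shows "\<exists>F. bounded_linear F \<and> (\<forall>x\<in>D. F x = f x) \<and> (\<forall>x. norm (F x) \<le> K * norm x)"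
proof -
  have diff: "f (x - y) = f x - f y" if "x \<in> D" "y \<in> D" for x y
    using add[of x "- y"] scale[of y "- 1"] that subspace_neg[OF D(1)] by simp
  have "uniformly_continuous_on D f"
    unfolding uniformly_continuous_on_def
  proof (intro allI impI)
    fix e :: real assume e: "e > 0"
    \<comment> \<open>The divisor \<open>\<bar>K\<bar> + 1\<close> is positive whatever the sign of
      \<open>K\<close>.\<close>
    define d where "d = e / (\<bar>K\<bar> + 1)"
    have "dist (f y) (f x) < e" if "x \<in> D" "y \<in> D" "dist y x < d" for x y
    proof -
      have "dist (f y) (f x) \<le> K * norm (y - x)"
        using bound[of "y - x"] subspace_diff[OF D(1)] that by (simp add: dist_norm diff)
      also have "\<dots> \<le> (\<bar>K\<bar> + 1) * norm (y - x)" by (intro mult_right_mono) auto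
      also have "\<dots> < e" using that(3) by (simp add: d_def dist_norm field_simps)
      finally show ?thesis .
    qed
    then show "\<exists>d>0. \<forall>x\<in>D. \<forall>y\<in>D. dist y x < d \<longrightarrow> dist (f y) (f x) < e"
      using e by (intro exI[of _ d]) (auto simp: d_def)
  qed
  from uniformly_continuous_on_extension_on_closure[OF this] obtain F where
    F: "uniformly_continuous_on UNIV F" "\<And>x. x \<in> D \<Longrightarrow> f x = F x"
    using D(2) by metis
  have lim: "\<exists>u. (\<forall>n. u n \<in> D) \<and> u \<longlonglongrightarrow> x \<and> (\<lambda>n. f (u n)) \<longlonglongrightarrow> F x" for x
  proof -
    obtain u where u: "\<And>n. u n \<in> D" "u \<longlonglongrightarrow> x"
      using D(2) by (metis UNIV_I closure_sequential)
    have "isCont F x"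
      using uniformly_continuous_imp_continuous[OF F(1)] by (simp add: continuous_on_eq_continuous_at)
    then have "(\<lambda>n. F (u n)) \<longlonglongrightarrow> F x" using u(2) isCont_tendsto_compose by blast
    then show ?thesis using u F(2) by (intro exI[of _ u]) simp
  qed
  have cont: "(\<lambda>n. F (u n)) \<longlonglongrightarrow> F x" if "u \<longlonglongrightarrow> x" for u x
    using uniformly_continuous_imp_continuous[OF F(1)] that
    by (metis UNIV_I continuous_on_eq_continuous_at isCont_tendsto_compose open_UNIV)
  have "norm (F x) \<le> norm x * K" for x
  proof -
    obtain u where u: "\<And>n. u n \<in> D" "u \<longlonglongrightarrow> x" "(\<lambda>n. f (u n)) \<longlonglongrightarrow> F x" using lim by blast
    show ?thesis
      by (rule LIMSEQ_le[OF tendsto_norm[OF u(3)] tendsto_mult_right[OF tendsto_norm[OF u(2)], of K]])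
         (use bound u(1) in \<open>auto simp: mult.commute\<close>)
  qed
  moreover have "F (x + y) = F x + F y" for x y
  proof -
    obtain u where u: "\<And>n. u n \<in> D" "u \<longlonglongrightarrow> x" "(\<lambda>n. f (u n)) \<longlonglongrightarrow> F x" using lim by blast
    obtain v where v: "\<And>n. v n \<in> D" "v \<longlonglongrightarrow> y" "(\<lambda>n. f (v n)) \<longlonglongrightarrow> F y" using lim by blast
    have "F (u n + v n) = f (u n) + f (v n)" for n
      using u(1) v(1) add F(2) subspace_add[OF D(1)] by metis
    then show ?thesis
      using cont[OF tendsto_add[OF u(2) v(2)]] tendsto_add[OF u(3) v(3)] LIMSEQ_unique by auto
  qed
  moreover have "F (r *\<^sub>R x) = r *\<^sub>R F x" for r x
  proof -
    obtain u where u: "\<And>n. u n \<in> D" "u \<longlonglongrightarrow> x" "(\<lambda>n. f (u n)) \<longlonglongrightarrow> F x" using lim by blast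
    have "F (r *\<^sub>R u n) = r *\<^sub>R f (u n)" for n
      using u(1) scale F(2) subspace_scale[OF D(1)] by metis
    then have "(\<lambda>n. F (r *\<^sub>R u n)) \<longlonglongrightarrow> r *\<^sub>R F x"
      using tendsto_scaleR[OF tendsto_const u(3)] by simp
    then show ?thesis
      by (rule LIMSEQ_unique[OF cont[OF tendsto_scaleR[OF tendsto_const u(2)]]])
  qed
  ultimately show ?thesis
    using F(2) by (intro exI[of _ F]) (auto intro!: bounded_linear_intro simp: mult.commute)
qed

declare strong_operator_topology_topspace [simp]

text \<open>The topology is the pullback of the product topology along \<open>blinfun_apply\<close>,
  so a cover is the preimage of a cover of the image. Compactness thus moves to a space of
  functions, where Tychonoff's theorem is available.\<close>

lemma compactin_strong_operator_topology:
  fixes S :: "('b::real_normed_vector \<Rightarrow>\<^sub>L 'c::real_normed_vector) set"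
  assumes "compact (blinfun_apply ` S)"
  shows "compactin strong_operator_topology S"
  unfolding compactin_def
proof (intro conjI allI impI)
  fix \<U> :: "('b \<Rightarrow>\<^sub>L 'c) set set"
  assume \<U>: "Ball \<U> (openin strong_operator_topology) \<and> S \<subseteq> \<Union> \<U>"
  have "\<exists>V. open V \<and> U = blinfun_apply -` V" if "U \<in> \<U>" for U
  proof -
    have "openin strong_operator_topology U" using \<U> that by blast
    then obtain V where "openin euclidean V" "U = blinfun_apply -` V \<inter> UNIV"
      unfolding strong_operator_topology_def openin_pullback_topology by blast
    then show ?thesis by (intro exI[of _ V] conjI) (simp_all only: open_openin Int_UNIV_right)
  qed
  then have "\<forall>U\<in>\<U>. \<exists>V. open V \<and> U = blinfun_apply -` V" by (intro ballI)
  from bchoice[OF this] obtain V where V: "\<forall>U\<in>\<U>. open (V U) \<and> U = blinfun_apply -` V U" ..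
  have V1: "open (V U)" if "U \<in> \<U>" for U using bspec[OF V that] by (rule conjunct1)
  have V2: "U = blinfun_apply -` V U" if "U \<in> \<U>" for U using bspec[OF V that] by (rule conjunct2)
  have "blinfun_apply ` S \<subseteq> (\<Union>U\<in>\<U>. V U)"
  proof
    fix f assume "f \<in> blinfun_apply ` S"
    then obtain \<phi> U where "f = blinfun_apply \<phi>" "U \<in> \<U>" "\<phi> \<in> U" using \<U> by blast
    then show "f \<in> (\<Union>U\<in>\<U>. V U)" using V2[of U] by blast
  qed
  with assms V1 obtain \<F> where "\<F> \<subseteq> \<U>" "finite \<F>" "blinfun_apply ` S \<subseteq> (\<Union>U\<in>\<F>. V U)"
    by (meson compactE_image)
  moreover have "S \<subseteq> \<Union> \<F>"
  proof
    fix \<phi> assume "\<phi> \<in> S"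
    then obtain U where U: "U \<in> \<F>" "blinfun_apply \<phi> \<in> V U"
      using \<open>blinfun_apply ` S \<subseteq> (\<Union>U\<in>\<F>. V U)\<close> by blast
    then have "\<phi> \<in> U" using V2[of U] \<open>\<F> \<subseteq> \<U>\<close> by blast
    then show "\<phi> \<in> \<Union> \<F>" using U(1) by blast
  qed
  ultimately show "\<exists>\<F>. finite \<F> \<and> \<F> \<subseteq> \<U> \<and> S \<subseteq> \<Union> \<F>" by blast
qed (simp add: strong_operator_topology_topspace)

lemma limitin_strong_operator_topology:
  fixes u :: "nat \<Rightarrow> 'b::real_normed_vector \<Rightarrow>\<^sub>L 'c::real_normed_vector"
  assumes "\<And>x. (\<lambda>n. blinfun_apply (u n) x) \<longlonglongrightarrow> blinfun_apply l x"
  shows "limitin strong_operator_topology u l sequentially"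
proof -
  have "limitin (product_topology (\<lambda>_. euclidean) UNIV) (\<lambda>n. blinfun_apply (u n)) (blinfun_apply l) sequentially"
    using assms by (simp add: limitin_componentwise)
  then have lim: "limitin euclidean (\<lambda>n. blinfun_apply (u n)) (blinfun_apply l) sequentially"
    by (simp only: euclidean_product_topology)
  show ?thesis
    unfolding limitin_def
  proof (intro conjI allI impI)
    fix U assume U: "openin strong_operator_topology U \<and> l \<in> U"
    then obtain V where V: "openin euclidean V" "U = blinfun_apply -` V \<inter> UNIV"
      unfolding strong_operator_topology_def openin_pullback_topology by blast
    then have "\<forall>\<^sub>F n in sequentially. blinfun_apply (u n) \<in> V"
      using lim U unfolding limitin_def by blast
    then show "\<forall>\<^sub>F n in sequentially. u n \<in> U"
      by eventually_elim (simp add: V(2))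
  qed simp
qed


section \<open>The CAR algebra\<close>

locale car =
  fixes a :: "nat \<Rightarrow> 'a::cstar_algebra"
  assumes is_CAR: "is_CAR a"
begin

lemma car_star_same: "(a j)\<^sup>\<star> * a j + a j * (a j)\<^sup>\<star> = 1"
  and car_star_diff: "j \<noteq> k \<Longrightarrow> (a j)\<^sup>\<star> * a k = - (a k * (a j)\<^sup>\<star>)"
  and car_anticomm: "a j * a k = - (a k * a j)"
  and car_star_anticomm: "(a j)\<^sup>\<star> * (a k)\<^sup>\<star> = - ((a k)\<^sup>\<star> * (a j)\<^sup>\<star>)"
  and car_generates: "(\<lambda>B. star_subalgebra B \<and> closed B) hull (range a \<union> range (\<lambda>j. (a j)\<^sup>\<star>)) = UNIV"
  using is_CAR unfolding is_CAR_def anticommutator_def by (auto simp: eq_neg_iff_add_eq_0 split: if_splits)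

lemma car_square: "a j * a j = 0"
  using car_anticomm[of j j] by (simp add: eq_neg_iff_add_eq_0 flip: scaleR_2)

lemma car_star_square: "(a j)\<^sup>\<star> * (a j)\<^sup>\<star> = 0"
  by (metis car_square star_mult star_zero)

text \<open>\<open>munit p q j\<close> are the matrix units of the \<open>j\<close>-th mode, indexed by its occupation number.\<close>

fun munit :: "bool \<Rightarrow> bool \<Rightarrow> nat \<Rightarrow> 'a" where
  "munit True True j = (a j)\<^sup>\<star> * a j"
| "munit True False j = (a j)\<^sup>\<star>"
| "munit False True j = a j"
| "munit False False j = a j * (a j)\<^sup>\<star>"

lemma munit_sum: "munit True True j + munit False False j = 1"
  by (simp add: car_star_same)

lemma munit_star: "(munit p q j)\<^sup>\<star> = munit q p j"
  by (cases p; cases q) (simp_all add: star_mult star_star)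

lemma munit_mult: "munit p q j * munit r s j = (if q = r then munit p s j else 0)"
proof -
  have 1: "a j * (a j)\<^sup>\<star> = 1 - (a j)\<^sup>\<star> * a j" using car_star_same[of j] by (simp add: eq_diff_eq add.commute)
  have 2: "a j * ((a j)\<^sup>\<star> * x) = x - (a j)\<^sup>\<star> * (a j * x)" for x
    unfolding mult.assoc[symmetric] 1 by (simp only: left_diff_distrib mult_1)
  have 3: "a j * (a j * x) = 0" "(a j)\<^sup>\<star> * ((a j)\<^sup>\<star> * x) = 0" for x
    by (simp_all add: car_square car_star_square flip: mult.assoc)
  show ?thesis
    by (cases p; cases q; cases r; cases s)
       (simp_all add: mult.assoc 1 2 3 right_diff_distrib left_diff_distrib car_square car_star_square)
qed

text \<open>Parity: a matrix unit is odd exactly when it is off-diagonal, and across different modes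
  a sign appears only between two odd elements.\<close>

lemma munit_commute:
  assumes "i \<noteq> j"
  shows "munit p q i * munit r s j = (if p \<noteq> q \<and> r \<noteq> s then - 1 else 1) *\<^sub>R (munit r s j * munit p q i)"
proof -
  have 1: "a i * a j = - (a j * a i)" "(a i)\<^sup>\<star> * (a j)\<^sup>\<star> = - ((a j)\<^sup>\<star> * (a i)\<^sup>\<star>)"
    "(a i)\<^sup>\<star> * a j = - (a j * (a i)\<^sup>\<star>)" "a i * (a j)\<^sup>\<star> = - ((a j)\<^sup>\<star> * a i)"
    using car_anticomm car_star_anticomm car_star_diff assms by (auto simp: eq_neg_iff_add_eq_0 add.commute)
  have 2: "a i * (a j * x) = - (a j * (a i * x))" "(a i)\<^sup>\<star> * ((a j)\<^sup>\<star> * x) = - ((a j)\<^sup>\<star> * ((a i)\<^sup>\<star> * x))"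
    "(a i)\<^sup>\<star> * (a j * x) = - (a j * ((a i)\<^sup>\<star> * x))" "a i * ((a j)\<^sup>\<star> * x) = - ((a j)\<^sup>\<star> * (a i * x))" for x
    using arg_cong[OF 1(1), of "\<lambda>y. y * x"] arg_cong[OF 1(2), of "\<lambda>y. y * x"]
      arg_cong[OF 1(3), of "\<lambda>y. y * x"] arg_cong[OF 1(4), of "\<lambda>y. y * x"] by (simp_all add: mult.assoc)
  show ?thesis
    by (cases p; cases q; cases r; cases s) (simp_all add: mult.assoc 1 2)
qed

text \<open>A word is a list of matrix units \<open>(p, q, j)\<close>; the modes \<open>j\<close> will always be distinct.\<close>

definition word :: "(bool \<times> bool \<times> nat) list \<Rightarrow> 'a" where
  "word w = prod_list (map (\<lambda>(p, q, j). munit p q j) w)"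

definition modes :: "(bool \<times> bool \<times> nat) list \<Rightarrow> nat list" where
  "modes w = map (\<lambda>(p, q, j). j) w"

lemma word_simps [simp]:
  "word [] = 1" "word ((p, q, j) # w) = munit p q j * word w" "word (v @ w) = word v * word w"
  by (simp_all add: word_def)

lemma modes_simps [simp]:
  "modes [] = []" "modes ((p, q, j) # w) = j # modes w" "modes (v @ w) = modes v @ modes w"
  by (simp_all add: modes_def)

lemma munit_word_commute:
  assumes "j \<notin> set (modes w)"
  shows "\<exists>e\<in>{1, -1}. munit r s j * word w = e *\<^sub>R (word w * munit r s j)"
  using assms
proof (induction w)
  case (Cons l w)
  obtain p q i where l: "l = (p, q, i)" by (cases l)
  from Cons l obtain e where e: "e \<in> {1, -1}" "munit r s j * word w = e *\<^sub>R (word w * munit r s j)"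
    by (metis list.set_intros(2) modes_simps(2))
  define d :: real where "d = (if r \<noteq> s \<and> p \<noteq> q then - 1 else 1)"
  have "munit r s j * word (l # w) = (munit r s j * munit p q i) * word w"
    by (simp add: l mult.assoc)
  also have "\<dots> = d *\<^sub>R (munit p q i * (munit r s j * word w))"
    using munit_commute[of j i r s p q] Cons.prems l by (simp add: d_def mult.assoc)
  also have "\<dots> = (d * e) *\<^sub>R (word (l # w) * munit r s j)"
    by (simp add: e l mult.assoc)
  finally show ?case using e(1) by (intro bexI[of _ "d * e"]) (auto simp: d_def)
qed simp

lemma projection_word_commute:
  assumes "j \<notin> set (modes w)"
  shows "munit r r j * word w = word w * munit r r j"
  using assms
proof (induction w)
  case (Cons l w)
  obtain p q i where l: "l = (p, q, i)" by (cases l)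
  have "munit r r j * word (l # w) = (munit r r j * munit p q i) * word w"
    by (simp add: l mult.assoc)
  also have "\<dots> = munit p q i * (munit r r j * word w)"
    using munit_commute[of j i r r p q] Cons.prems l by (simp add: mult.assoc)
  also have "\<dots> = word (l # w) * munit r r j"
    using Cons l by (simp add: mult.assoc)
  finally show ?case .
qed simp

text \<open>Why words with distinct modes span an algebra: the new letter travels, at the price of a
  sign, to the letter of its own mode and merges with it. \<open>e\<close> carries the sign, and it
  is 0 when the inner indices differ.\<close>

lemma munit_times_word:
  assumes "distinct (modes w)"
  shows "\<exists>e w'. distinct (modes w') \<and> set (modes w') \<subseteq> insert j (set (modes w)) \<and>
    munit r s j * word w = e *\<^sub>R word w'"
proof (cases "j \<in> set (modes w)")
  case False
  then show ?thesis using assms by (intro exI[of _ 1] exI[of _ "(r, s, j) # w"]) auto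
next
  case True
  then obtain p q where "(p, q, j) \<in> set w" by (auto simp: modes_def)
  then obtain v u where w: "w = v @ (p, q, j) # u" by (meson split_list)
  with assms have jv: "j \<notin> set (modes v)" by auto
  from munit_word_commute[OF this, of r s] obtain e where
    e: "munit r s j * word v = e *\<^sub>R (word v * munit r s j)" by blast
  have "munit r s j * word w = (munit r s j * word v) * (munit p q j * word u)"
    by (simp add: w mult.assoc)
  also have "\<dots> = e *\<^sub>R (word v * ((munit r s j * munit p q j) * word u))"
    by (simp add: e mult.assoc)
  finally have eq: "munit r s j * word w = e *\<^sub>R (word v * ((munit r s j * munit p q j) * word u))" .
  show ?thesis
  proof (cases "s = p")
    case True
    then show ?thesis using eq assms
      by (intro exI[of _ e] exI[of _ "v @ (r, q, j) # u"]) (auto simp: munit_mult w)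
  next
    case False
    then show ?thesis using eq assms by (intro exI[of _ 0] exI[of _ w]) (auto simp: munit_mult)
  qed
qed

lemma word_star: "(word w)\<^sup>\<star> = word (rev (map (\<lambda>(p, q, j). (q, p, j)) w))"
  by (induction w) (auto simp: star_mult munit_star)

section \<open>Local subalgebras and their density\<close>

text \<open>\<open>span\<close> is taken over the reals, so the complex coefficients are put into
  the spanning set.\<close>

definition local :: "nat set \<Rightarrow> 'a set" where
  "local F = span {c *\<^sub>C word w |c w. distinct (modes w) \<and> set (modes w) \<subseteq> F}"

lemma local_induct [consumes 1, case_names word subspace]:
  assumes "x \<in> local F"
    and "\<And>c w. distinct (modes w) \<Longrightarrow> set (modes w) \<subseteq> F \<Longrightarrow> P (c *\<^sub>C word w)"
    and "subspace {x. P x}"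
  shows "P x"
  using assms(1) unfolding local_def by (rule span_induct) (use assms in auto)

lemma subspace_local: "subspace (local F)"
  by (simp add: local_def)

lemma word_in_local: "distinct (modes w) \<Longrightarrow> set (modes w) \<subseteq> F \<Longrightarrow> c *\<^sub>C word w \<in> local F"
  unfolding local_def by (rule span_base) auto

lemma word_in_local': "distinct (modes w) \<Longrightarrow> set (modes w) \<subseteq> F \<Longrightarrow> word w \<in> local F"
  using word_in_local[of w F 1] by simp

lemma local_mono: "F \<subseteq> G \<Longrightarrow> local F \<subseteq> local G"
  unfolding local_def by (rule span_mono) auto

lemma local_one: "1 \<in> local F"
  using word_in_local'[of "[]"] by simp

lemma local_scaleC:
  assumes "x \<in> local F" shows "c *\<^sub>C x \<in> local F"
  using assms
proof (induction rule: local_induct)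
  case subspace
  show ?case
    using subspace_local[of F]
    by (auto simp: subspace_def scaleC_add_right scaleR_eq_scaleC scaleC_scaleC)
       (metis mult.commute scaleC_scaleC)
qed (simp add: scaleC_scaleC word_in_local)

lemma local_munit_mult:
  assumes "x \<in> local F" "j \<in> F" shows "munit r s j * x \<in> local F"
  using assms(1)
proof (induction rule: local_induct)
  case (word c w)
  from munit_times_word[OF word(1), of j r s] obtain e w' where
    w': "distinct (modes w')" "set (modes w') \<subseteq> insert j (set (modes w))" "munit r s j * word w = e *\<^sub>R word w'"
    by blast
  then have "c *\<^sub>C of_real e *\<^sub>C word w' \<in> local F"
    using word assms(2) by (intro local_scaleC word_in_local') auto
  then show ?case by (simp add: mult_scaleC_right w'(3) scaleR_eq_scaleC)
next
  case subspace
  show ?case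
    using subspace_local[of F] by (auto simp: subspace_def distrib_left)
qed

lemma local_word_mult:
  assumes "x \<in> local F" "set (modes w) \<subseteq> F" shows "word w * x \<in> local F"
  using assms(2) by (induction w) (auto simp: assms(1) mult.assoc local_munit_mult)

lemma local_mult:
  assumes "x \<in> local F" "y \<in> local F" shows "x * y \<in> local F"
  using assms(1)
proof (induction rule: local_induct)
  case (word c w)
  then show ?case by (simp add: mult_scaleC_left local_scaleC local_word_mult assms(2))
next
  case subspace
  show ?case using subspace_local[of F] by (auto simp: subspace_def distrib_right)
qed

lemma local_star:
  assumes "x \<in> local F" shows "x\<^sup>\<star> \<in> local F"
  using assms
proof (induction rule: local_induct)
  case (word c w)
  have "modes (rev (map (\<lambda>(p, q, j). (q, p, j)) w)) = rev (modes w)"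
    by (auto simp: modes_def rev_map)
  then show ?case using word by (simp add: star_scaleC word_star word_in_local)
next
  case subspace
  show ?case using subspace_local[of F]
    by (auto simp: subspace_def star_add scaleR_eq_scaleC star_scaleC)
qed

lemma local_finite:
  assumes "x \<in> local UNIV" shows "\<exists>n. x \<in> local {..<n}"
  using assms
proof (induction rule: local_induct)
  case (word c w)
  \<comment> \<open>\<open>insert 0\<close> keeps \<open>Max\<close> meaningful for the empty
    word.\<close>
  then show ?case
    by (intro exI[of _ "Suc (Max (insert 0 (set (modes w))))"] word_in_local)
       (auto simp: less_Suc_eq_le)
next
  case subspace
  have "x + y \<in> local {..<max n m}" if "x \<in> local {..<n}" "y \<in> local {..<m}" for x y n m
    using that local_mono[of "{..<n}" "{..<max n m}"] local_mono[of "{..<m}" "{..<max n m}"]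
    by (intro subspace_add[OF subspace_local]) auto
  moreover have "c *\<^sub>R x \<in> local {..<n}" if "x \<in> local {..<n}" for c x n
    by (rule subspace_scale[OF subspace_local that])
  ultimately show ?case
    unfolding subspace_def using subspace_0[OF subspace_local] by blast
qed

text \<open>The closure is itself a closed star subalgebra containing the generators, hence contains
  their hull, which is everything.\<close>

lemma closure_local: "closure (local UNIV) = UNIV"
proof -
  let ?C = "closure (local UNIV)"
  have "star_subalgebra ?C"
    unfolding star_subalgebra_def
  proof (intro conjI ballI allI)
    show "1 \<in> ?C" using local_one closure_subset by blast
  next
    fix x y assume "x \<in> ?C" "y \<in> ?C"
    then obtain f g where f: "\<And>n. f n \<in> local UNIV" "f \<longlonglongrightarrow> x" and g: "\<And>n. g n \<in> local UNIV" "g \<longlonglongrightarrow> y"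
      by (auto simp: closure_sequential)
    show "x + y \<in> ?C"
      unfolding closure_sequential using tendsto_add[OF f(2) g(2)] f(1) g(1) subspace_add[OF subspace_local]
      by (intro exI[of _ "\<lambda>n. f n + g n"]) auto
    show "x * y \<in> ?C"
      unfolding closure_sequential using tendsto_mult[OF f(2) g(2)] f(1) g(1) local_mult
      by (intro exI[of _ "\<lambda>n. f n * g n"]) auto
  next
    fix c x assume "x \<in> ?C"
    then obtain f where f: "\<And>n. f n \<in> local UNIV" "f \<longlonglongrightarrow> x" by (auto simp: closure_sequential)
    show "c *\<^sub>C x \<in> ?C"
      unfolding closure_sequential using tendsto_scaleC[OF f(2)] f(1) local_scaleC
      by (intro exI[of _ "\<lambda>n. c *\<^sub>C f n"]) auto
  next
    fix x assume "x \<in> ?C"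
    then obtain f where f: "\<And>n. f n \<in> local UNIV" "f \<longlonglongrightarrow> x" by (auto simp: closure_sequential)
    show "x\<^sup>\<star> \<in> ?C"
      unfolding closure_sequential using tendsto_star[OF f(2)] f(1) local_star
      by (intro exI[of _ "\<lambda>n. (f n)\<^sup>\<star>"]) auto
  qed
  moreover have "range a \<union> range (\<lambda>j. (a j)\<^sup>\<star>) \<subseteq> ?C"
  proof -
    have "munit p q j \<in> ?C" for p q j
      using word_in_local'[of "[(p, q, j)]" UNIV] closure_subset by auto
    from this[of False True] this[of True False] show ?thesis by auto
  qed
  ultimately have "(\<lambda>B. star_subalgebra B \<and> closed B) hull (range a \<union> range (\<lambda>j. (a j)\<^sup>\<star>)) \<subseteq> ?C"
    by (intro hull_minimal) auto
  then show ?thesis using car_generates by auto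
qed

text \<open>Both maps are only real linear, so agreement is tested on all complex multiples of
  words; density and continuity do the rest.\<close>

lemma bounded_linear_eqI:
  assumes "bounded_linear f" "bounded_linear g"
    and "\<And>c w. distinct (modes w) \<Longrightarrow> f (c *\<^sub>C word w) = g (c *\<^sub>C word w)"
  shows "f = g"
proof
  fix x
  have "f x = g x" if "x \<in> local UNIV" for x
    using that
  proof (induction rule: local_induct)
    case subspace
    show ?case
      using assms(1,2)[THEN bounded_linear.linear] by (auto simp: subspace_def linear_0 linear_add linear_cmul)
  qed (use assms(3) in auto)
  moreover have "continuous_on UNIV f" "continuous_on UNIV g"
    using assms(1,2) linear_continuous_on by blast+
  then have "closed {x. f x = g x}" by (intro closed_Collect_eq)
  ultimately have "closure (local UNIV) \<subseteq> {x. f x = g x}"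
    by (intro closure_minimal) auto
  then show "f x = g x" using closure_local by auto
qed


subsection \<open>The action of finite permutations\<close>

text \<open>Since \<open>d * d = 0\<close> and the anticommutator of \<open>d\<^sup>\<star>\<close>
  and \<open>d\<close> is 2, \<open>d / sqrt 2\<close> is an annihilator, and \<open>u\<close> is
  the parity operator of its mode. Conjugation by \<open>u\<close> therefore sends \<open>d\<close>
  to \<open>- d\<close> and fixes the orthogonal combination \<open>a i + a j\<close>, which means
  that it swaps \<open>a i\<close> and \<open>a j\<close>.\<close>

lemma transposition_automorphism:
  assumes "i \<noteq> j"
  shows "\<exists>\<alpha>. star_automorphism \<alpha> \<and> (\<forall>k. \<alpha> (a k) = a (Transposition.transpose i j k))"
proof -
  define d where "d = a i - a j"
  define u where "u = 1 - d\<^sup>\<star> * d"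
  have i1: "(a i)\<^sup>\<star> * a i = 1 - a i * (a i)\<^sup>\<star>" and j1: "(a j)\<^sup>\<star> * a j = 1 - a j * (a j)\<^sup>\<star>"
    using car_star_same[of i] car_star_same[of j] by (simp_all add: eq_diff_eq)
  have ac: "d * a k = - (a k * d)" for k
    unfolding d_def left_diff_distrib right_diff_distrib using car_anticomm[of i k] car_anticomm[of j k] by simp
  have sac: "d\<^sup>\<star> * a k = (if k = i then 1 else if k = j then - 1 else 0) - a k * d\<^sup>\<star>" for k
    unfolding d_def star_diff left_diff_distrib right_diff_distrib
    using car_star_diff[of i k] car_star_diff[of j k] i1 j1 assms by auto
  have dx: "d * x = a i * x - a j * x" and xd: "x * d = x * a i - x * a j" for x
    by (simp_all add: d_def left_diff_distrib right_diff_distrib)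
  have "d\<^sup>\<star> * d = (1 - a i * d\<^sup>\<star>) - (- 1 - a j * d\<^sup>\<star>)"
    using assms by (simp add: xd[of "d\<^sup>\<star>"] sac)
  then have sd: "d\<^sup>\<star> * d = 2 - d * d\<^sup>\<star>" by (simp add: dx[of "d\<^sup>\<star>"])
  have "d * d = - (d * d)" by (subst xd, subst dx) (simp add: ac xd)
  then have dd: "d * d = 0" by (simp add: eq_neg_iff_add_eq_0 flip: scaleR_2)
  have "d * (d\<^sup>\<star> * d) = d * 2 - (d * d) * d\<^sup>\<star>" by (simp only: sd right_diff_distrib mult.assoc)
  then have dsd: "d * (d\<^sup>\<star> * d) = 2 * d" by (simp add: dd mult_2 mult_2_right)
  have us: "u\<^sup>\<star> = u" by (simp add: u_def star_diff star_mult star_star)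
  have uu: "u * u = 1"
    by (simp add: u_def left_diff_distrib right_diff_distrib mult.assoc dsd) (simp add: mult_2 distrib_left)
  have ua: "u * a k = a (Transposition.transpose i j k) * u" for k
  proof -
    have e: "u * a k = a k + (if k = i then d else if k = j then - d else 0) - a k * (d\<^sup>\<star> * d)"
    proof -
      have "d\<^sup>\<star> * d * a k = - (d\<^sup>\<star> * a k * d)" by (simp add: mult.assoc ac)
      also have "\<dots> = - (if k = i then d else if k = j then - d else 0) + a k * (d\<^sup>\<star> * d)"
        by (simp add: sac left_diff_distrib mult.assoc)
      finally show ?thesis by (simp add: u_def left_diff_distrib)
    qed
    have ai: "a i * (d\<^sup>\<star> * d) = a j * (d\<^sup>\<star> * d) + 2 * d"
      using dsd dx[of "d\<^sup>\<star> * d"] by (simp add: diff_eq_eq add.commute)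
    show ?thesis
    proof (cases "k = i \<or> k = j")
      case True
      then show ?thesis
      proof
        assume "k = i"
        then show ?thesis unfolding e by (simp add: u_def right_diff_distrib ai mult_2) (simp add: d_def)
      next
        assume "k = j"
        then show ?thesis using assms unfolding e by (simp add: u_def right_diff_distrib ai mult_2) (simp add: d_def)
      qed
    next
      case False
      then show ?thesis unfolding e by (simp add: u_def right_diff_distrib)
    qed
  qed
  have "u * a k * u = a (Transposition.transpose i j k)" for k
    by (simp add: ua mult.assoc uu)
  then show ?thesis using star_automorphism_conj[OF us uu] by (intro exI[of _ "\<lambda>x. u * x * u"]) auto
qed

text \<open>Induction over transpositions multiplied from the right, hence the automorphism of the
  new transposition is applied first.\<close>

lemma permutes_automorphism:
  assumes "finite S" "p permutes S"
  shows "\<exists>\<alpha>. star_automorphism \<alpha> \<and> (\<forall>k. \<alpha> (a k) = a (p k))"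
  using assms
proof (induction rule: permutes_rev_induct)
  case id
  then show ?case by (intro exI[of _ id]) (simp add: star_automorphism_id del: id_apply, simp)
next
  case (swap i j p)
  then obtain \<alpha> where \<alpha>: "star_automorphism \<alpha>" "\<And>k. \<alpha> (a k) = a (p k)" by auto
  show ?case
  proof (cases "i = j")
    case False
    then obtain \<beta> where \<beta>: "star_automorphism \<beta>" "\<And>k. \<beta> (a k) = a (Transposition.transpose i j k)"
      using transposition_automorphism by blast
    show ?thesis
      using star_automorphism_comp[OF \<alpha>(1) \<beta>(1)]
      by (intro exI[of _ "\<lambda>x. \<alpha> (\<beta> x)"]) (simp add: o_def \<alpha>(2) \<beta>(2))
  qed (use \<alpha> in \<open>auto simp: Transposition.transpose_def o_def\<close>)
qed

lemma automorphism_munit: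
  assumes "star_automorphism \<alpha>" "\<And>k. \<alpha> (a k) = a (p k)"
  shows "\<alpha> (munit r s k) = munit r s (p k)"
  by (cases r; cases s)
     (simp_all add: star_automorphism_mult[OF assms(1)] star_automorphism_star[OF assms(1)] assms(2))

lemma automorphism_word:
  assumes "star_automorphism \<alpha>" "\<And>k. \<alpha> (a k) = a (p k)"
  shows "\<alpha> (word w) = word (map (\<lambda>(r, s, k). (r, s, p k)) w)"
  by (induction w)
     (auto simp: star_automorphism_mult[OF assms(1)] star_automorphism_one[OF assms(1)] automorphism_munit[OF assms])

text \<open>Justifies the \<open>THE\<close>: two such automorphisms agree on words, and both are
  continuous by \<open>star_automorphism_norm_le\<close>.\<close>

lemma perm_action:
  "star_automorphism (perm_action a g)" "perm_action a g (a k) = a (perm.apply g k)"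
proof -
  let ?P = "\<lambda>\<alpha>. star_automorphism \<alpha> \<and> (\<forall>j. \<alpha> (a j) = a (perm.apply g j))"
  have "perm.apply g permutes affected g"
    unfolding permutes_def by (metis bij_apply bij_pointE in_affected)
  then obtain \<alpha> where \<alpha>: "?P \<alpha>"
    using permutes_automorphism[of "affected g" "perm.apply g"] by auto
  have "\<beta> = \<alpha>" if "?P \<beta>" for \<beta>
    using that \<alpha>
    by (intro bounded_linear_eqI)
       (auto simp: star_automorphism_bounded_linear star_automorphism_scaleC automorphism_word)
  with \<alpha> have "?P (perm_action a g)"
    unfolding perm_action_def by (rule theI)
  then show "star_automorphism (perm_action a g)" "perm_action a g (a k) = a (perm.apply g k)" by auto
qed

lemmas perm_action_word = automorphism_word[OF perm_action]

text \<open>The sum \<open>S\<close> satisfies \<open>S * S = 0\<close>, and its anticommutator with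
  \<open>S\<^sup>\<star>\<close> is \<open>card F\<close>. Hence the square of
  \<open>S\<^sup>\<star> * S\<close> is \<open>card F\<close> times
  \<open>S\<^sup>\<star> * S\<close>, and the C*-identity turns this into a bound. The triangle
  inequality would lose the square root that the averaging argument needs.\<close>

lemma norm_sum_annihilators:
  assumes "finite F"
  shows "(norm (\<Sum>i\<in>F. a i))\<^sup>2 \<le> card F"
proof -
  define S where "S = (\<Sum>i\<in>F. a i)"
  have "S * S = (\<Sum>i\<in>F. \<Sum>j\<in>F. a i * a j)" by (simp add: S_def sum_product)
  also have "\<dots> = - (\<Sum>i\<in>F. \<Sum>j\<in>F. a j * a i)"
    unfolding sum_negf[symmetric] by (intro sum.cong refl car_anticomm)
  also have "\<dots> = - (S * S)" by (subst sum.swap) (simp add: S_def sum_product)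
  finally have SS: "S * S = 0" by (simp add: eq_neg_iff_add_eq_0 flip: scaleR_2)
  have "S\<^sup>\<star> * S + S * S\<^sup>\<star> = (\<Sum>i\<in>F. \<Sum>j\<in>F. (a i)\<^sup>\<star> * a j + a j * (a i)\<^sup>\<star>)"
    by (simp add: S_def star_sum sum_product sum.distrib) (subst sum.swap, simp)
  also have "\<dots> = (\<Sum>i\<in>F. \<Sum>j\<in>F. if j = i then 1 else 0)"
    by (intro sum.cong refl) (auto simp: car_star_same car_star_diff)
  also have "\<dots> = of_nat (card F)" using assms by simp
  finally have 1: "S * S\<^sup>\<star> = of_nat (card F) - S\<^sup>\<star> * S" by (simp add: eq_diff_eq add.commute)
  have "(S\<^sup>\<star> * S) * (S\<^sup>\<star> * S) = S\<^sup>\<star> * (S * S\<^sup>\<star>) * S" by (simp add: mult.assoc)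
  also have "\<dots> = (S\<^sup>\<star> * of_nat (card F)) * S - S\<^sup>\<star> * (S\<^sup>\<star> * (S * S))"
    by (simp only: 1 right_diff_distrib left_diff_distrib mult.assoc)
  also have "\<dots> = of_nat (card F) * (S\<^sup>\<star> * S)"
    by (simp only: SS mult_of_nat_commute[symmetric] mult.assoc) simp
  finally have "(norm (S\<^sup>\<star> * S))\<^sup>2 = norm (of_nat (card F) * (S\<^sup>\<star> * S))"
    using cstar_identity[of "S\<^sup>\<star> * S"] by (simp add: star_mult star_star)
  also have "\<dots> \<le> card F * norm (S\<^sup>\<star> * S)"
    using norm_mult_ineq[of "of_nat (card F)" "S\<^sup>\<star> * S"] by simp
  finally have "norm (S\<^sup>\<star> * S) \<le> card F \<or> norm (S\<^sup>\<star> * S) = 0"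
    by (metis mult_le_cancel_right norm_ge_zero order_le_less power2_eq_square)
  then show ?thesis by (auto simp: cstar_identity S_def[symmetric])
qed

end

section \<open>Measures on the unit interval and their moments\<close>

text \<open>Kept as measures on the whole real line, so that distribution functions and weak
  convergence apply directly. Total mass is left free because the cone over the states needs all
  finite measures.\<close>

definition unit_measure :: "real measure \<Rightarrow> bool" where
  "unit_measure M \<longleftrightarrow> finite_measure M \<and> sets M = sets borel \<and> emeasure M (- {0..1}) = 0"

lemma unit_measure_finite: "unit_measure M \<Longrightarrow> finite_measure M"
  and unit_measure_sets [measurable_cong]: "unit_measure M \<Longrightarrow> sets M = sets borel"
  by (auto simp: unit_measure_def)

lemma unit_measure_space: "unit_measure M \<Longrightarrow> space M = UNIV"
  using sets_eq_imp_space_eq[of M borel] by (simp add: unit_measure_def)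

lemma unit_measure_AE: "unit_measure M \<Longrightarrow> AE x in M. x \<in> {0..1}"
  unfolding unit_measure_def by (intro AE_I[of _ _ "- {0..1}"]) auto

lemma unit_measure_integrable:
  fixes f :: "real \<Rightarrow> 'b::{banach, second_countable_topology}"
  assumes M: "unit_measure M" and f: "continuous_on UNIV f"
  shows "integrable M f"
proof -
  have "bounded (f ` {0..1})"
    using f by (intro compact_imp_bounded compact_continuous_image) (auto intro: continuous_on_subset)
  then obtain B where B: "\<And>x. x \<in> {0..1} \<Longrightarrow> norm (f x) \<le> B"
    unfolding bounded_iff by (metis image_eqI)
  have "f \<in> borel_measurable M"
    using borel_measurable_continuous_onI[OF f] unit_measure_sets[OF M] measurable_cong_sets by blast
  then show ?thesis
    by (intro finite_measure.integrable_const_bound[OF unit_measure_finite[OF M], where B = B]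
        eventually_mono[OF unit_measure_AE[OF M]] B)
qed

lemma unit_measure_integral_nonneg:
  fixes f :: "real \<Rightarrow> real"
  assumes "unit_measure M" "\<And>x. x \<in> {0..1} \<Longrightarrow> 0 \<le> f x"
  shows "0 \<le> (LINT x|M. f x)"
  by (intro integral_nonneg_AE eventually_mono[OF unit_measure_AE[OF assms(1)]] assms(2))

lemma unit_measure_norm_integral_le:
  fixes f :: "real \<Rightarrow> 'b::{banach, second_countable_topology}"
  assumes M: "unit_measure M" and f: "continuous_on UNIV f" and B: "\<And>x. x \<in> {0..1} \<Longrightarrow> norm (f x) \<le> B"
  shows "norm (LINT x|M. f x) \<le> B * measure M UNIV"
proof -
  have "norm (LINT x|M. f x) \<le> (LINT x|M. norm (f x))" by (rule integral_norm_bound)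
  also have "\<dots> \<le> (LINT x|M. B)"
    by (intro integral_mono_AE unit_measure_integrable[OF M] f continuous_intros
        eventually_mono[OF unit_measure_AE[OF M]] B)
  finally show ?thesis by (simp add: unit_measure_space[OF M] mult.commute)
qed

definition moment :: "real measure \<Rightarrow> nat \<Rightarrow> real" where
  "moment M k = (LINT x|M. x ^ k)"

text \<open>The signed finite difference \<open>(-1)^l \<Delta>^l m\<close> at \<open>k\<close>; for
  a moment sequence it is the integral of \<open>x^k (1 - x)^l\<close>. Nonnegativity of all of them
  is complete monotonicity.\<close>

fun differences :: "(nat \<Rightarrow> real) \<Rightarrow> nat \<Rightarrow> nat \<Rightarrow> real" where
  "differences m k 0 = m k"
| "differences m k (Suc l) = differences m k l - differences m (Suc k) l"

lemma moment_differences: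
  assumes "unit_measure M"
  shows "(LINT x|M. x ^ k * (1 - x) ^ l) = differences (moment M) k l"
proof (induction l arbitrary: k)
  case (Suc l)
  have "(LINT x|M. x ^ k * (1 - x) ^ Suc l) = (LINT x|M. x ^ k * (1 - x) ^ l - x ^ Suc k * (1 - x) ^ l)"
    by (rule arg_cong[where f = "integral\<^sup>L M"]) (auto simp: algebra_simps)
  also have "\<dots> = (LINT x|M. x ^ k * (1 - x) ^ l) - (LINT x|M. x ^ Suc k * (1 - x) ^ l)"
    by (intro Bochner_Integration.integral_diff unit_measure_integrable[OF assms] continuous_intros)
  finally show ?case by (simp only: differences.simps Suc)
qed (simp add: moment_def)

text \<open>The integral that a Bernstein polynomial would have under a measure with moments
  \<open>m\<close>. It is written in terms of \<open>m\<close> alone, so it makes sense before such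
  a measure is known, as the mass to be placed at \<open>k / n\<close>.\<close>

definition bernstein_weight :: "(nat \<Rightarrow> real) \<Rightarrow> nat \<Rightarrow> nat \<Rightarrow> real" where
  "bernstein_weight m n k = (n choose k) * differences m k (n - k)"

lemma integral_Bernstein:
  assumes "unit_measure M"
  shows "(LINT x|M. Bernstein n k x) = bernstein_weight (moment M) n k"
  by (simp add: Bernstein_def bernstein_weight_def mult.assoc flip: moment_differences[OF assms])

text \<open>\<open>N\<close> is chosen before \<open>M\<close>. This uniformity is what later
  permits one degree \<open>n\<close> for the representing measures of all symmetric states at
  once.\<close>

lemma bernstein_integral_approx:
  fixes f :: "real \<Rightarrow> real"
  assumes f: "continuous_on UNIV f" and e: "0 < e"
  shows "\<exists>N. \<forall>n\<ge>N. \<forall>M. unit_measure M \<longrightarrow>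
    \<bar>(LINT x|M. f x) - (\<Sum>k\<le>n. f (k / n) * bernstein_weight (moment M) n k)\<bar> \<le> e * measure M UNIV"
proof -
  obtain N where N: "\<And>n x. N \<le> n \<Longrightarrow> x \<in> {0..1} \<Longrightarrow> \<bar>f x - (\<Sum>k\<le>n. f(k/n) * Bernstein n k x)\<bar> < e"
    using Bernstein_Weierstrass[OF continuous_on_subset[OF f] e] by blast
  have "\<bar>(LINT x|M. f x) - (\<Sum>k\<le>n. f (k / n) * bernstein_weight (moment M) n k)\<bar> \<le> e * measure M UNIV"
    if n: "n \<ge> N" and M: "unit_measure M" for n M
  proof -
    have cB: "continuous_on UNIV (\<lambda>x. c * Bernstein n k x)" for k c
      unfolding Bernstein_def by (intro continuous_intros)
    have "(LINT x|M. f x) - (\<Sum>k\<le>n. f (k / n) * bernstein_weight (moment M) n k)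
      = (LINT x|M. f x) - (LINT x|M. (\<Sum>k\<le>n. f (k / n) * Bernstein n k x))"
      by (subst Bochner_Integration.integral_sum)
         (auto intro!: unit_measure_integrable[OF M] cB cB[of 1, simplified] simp: integral_Bernstein[OF M])
    also have "\<dots> = (LINT x|M. f x - (\<Sum>k\<le>n. f (k / n) * Bernstein n k x))"
      by (intro Bochner_Integration.integral_diff[symmetric] unit_measure_integrable[OF M] f continuous_on_sum cB)
    finally show ?thesis
      using unit_measure_norm_integral_le[OF M, of "\<lambda>x. f x - (\<Sum>k\<le>n. f (k / n) * Bernstein n k x)" e]
        N[OF n] f by (force intro!: continuous_on_diff continuous_on_sum cB)
  qed
  then show ?thesis by blast
qed

lemma bernstein_integral_tendsto:
  fixes f :: "real \<Rightarrow> real"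
  assumes f: "continuous_on UNIV f" and M: "unit_measure M"
  shows "(\<lambda>n. \<Sum>k\<le>n. f (k / n) * bernstein_weight (moment M) n k) \<longlonglongrightarrow> (LINT x|M. f x)"
proof (rule LIMSEQ_I)
  fix e :: real assume "e > 0"
  \<comment> \<open>The added 1 covers the zero measure and makes the final inequality
    strict.\<close>
  define d where "d = e / (measure M UNIV + 1)"
  have d: "d > 0" "d * measure M UNIV < e"
    using \<open>e > 0\<close> by (auto simp: d_def field_simps add_pos_nonneg)
  obtain N where "\<forall>n\<ge>N. \<forall>M. unit_measure M \<longrightarrow>
    \<bar>(LINT x|M. f x) - (\<Sum>k\<le>n. f (k / n) * bernstein_weight (moment M) n k)\<bar> \<le> d * measure M UNIV"
    using bernstein_integral_approx[OF f d(1)] by blast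
  then show "\<exists>N. \<forall>n\<ge>N. norm ((\<Sum>k\<le>n. f (k / n) * bernstein_weight (moment M) n k) - (LINT x|M. f x)) < e"
    using M d(2) by (intro exI[of _ N]) (force simp: abs_minus_commute)
qed

text \<open>Bernstein sums depend on the moments only, so integrals of continuous functions agree;
  approximating indicators of half-lines then identifies the distribution functions.\<close>

lemma unit_measure_eqI:
  assumes M: "unit_measure M" and N: "unit_measure N" and mom: "\<And>k. moment M k = moment N k"
  shows "M = N"
proof -
  have mm: "moment M = moment N" using mom by auto
  have eq: "(LINT x|M. f x) = (LINT x|N. f x)" if "continuous_on UNIV f" for f :: "real \<Rightarrow> real"
    using bernstein_integral_tendsto[OF that M] bernstein_integral_tendsto[OF that N]
    unfolding mm by (rule LIMSEQ_unique)
  \<comment> \<open>For positive \<open>n\<close>, equal to 1 up to \<open>b\<close>, then falling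
    linearly to 0 at \<open>b + 1 / n\<close>.\<close>
  define f where "f b n x = max 0 (min 1 (1 - real n * (x - b)))" for b x n
  have cf: "continuous_on UNIV (f b n)" for b n
    unfolding f_def by (intro continuous_intros)
  have f_le: "norm (f b n x) \<le> 1" for b n x by (simp add: f_def)
  have lim: "(\<lambda>n. LINT x|P. f b n x) \<longlonglongrightarrow> measure P {..b}" if P: "unit_measure P" for P b
  proof -
    have "(\<lambda>n. f b n x) \<longlonglongrightarrow> indicator {..b} x" for x
    proof (cases "x \<le> b")
      case True
      have "f b n x = 1" for n
      proof -
        have "real n * (x - b) \<le> 0" using True by (intro mult_nonneg_nonpos) auto
        then show ?thesis by (simp add: f_def)
      qed
      then show ?thesis using True by simp
    next
      case False
      obtain N where "1 < real N * (x - b)"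
        using reals_Archimedean3[of "x - b"] False by auto
      then have "f b n x = 0" if "n \<ge> N" for n
      proof -
        have "real N * (x - b) \<le> real n * (x - b)" using that False by (intro mult_right_mono) auto
        with \<open>1 < real N * (x - b)\<close> show ?thesis by (simp add: f_def)
      qed
      then have "(\<lambda>n. f b n x) \<longlonglongrightarrow> 0"
        by (intro tendsto_eventually) (auto simp: eventually_sequentially)
      then show ?thesis using False by simp
    qed
    moreover have "f b n \<in> borel_measurable P" for n
      using borel_measurable_continuous_onI[OF cf] unit_measure_sets[OF P] measurable_cong_sets by blast
    moreover have "indicator {..b} \<in> borel_measurable P"
      by (rule borel_measurable_indicator) (simp add: unit_measure_sets[OF P])
    ultimately have "(\<lambda>n. LINT x|P. f b n x) \<longlonglongrightarrow> (LINT x|P. indicator {..b} x)"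
      by (intro integral_dominated_convergence[where w = "\<lambda>_. 1"] AE_I2
          unit_measure_integrable[OF P] continuous_intros) (simp_all add: f_le[unfolded real_norm_def])
    then show ?thesis using unit_measure_space[OF P] by simp
  qed
  have "finite_borel_measure M" "finite_borel_measure N"
    using M N by (auto simp: unit_measure_def finite_borel_measure_def finite_borel_measure_axioms_def)
  moreover have "cdf M = cdf N"
    using LIMSEQ_unique[OF lim[OF M] lim[OF N, folded eq[OF cf]]] by (auto simp: cdf_def)
  ultimately show ?thesis by (rule cdf_unique')
qed


subsection \<open>The Hausdorff moment problem\<close>

text \<open>For moments this is \<open>x^k (1 - x)^l\<close> multiplied by the expansion of
  \<open>(x + (1 - x))^r = 1\<close>. The induction, by Pascal's rule, proves it for an arbitrary
  sequence, where no measure is available yet.\<close>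

lemma differences_binomial:
  "(\<Sum>i\<le>r. (r choose i) * differences m (k + i) (l + r - i)) = differences m k l"
proof (induction r arbitrary: l)
  case (Suc r)
  have "(\<Sum>i\<le>Suc r. real (Suc r choose i) * differences m (k + i) (l + Suc r - i))
     = differences m k (l + Suc r) + (\<Sum>i\<le>r. real ((r choose i) + (r choose Suc i)) * differences m (k + Suc i) (l + r - i))"
    by (subst sum.atMost_Suc_shift) simp
  also have "\<dots> = (\<Sum>i\<le>r. real (r choose i) * differences m (k + Suc i) (l + r - i))
     + (differences m k (l + Suc r) + (\<Sum>i\<le>r. real (r choose Suc i) * differences m (k + Suc i) (l + r - i)))"
    by (simp add: sum.distrib algebra_simps)
  also have "differences m k (l + Suc r) + (\<Sum>i\<le>r. real (r choose Suc i) * differences m (k + Suc i) (l + r - i))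
     = (\<Sum>i\<le>Suc r. real (r choose i) * differences m (k + i) (l + Suc r - i))"
    by (subst sum.atMost_Suc_shift) simp
  also have "\<dots> = (\<Sum>i\<le>r. real (r choose i) * differences m (k + i) (l + Suc r - i))"
    by (simp add: binomial_eq_0)
  also have "(\<Sum>i\<le>r. real (r choose i) * differences m (k + Suc i) (l + r - i)) + \<dots>
      = (\<Sum>i\<le>r. real (r choose i) * differences m (k + i) (l + r - i))"
    unfolding sum.distrib[symmetric]
  proof (intro sum.cong refl)
    fix i assume "i \<in> {..r}"
    then have "l + Suc r - i = Suc (l + r - i)" by auto
    then show "real (r choose i) * differences m (k + Suc i) (l + r - i) + real (r choose i) * differences m (k + i) (l + Suc r - i)
      = real (r choose i) * differences m (k + i) (l + r - i)"
      by (simp add: algebra_simps)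
  qed
  finally show ?case using Suc.IH by simp
qed simp

text \<open>The discrete distribution with these weights has exact normalised factorial moments. The
  case \<open>j = 0\<close> says that the weights add up to \<open>m 0\<close>.\<close>

lemma bernstein_weight_factorial_moment:
  assumes "j \<le> n"
  shows "(\<Sum>k\<le>n. (k choose j) / (n choose j) * bernstein_weight m n k) = m j"
proof -
  have "(\<Sum>k\<le>n. (k choose j) / (n choose j) * bernstein_weight m n k)
      = (\<Sum>k\<in>{j..n}. (k choose j) / (n choose j) * bernstein_weight m n k)"
    by (rule sum.mono_neutral_right) (auto simp: binomial_eq_0)
  also have "\<dots> = (\<Sum>i\<le>n - j. (n - j choose i) * differences m (j + i) (0 + (n - j) - i))"
  proof (rule sum.reindex_bij_witness[of _ "\<lambda>i. j + i" "\<lambda>k. k - j"])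
    fix k assume k: "k \<in> {j..n}"
    have "real (n choose k) * real (k choose j) = real (n choose j) * real (n - j choose (k - j))"
      using choose_mult[of j k n] k by (metis atLeastAtMost_iff of_nat_mult)
    moreover have "real (n choose j) > 0" using assms by simp
    ultimately show "real (n - j choose (k - j)) * differences m (j + (k - j)) (0 + (n - j) - (k - j))
      = real (k choose j) / real (n choose j) * bernstein_weight m n k"
      using k by (simp add: bernstein_weight_def field_simps)
  qed (use assms in auto)
  also have "\<dots> = m j" unfolding differences_binomial by simp
  finally show ?thesis .
qed

text \<open>A product of factors \<open>(k - i) / (n - i)\<close> is compared with a product of
  factors \<open>k / n\<close>; all have absolute value at most 1, so the errors add. The separate
  bound \<open>J\<close> keeps the error per factor fixed during the induction on
  \<open>j\<close>.\<close>

lemma falling_quotient_approx: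
  assumes n: "2 * J < n" and k: "k \<le> n" and j: "j \<le> J"
  shows "\<bar>real (k choose j) / real (n choose j) - (real k / real n) ^ j\<bar> \<le> real j * (real J / real (n - J))"
proof -
  have "real (k choose j) / real (n choose j) = (\<Prod>i<j. (real k - real i) / (real n - real i))"
    using gbinomial_prod_rev[of "real k" j] gbinomial_prod_rev[of "real n" j]
    by (simp add: binomial_gbinomial prod_dividef atLeast0LessThan)
  moreover have "\<bar>(\<Prod>i<j. (real k - real i) / (real n - real i)) - (real k / real n) ^ j\<bar>
      \<le> real j * (real J / real (n - J))"
    using j
  proof (induction j)
    case (Suc j)
    define q where "q = (real k - real j) / (real n - real j)"
    define p where "p = (\<Prod>i<j. (real k - real i) / (real n - real i))"
    have nj: "real n - real j > 0" "real n - real J > 0" using Suc.prems n by auto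
    \<comment> \<open>When \<open>k < j\<close> the numerator is negative, and the bound needs
      \<open>j \<le> n - j\<close>; this is where \<open>2 * J < n\<close> enters.\<close>
    have q1: "\<bar>q\<bar> \<le> 1" using k Suc.prems n nj by (auto simp: q_def abs_le_iff field_simps)
    have k1: "\<bar>(real k / real n) ^ j\<bar> \<le> 1" using k n by (simp add: power_le_one)
    have "q - real k / real n = - (real j * (real n - real k) / (real n * (real n - real j)))"
      using nj n by (simp add: q_def field_simps)
    then have "\<bar>q - real k / real n\<bar> = real j * (real n - real k) / (real n * (real n - real j))"
      using nj k by (simp add: abs_mult)
    also have "\<dots> \<le> real j * real n / (real n * (real n - real j))"
      using nj k n by (intro divide_right_mono mult_left_mono mult_nonneg_nonneg) auto
    also have "\<dots> = real j / (real n - real j)" using n by simp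
    also have "\<dots> \<le> real J / (real n - real J)"
      using Suc.prems nj by (intro frac_le) auto
    finally have qk: "\<bar>q - real k / real n\<bar> \<le> real J / real (n - J)"
      using n by (simp add: of_nat_diff)
    have "\<bar>p * q - (real k / real n) ^ j * (real k / real n)\<bar>
        = \<bar>(p - (real k / real n) ^ j) * q + (real k / real n) ^ j * (q - real k / real n)\<bar>"
      by (simp add: algebra_simps)
    also have "\<dots> \<le> \<bar>p - (real k / real n) ^ j\<bar> * \<bar>q\<bar> + \<bar>(real k / real n) ^ j\<bar> * \<bar>q - real k / real n\<bar>"
      by (metis abs_mult abs_triangle_ineq)
    also have "\<dots> \<le> (real j * (real J / real (n - J))) * 1 + 1 * (real J / real (n - J))"
      using Suc.IH Suc.prems q1 k1 qk by (intro add_mono mult_mono) (auto simp: p_def)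
    also have "\<dots> = real (Suc j) * (real J / real (n - J))" by (simp add: add_divide_distrib algebra_simps)
    finally show ?case by (simp add: p_def q_def mult.commute)
  qed simp
  ultimately show ?thesis by simp
qed

text \<open>The factorial moments of the weights are exact, and ordinary moments differ from them by
  a term of order \<open>1 / n\<close>.\<close>

lemma bernstein_weight_moment_tendsto:
  assumes nonneg: "\<And>k l. 0 \<le> differences m k l" and m0: "m 0 = 1"
  shows "(\<lambda>n. \<Sum>k\<le>n. (real k / real n) ^ j * bernstein_weight m n k) \<longlonglongrightarrow> m j"
proof (rule Lim_null[THEN iffD2], rule Lim_null_comparison)
  have w0: "0 \<le> bernstein_weight m n k" for n k by (simp add: bernstein_weight_def nonneg)
  have w1: "(\<Sum>k\<le>n. bernstein_weight m n k) = 1" for n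
    using bernstein_weight_factorial_moment[of 0 n m] m0 by simp
  show "\<forall>\<^sub>F n in sequentially. norm ((\<Sum>k\<le>n. (real k / real n) ^ j * bernstein_weight m n k) - m j)
      \<le> real j * (real j / real (n - j))"
    unfolding eventually_sequentially
  proof (intro exI[of _ "2 * j + 1"] allI impI)
    fix n assume n: "2 * j + 1 \<le> n"
    have "(\<Sum>k\<le>n. (real k / real n) ^ j * bernstein_weight m n k) - m j =
      (\<Sum>k\<le>n. ((real k / real n) ^ j - (k choose j) / (n choose j)) * bernstein_weight m n k)"
      using bernstein_weight_factorial_moment[of j n m] n
      by (simp add: left_diff_distrib sum_subtractf)
    also have "norm \<dots> \<le> (\<Sum>k\<le>n. (real j * (real j / real (n - j))) * bernstein_weight m n k)"
      unfolding real_norm_def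
    proof (intro order_trans[OF sum_abs] sum_mono)
      fix k assume "k \<in> {..n}"
      then have "\<bar>(real k / real n) ^ j - (k choose j) / (n choose j)\<bar> \<le> real j * (real j / real (n - j))"
        using falling_quotient_approx[of j n k j] n by (simp add: abs_minus_commute)
      then show "\<bar>((real k / real n) ^ j - (k choose j) / (n choose j)) * bernstein_weight m n k\<bar>
          \<le> real j * (real j / real (n - j)) * bernstein_weight m n k"
        unfolding abs_mult using w0[of n k] by (intro mult_mono) auto
    qed
    also have "\<dots> = real j * (real j / real (n - j))"
      unfolding sum_distrib_left[symmetric] w1 by simp
    finally show "norm ((\<Sum>k\<le>n. (real k / real n) ^ j * bernstein_weight m n k) - m j) \<le> real j * (real j / real (n - j))" .
  qed
  have "filterlim (\<lambda>n. real (n - j)) at_top sequentially"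
    by (intro filterlim_compose[OF filterlim_real_sequentially] filterlim_minus_const_nat_at_top)
  then show "(\<lambda>n. real j * (real j / real (n - j))) \<longlonglongrightarrow> 0"
    by (intro tendsto_mult_right_zero tendsto_divide_0[OF tendsto_const] filterlim_at_top_imp_at_infinity)
qed

theorem hausdorff_moment:
  assumes nonneg: "\<And>k l. 0 \<le> differences m k l" and m0: "m 0 = 1"
  shows "\<exists>M. unit_measure M \<and> moment M = m"
proof -
  have w0: "0 \<le> bernstein_weight m n k" for n k by (simp add: bernstein_weight_def nonneg)
  have w1: "(\<Sum>k\<le>n. bernstein_weight m n k) = 1" for n
    using bernstein_weight_factorial_moment[of 0 n m] m0 by simp
  define p where "p n = embed_pmf (bernstein_weight m n)" for n
  have supp: "bernstein_weight m n k = 0" if "k \<notin> {..n}" for n k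
    using that by (simp add: bernstein_weight_def binomial_eq_0)
  have nn: "(\<integral>\<^sup>+ x. ennreal (bernstein_weight m n x) \<partial>count_space UNIV) = 1" for n
  proof -
    have "(\<integral>\<^sup>+ x. ennreal (bernstein_weight m n x) \<partial>count_space UNIV) = (\<Sum>k\<le>n. ennreal (bernstein_weight m n k))"
      by (rule nn_integral_count_space') (auto simp: supp)
    then show ?thesis by (simp add: sum_ennreal w0 w1)
  qed
  have pmf_p: "pmf (p n) k = bernstein_weight m n k" for n k
    unfolding p_def by (rule pmf_embed_pmf[OF w0 nn])
  have set_p: "set_pmf (p n) \<subseteq> {..n}" for n
    using supp by (auto simp: set_pmf_eq pmf_p)
  define \<nu> where "\<nu> n = distr (measure_pmf (p n)) borel (\<lambda>k. real k / real n)" for n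
  have rd: "real_distribution (\<nu> n)" for n
    unfolding \<nu>_def real_distribution_def real_distribution_axioms_def
    by (auto intro!: measure_pmf.prob_space_distr)
  have int: "(LINT x|\<nu> n. f x) = (\<Sum>k\<le>n. f (k / n) * bernstein_weight m n k)"
    if "f \<in> borel_measurable borel" for n and f :: "real \<Rightarrow> real"
    unfolding \<nu>_def using that set_p[of n]
    by (subst integral_distr) (auto simp: integral_measure_pmf_real[where A = "{..n}"] pmf_p subset_iff)
  \<comment> \<open>Tightness is phrased with half-open intervals, so the left end has to lie below
    the possible atom 0.\<close>
  have "measure (\<nu> n) {- 1<..1} = 1" for n
  proof -
    have "real k / real n \<le> 1" if "k \<in> set_pmf (p n)" for k
      using that set_p[of n] by (auto simp: divide_le_eq)
    moreover have "- 1 < real k / real n" for k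
      by (rule less_le_trans[of _ 0]) auto
    ultimately have "AE k in measure_pmf (p n). k \<in> (\<lambda>k. real k / real n) -` {- 1<..1}"
      by (auto simp: AE_measure_pmf_iff)
    then show ?thesis
      unfolding \<nu>_def by (subst measure_distr) (auto simp: measure_pmf.prob_eq_1)
  qed
  then have "tight \<nu>"
    unfolding tight_def by (intro conjI allI impI rd exI[of _ "- 1"] exI[of _ 1]) auto
  from tight_imp_convergent_subsubsequence[OF this strict_mono_id] obtain r M
    where r: "strict_mono r" and M: "real_distribution M" and w: "weak_conv_m (\<nu> \<circ> r) M"
    by (auto simp: o_def)
  interpret M: real_distribution M by fact
  have conv: "(\<lambda>n. LINT x|\<nu> (r n). f x) \<longlonglongrightarrow> (LINT x|M. f x)"
    if "continuous_on UNIV f" "\<And>x. \<bar>f x\<bar> \<le> B" for f :: "real \<Rightarrow> real" and B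
    using weak_conv_imp_integral_bdd_continuous_conv[OF _ M w, of f B] that rd
    by (auto simp: continuous_on_eq_continuous_at)
  \<comment> \<open>Weak convergence tests bounded functions only. Clamping to the unit interval
    makes the powers bounded without changing them at the atoms \<open>k / n\<close>.\<close>
  define c where "c x = max 0 (min 1 (x::real))" for x
  have c: "continuous_on UNIV c" unfolding c_def by (intro continuous_intros)
  have ck: "c (real k / real n) = real k / real n" if "k \<le> n" for k n
  proof -
    have "real k / real n \<le> 1" using that by (cases "n = 0") auto
    then show ?thesis by (simp add: c_def)
  qed
  \<comment> \<open>The truncated distance to the unit interval: it vanishes at all atoms, so its
    integral against the limit is 0, which confines the limit to that interval.\<close>
  define g where "g x = min 1 \<bar>x - c x\<bar>" for x
  have g: "continuous_on UNIV g" unfolding g_def by (intro continuous_intros c)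
  have "(LINT x|\<nu> n. g x) = 0" for n
    unfolding int[OF borel_measurable_continuous_onI[OF g]]
    by (rule sum.neutral) (simp add: g_def ck)
  then have "(LINT x|M. g x) = 0"
    using conv[OF g, of 1] by (auto simp: g_def LIMSEQ_const_iff)
  moreover have "integrable M g"
    using borel_measurable_continuous_onI[OF g] by (intro M.integrable_const_bound[of _ 1]) (auto simp: g_def)
  ultimately have "AE x in M. g x = 0"
    by (subst (asm) integral_nonneg_eq_0_iff_AE) (auto simp: g_def)
  then have AE: "AE x in M. x \<in> {0..1}"
  proof (rule eventually_mono)
    fix x assume "g x = 0"
    then have "x = c x" by (simp add: g_def min_def split: if_splits)
    moreover have "c x \<in> {0..1}" by (simp add: c_def)
    ultimately show "x \<in> {0..1}" by simp
  qed
  have "{x \<in> space M. \<not> x \<in> {0..1}} = - {0..1}" by auto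
  from iffD1[OF AE_iff_measurable[OF _ this] AE] have um: "unit_measure M"
    unfolding unit_measure_def using M.finite_measure_axioms by simp
  have "moment M j = m j" for j
  proof -
    have cj: "continuous_on UNIV (\<lambda>x. c x ^ j)" by (intro continuous_intros c)
    have "moment M j = (LINT x|M. c x ^ j)"
      unfolding moment_def
    proof (rule integral_cong_AE)
      show "AE x in M. x ^ j = c x ^ j"
        by (rule eventually_mono[OF AE]) (simp add: c_def)
    qed (use borel_measurable_continuous_onI[OF cj] in auto)
    moreover have "(\<lambda>n. LINT x|\<nu> (r n). c x ^ j) \<longlonglongrightarrow> (LINT x|M. c x ^ j)"
      by (rule conv[OF cj, of 1]) (auto simp: c_def power_abs[symmetric] intro!: power_le_one)
    moreover have "(LINT x|\<nu> n. c x ^ j) = (\<Sum>k\<le>n. (real k / real n) ^ j * bernstein_weight m n k)" for n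
      unfolding int[OF borel_measurable_continuous_onI[OF cj]]
      by (intro sum.cong refl) (simp add: ck)
    moreover have "(\<lambda>n. \<Sum>k\<le>r n. (real k / real (r n)) ^ j * bernstein_weight m (r n) k) \<longlonglongrightarrow> m j"
      using LIMSEQ_subseq_LIMSEQ[OF bernstein_weight_moment_tendsto[OF nonneg m0, of j] r] by (simp add: o_def)
    ultimately show ?thesis by (simp add: LIMSEQ_unique)
  qed
  then show ?thesis using um by auto
qed

section \<open>Product states\<close>

definition diagonal :: "(bool \<times> bool \<times> nat) list \<Rightarrow> bool" where
  "diagonal w \<longleftrightarrow> (\<forall>(p, q, j)\<in>set w. p = q)"

lemma diagonal_simps [simp]:
  "diagonal []" "diagonal ((p, q, j) # w) \<longleftrightarrow> p = q \<and> diagonal w" "diagonal (v @ w) \<longleftrightarrow> diagonal v \<and> diagonal w"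
  by (simp_all add: diagonal_def ball_Un)

context car
begin

section \<open>Diagonal words and minimal projections\<close>

lemma mode_in_modes: "(p, q, j) \<in> set w \<Longrightarrow> j \<in> set (modes w)"
  by (force simp: modes_def)

lemma diagonal_word_commute:
  assumes "j \<notin> set (modes w)" "diagonal w"
  shows "munit r s j * word w = word w * munit r s j"
  using assms
proof (induction w)
  case (Cons l w)
  obtain p q i where l: "l = (p, q, i)" by (cases l)
  have "munit r s j * word (l # w) = (munit r s j * munit p q i) * word w"
    by (simp add: l mult.assoc)
  also have "\<dots> = munit p q i * (munit r s j * word w)"
    using munit_commute[of j i r s p q] Cons.prems l by (simp add: mult.assoc)
  also have "\<dots> = word (l # w) * munit r s j"
    using Cons l by (simp add: mult.assoc)
  finally show ?case .
qed simp

lemma diagonal_word_projection: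
  assumes "distinct (modes w)" "diagonal w"
  shows "word w * word w = word w" "(word w)\<^sup>\<star> = word w"
proof -
  have "word w * word w = word w \<and> (word w)\<^sup>\<star> = word w"
    using assms
  proof (induction w)
    case (Cons l w)
    obtain p q i where l: "l = (p, q, i)" by (cases l)
    with Cons have pq: "p = q" and c: "munit p q i * word w = word w * munit p q i"
      and IH: "word w * word w = word w" "(word w)\<^sup>\<star> = word w"
      by (auto intro: diagonal_word_commute)
    have "word (l # w) * word (l # w) = munit p q i * (word w * munit p q i) * word w"
      by (simp add: l mult.assoc)
    also have "\<dots> = (munit p q i * munit p q i) * (word w * word w)"
      unfolding c[symmetric] by (simp only: mult.assoc)
    also have "\<dots> = word (l # w)" using IH pq by (simp add: munit_mult l)
    finally show ?case using IH c pq by (simp add: l star_mult munit_star)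
  qed simp
  then show "word w * word w = word w" "(word w)\<^sup>\<star> = word w" by auto
qed

text \<open>\<open>vac s n\<close> is the minimal projection of the first \<open>n\<close> modes with occupation numbers \<open>s\<close>.\<close>

definition vac :: "(nat \<Rightarrow> bool) \<Rightarrow> nat \<Rightarrow> 'a" where
  "vac s n = word (map (\<lambda>j. (s j, s j, j)) [0..<n])"

lemma modes_vac: "modes (map (\<lambda>j. (s j, s j, j)) js) = js" and diagonal_vac: "diagonal (map (\<lambda>j. (s j, s j, j)) js)"
  by (auto simp: modes_def diagonal_def o_def)

lemma vac_0 [simp]: "vac s 0 = 1"
  and vac_Suc: "vac s (Suc n) = vac s n * munit (s n) (s n) n"
  by (simp_all add: vac_def)

lemma vac_idem: "vac s n * vac s n = vac s n" and vac_star: "(vac s n)\<^sup>\<star> = vac s n"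
  unfolding vac_def by (rule diagonal_word_projection; simp add: modes_vac diagonal_vac)+

lemma vac_commute: "n \<le> j \<Longrightarrow> munit r q j * vac s n = vac s n * munit r q j"
  unfolding vac_def by (rule diagonal_word_commute) (simp_all add: modes_vac diagonal_vac)

lemma vac_absorb:
  assumes "i < n"
  shows "munit (s i) (s i) i * vac s n = vac s n" "vac s n * munit (s i) (s i) i = vac s n"
proof -
  show "vac s n * munit (s i) (s i) i = vac s n"
    using assms
  proof (induction n)
    case (Suc n)
    show ?case
    proof (cases "i = n")
      case False
      have "vac s (Suc n) * munit (s i) (s i) i = (vac s n * munit (s i) (s i) i) * munit (s n) (s n) n"
        using munit_commute[of n i "s n" "s n" "s i" "s i"] False by (simp add: vac_Suc mult.assoc)
      then show ?thesis using Suc False by (simp add: vac_Suc)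
    qed (simp add: vac_Suc mult.assoc munit_mult)
  qed simp
  then show "munit (s i) (s i) i * vac s n = vac s n"
    using star_mult[of "vac s n" "munit (s i) (s i) i"] by (simp add: vac_star munit_star)
qed

lemma vac_mono:
  assumes "n \<le> m"
  shows "vac s m * vac s n = vac s m" "vac s n * vac s m = vac s m"
proof -
  show "vac s m * vac s n = vac s m"
    using assms
  proof (induction n)
    case (Suc n)
    have "vac s m * vac s (Suc n) = (vac s m * vac s n) * munit (s n) (s n) n"
      by (simp add: vac_Suc mult.assoc)
    then show ?case using Suc by (simp add: vac_absorb)
  qed simp
  then show "vac s n * vac s m = vac s m"
    using star_mult[of "vac s m" "vac s n"] by (simp add: vac_star)
qed

lemma munit_flip: "munit r q j * (munit q q j * munit q r j) = munit r r j"
  by (simp add: munit_mult)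

text \<open>\<open>munit (\<not> s n) (s n) n\<close> is the partial isometry that flips the
  occupation of mode \<open>n\<close>, so the two halves of \<open>vac s n\<close> are
  conjugate.\<close>

lemma vac_flip:
  "vac s n * munit (\<not> s n) (\<not> s n) n = munit (\<not> s n) (s n) n * vac s (Suc n) * munit (s n) (\<not> s n) n"
proof -
  have "munit (\<not> s n) (s n) n * vac s (Suc n) * munit (s n) (\<not> s n) n
     = (munit (\<not> s n) (s n) n * vac s n) * (munit (s n) (s n) n * munit (s n) (\<not> s n) n)"
    by (simp add: vac_Suc mult.assoc)
  also have "\<dots> = vac s n * (munit (\<not> s n) (s n) n * (munit (s n) (s n) n * munit (s n) (\<not> s n) n))"
    by (simp add: vac_commute mult.assoc)
  finally show ?thesis by (simp only: munit_flip)
qed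

lemma munit_sum': "munit r r j + munit (\<not> r) (\<not> r) j = 1"
  using munit_sum[of j] by (cases r) (simp_all add: add.commute)

lemma vac_split: "vac s n = vac s (Suc n) + munit (\<not> s n) (s n) n * vac s (Suc n) * munit (s n) (\<not> s n) n"
proof -
  have "vac s n = vac s n * (munit (s n) (s n) n + munit (\<not> s n) (\<not> s n) n)"
    by (simp add: munit_sum')
  then show ?thesis by (simp only: distrib_left vac_flip vac_Suc[symmetric])
qed

text \<open>If \<open>vac s (Suc n)\<close> vanished, so would its flipped conjugate, and hence
  their sum \<open>vac s n\<close>; descending, one would reach \<open>1 = 0\<close>.\<close>

lemma vac_nonzero: "vac s n \<noteq> 0"
proof (induction n)
  case (Suc n)
  then show ?case using vac_split[of s n] by auto
qed simp

lemma norm_vac: "norm (vac s n) = 1"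
proof -
  have "(norm (vac s n))\<^sup>2 = norm (vac s n)"
    using cstar_identity[of "vac s n"] by (simp add: vac_star vac_idem)
  then show ?thesis using vac_nonzero[of s n] by (simp add: power2_eq_square)
qed

text \<open>The projection of the first letter's mode is split off both copies of
  \<open>vac s n\<close> and brought next to that letter, which it compresses to a scalar multiple
  of itself. Thus the word disappears letter by letter.\<close>

lemma vac_word:
  assumes "distinct (modes w)" "set (modes w) \<subseteq> {..<n}"
  shows "vac s n * word w * vac s n = of_bool (\<forall>(p, q, j)\<in>set w. p = s j \<and> q = s j) *\<^sub>C vac s n"
  using assms
proof (induction w)
  case Nil
  then show ?case by (simp add: vac_idem)
next
  case (Cons l w)
  obtain p q i where l: "l = (p, q, i)" by (cases l)
  let ?q = "munit (s i) (s i) i"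
  from Cons.prems l have i: "i < n" "i \<notin> set (modes w)" by auto
  have "vac s n * word (l # w) * vac s n = (vac s n * ?q) * munit p q i * word w * (?q * vac s n)"
    using vac_absorb[OF i(1), of s] by (simp add: l mult.assoc)
  also have "\<dots> = vac s n * (?q * munit p q i) * (word w * ?q) * vac s n"
    by (simp only: mult.assoc)
  also have "\<dots> = vac s n * (?q * munit p q i * ?q) * word w * vac s n"
    by (simp only: projection_word_commute[OF i(2), symmetric] mult.assoc)
  also have "?q * munit p q i * ?q = of_bool (p = s i \<and> q = s i) *\<^sub>C ?q"
    by (simp add: munit_mult of_bool_def)
  also have "vac s n * (of_bool (p = s i \<and> q = s i) *\<^sub>C ?q) * word w * vac s n
      = of_bool (p = s i \<and> q = s i) *\<^sub>C ((vac s n * ?q) * word w * vac s n)"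
    by (simp only: mult_scaleC_left mult_scaleC_right mult.assoc)
  also have "\<dots> = of_bool (p = s i \<and> q = s i) *\<^sub>C (vac s n * word w * vac s n)"
    using vac_absorb[OF i(1), of s] by simp
  finally show ?case using Cons l by (auto simp: scaleC_scaleC)
qed

section \<open>Pure product states on local elements\<close>

text \<open>The pure state with sharp occupation numbers \<open>s\<close>. The existential over
  \<open>n\<close> avoids choosing a region for \<open>x\<close>; the scalar is the same for every
  \<open>n\<close> that works, by \<open>vac_expectation_mono\<close>.\<close>

definition pure :: "(nat \<Rightarrow> bool) \<Rightarrow> 'a \<Rightarrow> complex" where
  "pure s x = (THE c. \<exists>n. vac s n * x * vac s n = c *\<^sub>C vac s n)"

lemma vac_expectation_mono:
  assumes "vac s n * x * vac s n = c *\<^sub>C vac s n" "n \<le> m"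
  shows "vac s m * x * vac s m = c *\<^sub>C vac s m"
proof -
  have "vac s m * x * vac s m = (vac s m * vac s n) * x * (vac s n * vac s m)"
    using vac_mono[OF assms(2)] by simp
  also have "\<dots> = vac s m * (vac s n * x * vac s n) * vac s m" by (simp only: mult.assoc)
  finally show ?thesis using vac_mono[OF assms(2)] assms(1)
    by (simp add: mult_scaleC_left mult_scaleC_right vac_idem)
qed

lemma pure_eqI:
  assumes "vac s n * x * vac s n = c *\<^sub>C vac s n"
  shows "pure s x = c"
  unfolding pure_def
proof (rule the_equality)
  show "\<exists>n. vac s n * x * vac s n = c *\<^sub>C vac s n" using assms by blast
next
  fix d assume "\<exists>n. vac s n * x * vac s n = d *\<^sub>C vac s n"
  then obtain m where "vac s m * x * vac s m = d *\<^sub>C vac s m" by blast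
  from vac_expectation_mono[OF this, of "max n m"] vac_expectation_mono[OF assms, of "max n m"]
  show "d = c" using vac_nonzero by (simp add: scaleC_cancel)
qed

lemma pure_local:
  assumes "x \<in> local {..<n}"
  shows "vac s n * x * vac s n = pure s x *\<^sub>C vac s n"
proof -
  have "\<exists>c. vac s n * x * vac s n = c *\<^sub>C vac s n"
    using assms
  proof (induction rule: local_induct)
    case (word c w)
    have "vac s n * (c *\<^sub>C word w) * vac s n = c *\<^sub>C (vac s n * word w * vac s n)"
      by (simp only: mult_scaleC_left mult_scaleC_right)
    then show ?case unfolding vac_word[OF word] scaleC_scaleC by blast
  next
    case subspace
    have "\<exists>c. 0 = c *\<^sub>C vac s n" by (intro exI[of _ 0]) simp
    then show ?case
      by (auto simp: subspace_def distrib_left distrib_right scaleC_scaleC scaleR_eq_scaleC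
          mult_scaleC_left mult_scaleC_right) (metis scaleC_add_left)
  qed
  then show ?thesis using pure_eqI by auto
qed

lemma pure_local_eventually:
  assumes "x \<in> local UNIV"
  shows "\<exists>N. \<forall>n\<ge>N. vac s n * x * vac s n = pure s x *\<^sub>C vac s n"
  using local_finite[OF assms] pure_local vac_expectation_mono by blast

lemma pure_add:
  assumes "x \<in> local UNIV" "y \<in> local UNIV" shows "pure s (x + y) = pure s x + pure s y"
proof -
  obtain N M where "\<And>n. n \<ge> N \<Longrightarrow> vac s n * x * vac s n = pure s x *\<^sub>C vac s n"
    "\<And>n. n \<ge> M \<Longrightarrow> vac s n * y * vac s n = pure s y *\<^sub>C vac s n"
    using pure_local_eventually assms by metis
  then show ?thesis
    by (intro pure_eqI[of s "max N M"]) (simp add: distrib_left distrib_right scaleC_add_left)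
qed

lemma pure_scaleC:
  assumes "x \<in> local UNIV" shows "pure s (c *\<^sub>C x) = c * pure s x"
proof -
  obtain N where "\<And>n. n \<ge> N \<Longrightarrow> vac s n * x * vac s n = pure s x *\<^sub>C vac s n"
    using pure_local_eventually assms by metis
  then show ?thesis
    by (intro pure_eqI[of s N]) (simp add: mult_scaleC_left mult_scaleC_right scaleC_scaleC)
qed

lemma pure_bound:
  assumes "x \<in> local UNIV" shows "norm (pure s x) \<le> norm x"
proof -
  obtain n where "vac s n * x * vac s n = pure s x *\<^sub>C vac s n"
    using pure_local_eventually assms by blast
  then have "norm (pure s x) = norm (vac s n * x * vac s n)" by (simp add: norm_scaleC norm_vac)
  also have "\<dots> \<le> norm (vac s n) * norm x * norm (vac s n)"
    by (meson norm_ge_zero norm_mult_ineq order_trans mult_right_mono)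
  finally show ?thesis by (simp add: norm_vac)
qed

lemma pure_word:
  assumes "distinct (modes w)"
  shows "pure s (word w) = of_bool (\<forall>(p, q, j)\<in>set w. p = s j \<and> q = s j)"
proof -
  have "set (modes w) \<subseteq> {..<Suc (Max (insert 0 (set (modes w))))}" by (auto simp: less_Suc_eq_le)
  from vac_word[OF assms this] show ?thesis by (rule pure_eqI)
qed

text \<open>The minimal projections of the first \<open>n\<close> modes are conjugates of
  \<open>vac s n\<close> under flips, and they add up to \<open>1\<close>. A list of conjugators
  makes it unnecessary to show that they are distinct.\<close>

lemma vac_resolution:
  "\<exists>cs. set cs \<subseteq> local {..<n} \<and> sum_list (map (\<lambda>c. c\<^sup>\<star> * vac s n * c) cs) = 1"
proof (induction n)
  case 0
  show ?case by (intro exI[of _ "[1]"]) (simp add: local_one)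
next
  case (Suc n)
  then obtain cs where cs: "set cs \<subseteq> local {..<n}" "sum_list (map (\<lambda>c. c\<^sup>\<star> * vac s n * c) cs) = 1" by blast
  define t where "t = munit (s n) (\<not> s n) n"
  have "vac s n = vac s (Suc n) + t\<^sup>\<star> * vac s (Suc n) * t"
    using vac_split[of s n] by (simp add: t_def munit_star)
  then have "c\<^sup>\<star> * vac s n * c = c\<^sup>\<star> * vac s (Suc n) * c + (t * c)\<^sup>\<star> * vac s (Suc n) * (t * c)" for c
    by (simp add: distrib_left distrib_right star_mult mult.assoc)
  then have "sum_list (map (\<lambda>c. c\<^sup>\<star> * vac s (Suc n) * c) (cs @ map (\<lambda>c. t * c) cs)) = 1"
    using cs(2) by (simp add: sum_list_addf o_def)
  moreover have "set (cs @ map (\<lambda>c. t * c) cs) \<subseteq> local {..<Suc n}"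
    using cs(1) local_mono[of "{..<n}" "{..<Suc n}"] by (auto simp: t_def intro!: local_munit_mult)
  ultimately show ?case by blast
qed

text \<open>Inserting the resolution of \<open>1\<close> between \<open>x\<^sup>\<star>\<close> and
  \<open>x\<close> turns the compression of \<open>x\<^sup>\<star> * x\<close> into a sum of squares
  \<open>(cmod (pure s (c * x)))\<^sup>2\<close>.\<close>

lemma pure_positive:
  assumes "x \<in> local UNIV" shows "pure s (x\<^sup>\<star> * x) \<in> \<real>\<^sub>\<ge>\<^sub>0"
proof -
  obtain n where x: "x \<in> local {..<n}" using local_finite[OF assms] by blast
  obtain cs where cs: "set cs \<subseteq> local {..<n}" "sum_list (map (\<lambda>c. c\<^sup>\<star> * vac s n * c) cs) = 1"
    using vac_resolution by blast
  have "vac s n * (x\<^sup>\<star> * sum_list (map (\<lambda>c. c\<^sup>\<star> * vac s n * c) cs) * x) * vac s n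
    = of_real (sum_list (map (\<lambda>c. (cmod (pure s (c * x)))\<^sup>2) cs)) *\<^sub>C vac s n"
    using cs(1)
  proof (induction cs)
    case (Cons c cs)
    have cx: "vac s n * (c * x) * vac s n = pure s (c * x) *\<^sub>C vac s n"
      using Cons.prems x by (intro pure_local local_mult) auto
    have "vac s n * (x\<^sup>\<star> * (c\<^sup>\<star> * vac s n * c) * x) * vac s n
      = vac s n * (x\<^sup>\<star> * (c\<^sup>\<star> * (vac s n * vac s n) * c) * x) * vac s n"
      by (simp only: vac_idem)
    also have "\<dots> = (vac s n * (c * x) * vac s n)\<^sup>\<star> * (vac s n * (c * x) * vac s n)"
      by (simp add: star_mult vac_star mult.assoc)
    also have "\<dots> = (cnj (pure s (c * x)) * pure s (c * x)) *\<^sub>C vac s n"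
      unfolding cx by (simp add: star_scaleC vac_star vac_idem mult_scaleC_left mult_scaleC_right scaleC_scaleC mult.commute)
    also have "cnj (pure s (c * x)) * pure s (c * x) = of_real ((cmod (pure s (c * x)))\<^sup>2)"
      by (metis complex_norm_square mult.commute)
    finally show ?case using Cons by (simp add: distrib_left distrib_right scaleC_add_left)
  qed simp
  then have "vac s n * (x\<^sup>\<star> * x) * vac s n = of_real (sum_list (map (\<lambda>c. (cmod (pure s (c * x)))\<^sup>2) cs)) *\<^sub>C vac s n"
    by (simp add: cs(2))
  then have "pure s (x\<^sup>\<star> * x) = of_real (sum_list (map (\<lambda>c. (cmod (pure s (c * x)))\<^sup>2) cs))"
    by (rule pure_eqI)
  moreover have "0 \<le> sum_list (map (\<lambda>c. (cmod (pure s (c * x)))\<^sup>2) cs)"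
    by (rule sum_list_nonneg) auto
  ultimately show ?thesis by simp
qed

text \<open>\<open>avg l s n\<close> averages \<open>pure\<close> over independent Bernoulli(\<open>l\<close>) occupation numbers of the first \<open>n\<close> modes.\<close>

fun avg :: "real \<Rightarrow> (nat \<Rightarrow> bool) \<Rightarrow> nat \<Rightarrow> 'a \<Rightarrow> complex" where
  "avg l s 0 x = pure s x"
| "avg l s (Suc n) x = of_real l * avg l (s(n := True)) n x + of_real (1 - l) * avg l (s(n := False)) n x"

lemma avg_add:
  "x \<in> local UNIV \<Longrightarrow> y \<in> local UNIV \<Longrightarrow> avg l s n (x + y) = avg l s n x + avg l s n y"
  by (induction n arbitrary: s) (auto simp: pure_add algebra_simps)

lemma avg_scaleC: "x \<in> local UNIV \<Longrightarrow> avg l s n (c *\<^sub>C x) = c * avg l s n x"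
  by (induction n arbitrary: s) (auto simp: pure_scaleC algebra_simps)

lemma avg_bound:
  assumes "x \<in> local UNIV" "0 \<le> l" "l \<le> 1" shows "norm (avg l s n x) \<le> norm x"
proof (induction n arbitrary: s)
  case (Suc n)
  have "norm (avg l s (Suc n) x) \<le> l * norm (avg l (s(n := True)) n x) + (1 - l) * norm (avg l (s(n := False)) n x)"
    using assms(2,3) norm_triangle_ineq[of "of_real l * avg l (s(n := True)) n x" "of_real (1 - l) * avg l (s(n := False)) n x"]
    by (simp add: norm_mult del: of_real_diff)
  also have "\<dots> \<le> l * norm x + (1 - l) * norm x"
    using assms(2,3) by (intro add_mono mult_left_mono Suc) auto
  finally show ?case by (simp add: algebra_simps)
qed (simp add: pure_bound assms)

lemma avg_positive:
  assumes "x \<in> local UNIV" "0 \<le> l" "l \<le> 1" shows "avg l s n (x\<^sup>\<star> * x) \<in> \<real>\<^sub>\<ge>\<^sub>0"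
proof (induction n arbitrary: s)
  case (Suc n)
  show ?case using Suc assms(2,3) unfolding avg.simps
    by (intro nonneg_Reals_add_I nonneg_Reals_mult_I) (simp_all del: of_real_diff)
qed (simp add: pure_positive assms)

section \<open>Averaged occupation numbers and the product states\<close>

definition letter_weight :: "real \<Rightarrow> bool \<Rightarrow> bool \<Rightarrow> real" where
  "letter_weight l p q = (if p \<noteq> q then 0 else if p then l else 1 - l)"

definition word_weight :: "real \<Rightarrow> (bool \<times> bool \<times> nat) list \<Rightarrow> real" where
  "word_weight l w = prod_list (map (\<lambda>(p, q, j). letter_weight l p q) w)"

text \<open>Mode \<open>n\<close> occurs at most once in the word, so averaging over its occupation
  number changes a single factor. Letters of modes not yet averaged keep their sharp value under
  \<open>s\<close>.\<close>

lemma avg_word: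
  assumes "distinct (modes w)"
  shows "avg l s n (word w) =
    of_real (prod_list (map (\<lambda>(p, q, j). if j < n then letter_weight l p q else of_bool (p = s j \<and> q = s j)) w))"
    (is "_ = of_real (prod_list (map (?f n s) w))")
proof (induction n arbitrary: s)
  case 0
  have "pure s (word w) = of_real (prod_list (map (?f 0 s) w))"
    unfolding pure_word[OF assms] by (induction w) (simp_all add: case_prod_unfold of_bool_conj)
  then show ?case by simp
next
  case (Suc n)
  have "l * prod_list (map (?f n (s(n := True))) w) + (1 - l) * prod_list (map (?f n (s(n := False))) w)
      = prod_list (map (?f (Suc n) s) w)"
  proof (cases "n \<in> set (modes w)")
    case False
    then have eq: "map (?f n (s(n := b))) w = map (?f (Suc n) s) w" for b
      by (auto simp: less_Suc_eq intro!: map_cong dest: mode_in_modes)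
    show ?thesis unfolding eq by (simp only: flip: distrib_right) simp
  next
    case True
    then obtain p q where "(p, q, n) \<in> set w" by (auto simp: modes_def)
    then obtain v u where w: "w = v @ (p, q, n) # u" by (meson split_list)
    have eq: "map (?f n (s(n := b))) z = map (?f (Suc n) s) z" if "n \<notin> set (modes z)" for b z
      using that by (auto simp: less_Suc_eq intro!: map_cong dest: mode_in_modes)
    have "n \<notin> set (modes v)" "n \<notin> set (modes u)" using assms w by auto
    note eqs = eq[OF this(1)] eq[OF this(2)]
    show ?thesis
      unfolding w map_append list.map eqs prod_list.append prod_list.Cons
      by (cases p; cases q) (simp_all add: letter_weight_def)
  qed
  then show ?case
    unfolding avg.simps Suc of_real_mult[symmetric] of_real_add[symmetric] by (simp only:)
qed

lemma avg_word_eventually: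
  assumes "distinct (modes w)"
  shows "\<forall>\<^sub>F n in sequentially. avg l s n (word w) = of_real (word_weight l w)"
proof -
  have "avg l s n (word w) = of_real (word_weight l w)" if "n \<ge> Suc (Max (insert 0 (set (modes w))))" for n
  proof -
    have "j < n" if "j \<in> set (modes w)" for j
      using that \<open>n \<ge> _\<close> Max_ge[of "insert 0 (set (modes w))" j] by (simp add: Suc_le_eq)
    then show ?thesis
      unfolding avg_word[OF assms] word_weight_def
      by (intro arg_cong[where f = of_real] arg_cong[where f = prod_list] map_cong) (force simp: modes_def)+
  qed
  then show ?thesis unfolding eventually_sequentially by blast
qed

lemma avg_convergent:
  assumes "x \<in> local UNIV" shows "convergent (\<lambda>n. avg l s n x)"
proof -
  \<comment> \<open>The averages are in fact eventually constant. Membership in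
    \<open>local UNIV\<close> is part of the predicate because additivity of \<open>avg\<close> is
    known only there, while the predicate has to define a subspace.\<close>
  have "\<exists>c. \<forall>\<^sub>F n in sequentially. avg l s n x = c \<and> x \<in> local UNIV"
    using assms
  proof (induction rule: local_induct)
    case (word c w)
    have "\<forall>\<^sub>F n in sequentially. avg l s n (c *\<^sub>C word w) = c * of_real (word_weight l w) \<and> c *\<^sub>C word w \<in> local UNIV"
      using avg_word_eventually[OF word(1), of l s]
      by eventually_elim (simp add: avg_scaleC word_in_local word_in_local' word)
    then show ?case by blast
  next
    case subspace
    show ?case
      unfolding subspace_def
    proof (intro conjI ballI allI; (elim CollectE exE)?, intro CollectI)
      have "avg l s n 0 = 0" for n
        using avg_scaleC[OF local_one[of UNIV], of l s n 0] by simp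
      then show "\<exists>c. \<forall>\<^sub>F n in sequentially. avg l s n 0 = c \<and> 0 \<in> local UNIV"
        using subspace_0[OF subspace_local] by auto
    next
      fix x y c d
      assume "\<forall>\<^sub>F n in sequentially. avg l s n x = c \<and> x \<in> local UNIV"
        "\<forall>\<^sub>F n in sequentially. avg l s n y = d \<and> y \<in> local UNIV"
      then have "\<forall>\<^sub>F n in sequentially. avg l s n (x + y) = c + d \<and> x + y \<in> local UNIV"
        by eventually_elim (simp add: avg_add subspace_add[OF subspace_local])
      then show "\<exists>c. \<forall>\<^sub>F n in sequentially. avg l s n (x + y) = c \<and> x + y \<in> local UNIV" by blast
    next
      fix r x c
      assume "\<forall>\<^sub>F n in sequentially. avg l s n x = c \<and> x \<in> local UNIV"
      then have "\<forall>\<^sub>F n in sequentially. avg l s n (r *\<^sub>R x) = of_real r * c \<and> r *\<^sub>R x \<in> local UNIV"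
        by eventually_elim (simp add: scaleR_eq_scaleC avg_scaleC local_scaleC)
      then show "\<exists>c. \<forall>\<^sub>F n in sequentially. avg l s n (r *\<^sub>R x) = c \<and> r *\<^sub>R x \<in> local UNIV" by blast
    qed
  qed
  then obtain c where "\<forall>\<^sub>F n in sequentially. avg l s n x = c \<and> x \<in> local UNIV" by blast
  then have "(\<lambda>n. avg l s n x) \<longlonglongrightarrow> c"
    by (intro tendsto_eventually) (auto elim: eventually_mono)
  then show ?thesis by (auto simp: convergent_def)
qed

text \<open>The limit of the averages is contractive on local elements and therefore extends;
  homogeneity and positivity pass to the extension by density. The norm bound stays in the
  statement, since continuity in \<open>l\<close> and integration over \<open>l\<close> rest on
  it.\<close>

lemma product_state_exists:
  assumes l: "0 \<le> l" "l \<le> 1"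
  shows "\<exists>\<phi>. state \<phi> \<and> (\<forall>w. distinct (modes w) \<longrightarrow> blinfun_apply \<phi> (word w) = of_real (word_weight l w)) \<and>
    (\<forall>x. norm (blinfun_apply \<phi> x) \<le> norm x)"
proof -
  define f where "f x = lim (\<lambda>n. avg l (\<lambda>_. False) n x)" for x
  have f: "(\<lambda>n. avg l (\<lambda>_. False) n x) \<longlonglongrightarrow> f x" if "x \<in> local UNIV" for x
    unfolding f_def using avg_convergent[OF that] by (simp add: convergent_LIMSEQ_iff)
  have f_add: "f (x + y) = f x + f y" if "x \<in> local UNIV" "y \<in> local UNIV" for x y
    using f[OF subspace_add[OF subspace_local that]] tendsto_add[OF f f, OF that]
    by (simp add: avg_add that LIMSEQ_unique)
  have f_scaleC: "f (c *\<^sub>C x) = c * f x" if "x \<in> local UNIV" for c x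
    using f[OF local_scaleC[OF that, of c]] tendsto_mult[OF tendsto_const f, OF that, of c]
    by (simp add: avg_scaleC that LIMSEQ_unique)
  have f_bound: "norm (f x) \<le> 1 * norm x" if "x \<in> local UNIV" for x
    using tendsto_upperbound[OF tendsto_norm[OF f[OF that]], of "norm x"] avg_bound[OF that l] by simp
  have f_pos: "f (x\<^sup>\<star> * x) \<in> \<real>\<^sub>\<ge>\<^sub>0" if "x \<in> local UNIV" for x
    by (rule closed_sequentially[OF closed_nonneg_Reals_complex avg_positive[OF that l]
        f[OF local_mult[OF local_star[OF that] that]]])
  have f_word: "f (word w) = of_real (word_weight l w)" if "distinct (modes w)" for w
    by (rule LIMSEQ_unique[OF f[OF word_in_local'[OF that subset_UNIV]] tendsto_eventually[OF avg_word_eventually[OF that]]])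
  obtain F where F: "bounded_linear F" "\<And>x. x \<in> local UNIV \<Longrightarrow> F x = f x" "\<And>x. norm (F x) \<le> 1 * norm x"
  proof -
    have "f (r *\<^sub>R x) = r *\<^sub>R f x" if "x \<in> local UNIV" for r x
      by (simp add: scaleR_eq_scaleC f_scaleC that scaleR_conv_of_real)
    from bounded_linear_extension_dense[OF subspace_local closure_local f_add this f_bound] that
    show thesis by blast
  qed
  define \<phi> where "\<phi> = Blinfun F"
  have \<phi>: "blinfun_apply \<phi> = F" unfolding \<phi>_def by (rule bounded_linear_Blinfun_apply[OF F(1)])
  have scale: "F (c *\<^sub>C x) = c * F x" for c x
  proof -
    have "(\<lambda>x. F (c *\<^sub>C x)) = (\<lambda>x. c * F x)"
    proof (rule bounded_linear_eqI)
      show "bounded_linear (\<lambda>x. F (c *\<^sub>C x))" by (rule bounded_linear_compose[OF F(1) bounded_linear_scaleC])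
      show "bounded_linear (\<lambda>x. c * F x)" by (rule bounded_linear_const_mult[OF F(1)])
      show "F (c *\<^sub>C d *\<^sub>C word w) = c * F (d *\<^sub>C word w)" if "distinct (modes w)" for d w
        using that by (simp add: F(2) word_in_local local_scaleC f_scaleC)
    qed
    then show ?thesis by meson
  qed
  have pos: "F (x\<^sup>\<star> * x) \<in> \<real>\<^sub>\<ge>\<^sub>0" for x
  proof -
    obtain u where u: "\<And>n. u n \<in> local UNIV" "u \<longlonglongrightarrow> x"
      using closure_local by (metis UNIV_I closure_sequential)
    have lim: "(\<lambda>n. F ((u n)\<^sup>\<star> * u n)) \<longlonglongrightarrow> F (x\<^sup>\<star> * x)"
      by (intro bounded_linear.tendsto[OF F(1)] tendsto_mult tendsto_star u(2))
    have "F ((u n)\<^sup>\<star> * u n) \<in> \<real>\<^sub>\<ge>\<^sub>0" for n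
      using f_pos[OF u(1)] F(2)[OF local_mult[OF local_star[OF u(1)] u(1)]] by metis
    from closed_sequentially[OF closed_nonneg_Reals_complex this lim] show ?thesis .
  qed
  have "F 1 = 1" using F(2)[OF local_one] f_word[of "[]"] by (simp add: word_weight_def)
  then have "state \<phi>" unfolding state_def \<phi> using scale pos by auto
  moreover have "blinfun_apply \<phi> (word w) = of_real (word_weight l w)" if "distinct (modes w)" for w
    unfolding \<phi> using F(2)[OF word_in_local'[OF that subset_UNIV]] f_word[OF that] by simp
  moreover have "norm (blinfun_apply \<phi> x) \<le> norm x" for x
    using F(3)[of x] by (simp add: \<phi>)
  ultimately show ?thesis by blast
qed


section \<open>Symmetric states are mixtures of product states\<close>

text \<open>Clamping the parameter makes the map total and continuous on the whole line, as measures
  on the line and Bernstein sums require. The \<open>SOME\<close> leaves no freedom, since values on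
  words determine a state.\<close>

definition prod_state :: "real \<Rightarrow> 'a \<Rightarrow>\<^sub>L complex" where
  "prod_state l = (SOME \<phi>. state \<phi> \<and>
     (\<forall>w. distinct (modes w) \<longrightarrow> blinfun_apply \<phi> (word w) = of_real (word_weight (max 0 (min 1 l)) w)) \<and>
     (\<forall>x. norm (blinfun_apply \<phi> x) \<le> norm x))"

lemma prod_state:
  shows state_prod_state: "state (prod_state l)"
    and prod_state_word: "distinct (modes w) \<Longrightarrow>
      blinfun_apply (prod_state l) (word w) = of_real (word_weight (max 0 (min 1 l)) w)"
    and prod_state_norm_le: "norm (blinfun_apply (prod_state l) x) \<le> norm x"
proof -
  have "0 \<le> max 0 (min 1 l)" "max 0 (min 1 l) \<le> 1" by auto
  from someI_ex[OF product_state_exists[OF this]]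
  show "state (prod_state l)" "distinct (modes w) \<Longrightarrow>
      blinfun_apply (prod_state l) (word w) = of_real (word_weight (max 0 (min 1 l)) w)"
    "norm (blinfun_apply (prod_state l) x) \<le> norm x"
    unfolding prod_state_def by blast+
qed

lemma symmetric_state: "\<phi> \<in> symmetric_states a \<Longrightarrow> state \<phi>"
  and symmetric_invariant: "\<phi> \<in> symmetric_states a \<Longrightarrow> blinfun_apply \<phi> (perm_action a g x) = blinfun_apply \<phi> x"
  unfolding symmetric_states_def by (auto simp: fun_eq_iff)

lemma prod_state_symmetric: "prod_state l \<in> symmetric_states a"
proof -
  have "blinfun_apply (prod_state l) \<circ> perm_action a g = blinfun_apply (prod_state l)" for g
  proof (rule bounded_linear_eqI)
    show "bounded_linear (blinfun_apply (prod_state l) \<circ> perm_action a g)"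
      unfolding o_def
      by (rule bounded_linear_compose[OF blinfun.bounded_linear_right star_automorphism_bounded_linear[OF perm_action(1)]])
    fix c w assume w: "distinct (modes w)"
    define w' where "w' = map (\<lambda>(r, s, k). (r, s, perm.apply g k)) w"
    have "modes w' = map (perm.apply g) (modes w)" by (auto simp: w'_def modes_def)
    then have w': "distinct (modes w')"
      using w by (simp add: distinct_map inj_on_def apply_inj)
    have "word_weight m w' = word_weight m w" for m
      by (simp add: word_weight_def w'_def o_def case_prod_unfold)
    then show "(blinfun_apply (prod_state l) \<circ> perm_action a g) (c *\<^sub>C word w) = blinfun_apply (prod_state l) (c *\<^sub>C word w)"
      by (simp add: star_automorphism_scaleC[OF perm_action(1)] perm_action_word state_scaleC[OF state_prod_state]
          prod_state_word w w' flip: w'_def)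
  qed (rule blinfun.bounded_linear_right)
  then show ?thesis unfolding symmetric_states_def using state_prod_state by blast
qed

lemma continuous_word_weight: "continuous_on UNIV (\<lambda>l. word_weight (max 0 (min 1 l)) w)"
proof (induction w)
  case (Cons u w)
  obtain p q j where u: "u = (p, q, j)" by (cases u)
  have "continuous_on UNIV (\<lambda>l. letter_weight (max 0 (min 1 l)) p q)"
    by (cases "p = q"; cases p) (auto simp: letter_weight_def intro!: continuous_intros)
  then show ?case using Cons by (simp add: word_weight_def u continuous_on_mult)
qed (simp add: word_weight_def)

text \<open>On words the value is a polynomial in the clamped parameter. Since all product states
  are contractive, approximating \<open>x\<close> by local elements is uniform in
  \<open>l\<close>.\<close>

lemma continuous_prod_state: "continuous_on UNIV (\<lambda>l. blinfun_apply (prod_state l) x)"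
proof -
  have loc: "continuous_on UNIV (\<lambda>l. blinfun_apply (prod_state l) y)" if "y \<in> local UNIV" for y
    using that
  proof (induction rule: local_induct)
    case (word c w)
    have eq: "(\<lambda>l. blinfun_apply (prod_state l) (c *\<^sub>C word w)) = (\<lambda>l. c * of_real (word_weight (max 0 (min 1 l)) w))"
      by (simp add: state_scaleC[OF state_prod_state] prod_state_word word)
    show ?case
      unfolding eq by (intro continuous_intros continuous_word_weight)
  next
    case subspace
    show ?case
      by (auto simp: subspace_def blinfun.add_right blinfun.scaleR_right blinfun.zero_right intro!: continuous_intros)
  qed
  obtain u where u: "\<And>n. u n \<in> local UNIV" "u \<longlonglongrightarrow> x"
    using closure_local by (metis UNIV_I closure_sequential)
  have "uniform_limit UNIV (\<lambda>n l. blinfun_apply (prod_state l) (u n)) (\<lambda>l. blinfun_apply (prod_state l) x) sequentially"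
  proof (rule uniform_limitI)
    fix e :: real assume "e > 0"
    then have "\<forall>\<^sub>F n in sequentially. dist (u n) x < e" using u(2) tendstoD by blast
    then show "\<forall>\<^sub>F n in sequentially. \<forall>l\<in>UNIV. dist (blinfun_apply (prod_state l) (u n)) (blinfun_apply (prod_state l) x) < e"
    proof eventually_elim
      case (elim n)
      have "dist (blinfun_apply (prod_state l) (u n)) (blinfun_apply (prod_state l) x) \<le> dist (u n) x" for l
        using prod_state_norm_le[of l "u n - x"] by (simp add: dist_norm blinfun.diff_right)
      then show ?case using elim le_less_trans by blast
    qed
  qed
  then show ?thesis
    by (rule uniform_limit_theorem[rotated]) (auto simp: loc u(1))
qed

section \<open>Vanishing on off-diagonal words\<close>

lemma symmetric_rename:
  assumes \<phi>: "\<phi> \<in> symmetric_states a"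
    and d: "distinct (modes (v @ (p, q, j) # u))" and N: "N \<notin> set (modes (v @ (p, q, j) # u))"
  shows "blinfun_apply \<phi> (word (v @ (p, q, j) # u)) = blinfun_apply \<phi> (word (v @ (p, q, N) # u))"
proof -
  let ?g = "Perm.swap j N"
  have id: "map (\<lambda>(r, s, k). (r, s, perm.apply ?g k)) z = z" if "j \<notin> set (modes z)" "N \<notin> set (modes z)" for z
    using that
  proof (induction z)
    case (Cons l z)
    then show ?case by (cases l) auto
  qed simp
  have "map (\<lambda>(r, s, k). (r, s, perm.apply ?g k)) (v @ (p, q, j) # u) = v @ (p, q, N) # u"
    using id[of v] id[of u] d N by simp
  then have "perm_action a ?g (word (v @ (p, q, j) # u)) = word (v @ (p, q, N) # u)"
    by (simp only: perm_action_word)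
  then show ?thesis by (metis symmetric_invariant[OF \<phi>])
qed

text \<open>
  Averaging an off-diagonal letter over \<open>n\<close> fresh modes does not change the value of the state,
  but the average has norm at most \<open>n\<^sup>-\<^sup>1\<^sup>/\<^sup>2\<close>.
\<close>

lemma symmetric_off_diagonal:
  assumes \<phi>: "\<phi> \<in> symmetric_states a" and w: "distinct (modes w)" "\<not> diagonal w"
  shows "blinfun_apply \<phi> (word w) = 0"
proof (rule ccontr)
  assume nz: "blinfun_apply \<phi> (word w) \<noteq> 0"
  from w(2) obtain p q j where pq: "(p, q, j) \<in> set w" "p \<noteq> q" by (auto simp only: diagonal_def)
  then obtain v u where vu: "w = v @ (p, q, j) # u" by (meson split_list)
  define n where "n = Suc (Max (insert 0 (set (modes w))))"
  have n: "N \<notin> set (modes w)" if "N \<ge> n" for N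
  proof
    assume "N \<in> set (modes w)"
    then have "N \<le> Max (insert 0 (set (modes w)))" by (intro Max_ge) auto
    with that show False by (simp add: n_def)
  qed
  define c where "c = norm (blinfun_apply \<phi> (word w))"
  define C where "C = norm \<phi> * (norm (word v) * norm (word u))"
  have C: "C \<ge> 0" by (simp add: C_def)
  \<comment> \<open>The left side grows linearly in the number \<open>M\<close> of fresh modes, the
    right side like its square root; any \<open>M\<close> above \<open>(C / c)\<^sup>2\<close> gives
    the contradiction.\<close>
  have bound: "real M * c \<le> C * sqrt M" for M
  proof -
    let ?F = "{n..<n + M}"
    define S where "S = (\<Sum>N\<in>?F. munit p q N)"
    have S: "norm S \<le> sqrt M"
    proof (cases p)
      case True
      then have "S = (\<Sum>N\<in>?F. a N)\<^sup>\<star>" using pq(2) by (simp add: S_def star_sum)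
      then show ?thesis using norm_sum_annihilators[of ?F] by (simp add: real_le_rsqrt)
    next
      case False
      then have "S = (\<Sum>N\<in>?F. a N)" using pq(2) by (simp add: S_def)
      then show ?thesis using norm_sum_annihilators[of ?F] by (simp add: real_le_rsqrt)
    qed
    have "of_nat M * blinfun_apply \<phi> (word w) = (\<Sum>N\<in>?F. blinfun_apply \<phi> (word (v @ (p, q, N) # u)))"
    proof -
      have "blinfun_apply \<phi> (word (v @ (p, q, N) # u)) = blinfun_apply \<phi> (word w)" if "N \<in> ?F" for N
        using symmetric_rename[OF \<phi>, of v p q j u N] w(1) n[of N] that by (simp add: vu)
      then show ?thesis by simp
    qed
    also have "\<dots> = blinfun_apply \<phi> (word v * S * word u)"
      by (simp add: S_def sum_distrib_left sum_distrib_right blinfun.sum_right mult.assoc)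
    finally have "real M * c = norm (blinfun_apply \<phi> (word v * S * word u))"
      by (metis c_def norm_mult norm_of_nat)
    also have "\<dots> \<le> norm \<phi> * norm (word v * S * word u)" by (rule norm_blinfun)
    also have "\<dots> \<le> norm \<phi> * ((norm (word v) * norm S) * norm (word u))"
      by (intro mult_left_mono order_trans[OF norm_mult_ineq] mult_right_mono norm_mult_ineq) auto
    also have "\<dots> \<le> norm \<phi> * ((norm (word v) * sqrt M) * norm (word u))"
      by (intro mult_left_mono mult_right_mono S) auto
    finally show ?thesis by (simp add: C_def mult_ac)
  qed
  have c: "c > 0" using nz by (simp add: c_def)
  obtain M where M: "(C / c)\<^sup>2 < real M" using reals_Archimedean2 by blast
  then have "M > 0" by (metis of_nat_0_less_iff le_less_trans zero_le_power2)
  have "sqrt M * (sqrt M * c) \<le> sqrt M * C" using bound[of M] by (simp add: mult_ac flip: mult.assoc)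
  then have "sqrt M * c \<le> C" using \<open>M > 0\<close> by simp
  then have "sqrt M \<le> C / c" using c by (simp add: field_simps)
  then have "real M \<le> (C / c)\<^sup>2" using real_sqrt_le_iff sqrt_le_D by blast
  with M show False by simp
qed

section \<open>Values on diagonal words\<close>

fun relabel :: "nat \<Rightarrow> (bool \<times> bool \<times> nat) list \<Rightarrow> (bool \<times> bool \<times> nat) list" where
  "relabel N [] = []"
| "relabel N ((p, q, j) # u) = (p, q, N) # relabel (Suc N) u"

lemma symmetric_relabel:
  assumes \<phi>: "\<phi> \<in> symmetric_states a"
    and "distinct (modes (v @ u))" "\<And>j. j \<in> set (modes (v @ u)) \<Longrightarrow> j < N"
  shows "blinfun_apply \<phi> (word (v @ u)) = blinfun_apply \<phi> (word (v @ relabel N u))"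
  using assms(2,3)
proof (induction u arbitrary: v N)
  case (Cons l u)
  obtain p q j where l: "l = (p, q, j)" by (cases l)
  have "N \<notin> set (modes (v @ (p, q, j) # u))" using Cons.prems(2) l by blast
  then have "blinfun_apply \<phi> (word (v @ l # u)) = blinfun_apply \<phi> (word ((v @ [(p, q, N)]) @ u))"
    using symmetric_rename[OF \<phi>, of v p q j u N] Cons.prems(1) l by simp
  also have "\<dots> = blinfun_apply \<phi> (word ((v @ [(p, q, N)]) @ relabel (Suc N) u))"
  proof (rule Cons.IH)
    show "distinct (modes ((v @ [(p, q, N)]) @ u))"
      using Cons.prems \<open>N \<notin> _\<close> l by auto
    fix i assume "i \<in> set (modes ((v @ [(p, q, N)]) @ u))"
    then show "i < Suc N" using Cons.prems(2)[of i] l by auto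
  qed
  finally show ?case by (simp add: l)
qed simp

lemma relabel_eq: "map (\<lambda>(p, q, j). (p, q)) u = map (\<lambda>(p, q, j). (p, q)) v \<Longrightarrow> relabel N u = relabel N v"
proof (induction u arbitrary: v N)
  case (Cons l u)
  then obtain m z where "v = m # z" by (cases v) auto
  with Cons show ?case by (cases l; cases m) auto
qed simp

text \<open>Both words are moved to the same fresh modes beyond all modes in use, one transposition
  per letter. Going through fresh modes avoids a permutation between two mode lists that may
  overlap.\<close>

lemma symmetric_letters:
  assumes \<phi>: "\<phi> \<in> symmetric_states a" and "distinct (modes u)" "distinct (modes v)"
    and "map (\<lambda>(p, q, j). (p, q)) u = map (\<lambda>(p, q, j). (p, q)) v"
  shows "blinfun_apply \<phi> (word u) = blinfun_apply \<phi> (word v)"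
proof -
  define N where "N = Suc (Max (insert 0 (set (modes u) \<union> set (modes v))))"
  have N: "j < N" if "j \<in> set (modes u) \<union> set (modes v)" for j
    using that by (auto simp: N_def less_Suc_eq_le intro!: Max_ge)
  show ?thesis
    using symmetric_relabel[OF \<phi>, of "[]" u N] symmetric_relabel[OF \<phi>, of "[]" v N]
      relabel_eq[OF assms(4), of N] assms(2,3) N by simp
qed

definition occupied :: "nat list \<Rightarrow> 'a" where
  "occupied js = word (map (\<lambda>j. (True, True, j)) js)"

text \<open>Taking the real part loses nothing for a state, because the argument is a
  projection.\<close>

definition state_moment :: "('a \<Rightarrow>\<^sub>L complex) \<Rightarrow> nat \<Rightarrow> real" where
  "state_moment \<phi> k = Re (blinfun_apply \<phi> (occupied [0..<k]))"

lemma modes_occupied: "modes (map (\<lambda>j. (p, q, j)) js) = js"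
  by (auto simp: modes_def o_def)

lemma diagonal_occupied: "diagonal (map (\<lambda>j. (p, p, j)) js)"
  by (auto simp: diagonal_def)

lemma state_diagonal_nonneg:
  assumes "state \<phi>" "distinct (modes w)" "diagonal w"
  shows "blinfun_apply \<phi> (word w) \<in> \<real>\<^sub>\<ge>\<^sub>0"
  using state_pos[OF assms(1), of "word w"] diagonal_word_projection[OF assms(2,3)] by simp

lemma symmetric_occupied:
  assumes "\<phi> \<in> symmetric_states a" "distinct js"
  shows "blinfun_apply \<phi> (occupied js) = of_real (state_moment \<phi> (length js))"
proof -
  have "blinfun_apply \<phi> (occupied js) = blinfun_apply \<phi> (occupied [0..<length js])"
    unfolding occupied_def
    by (rule symmetric_letters[OF assms(1)]) (auto simp: modes_occupied assms(2) o_def map_replicate_const)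
  also have "\<dots> = of_real (state_moment \<phi> (length js))"
    using state_diagonal_nonneg[OF symmetric_state[OF assms(1)], of "map (\<lambda>j. (True, True, j)) [0..<length js]"]
    by (simp add: occupied_def state_moment_def modes_occupied diagonal_occupied nonneg_Reals_eq_of_real)
  finally show ?thesis .
qed

definition count_letter :: "bool \<Rightarrow> (bool \<times> bool \<times> nat) list \<Rightarrow> nat" where
  "count_letter b w = length (filter (\<lambda>(p, q, j). p = b) w)"

text \<open>An occupied letter joins the prefix \<open>js\<close>. An empty letter is
  \<open>1\<close> minus an occupied one, so it contributes the recursion step of
  \<open>differences\<close>. The prefix makes the induction hypothesis cover both terms.\<close>

lemma symmetric_diagonal:
  assumes \<phi>: "\<phi> \<in> symmetric_states a"
  shows "distinct (js @ modes w) \<Longrightarrow> diagonal w \<Longrightarrow> blinfun_apply \<phi> (occupied js * word w) =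
    of_real (differences (state_moment \<phi>) (length js + count_letter True w) (count_letter False w))"
proof (induction w arbitrary: js)
  case Nil
  then show ?case by (simp add: count_letter_def symmetric_occupied[OF \<phi>])
next
  case (Cons l w)
  obtain p j where l: "l = (p, p, j)" using Cons.prems(2) by (cases l) auto
  have occ: "occupied js * (munit True True j * word w) = occupied (js @ [j]) * word w"
    by (simp add: occupied_def mult.assoc)
  have IH: "blinfun_apply \<phi> (occupied (js @ [j]) * word w) =
      of_real (differences (state_moment \<phi>) (Suc (length js + count_letter True w)) (count_letter False w))"
    using Cons l by simp
  show ?case
  proof (cases p)
    case True
    then show ?thesis using IH occ by (simp add: l count_letter_def)
  next
    case False
    have "munit False False j = 1 - munit True True j" using munit_sum[of j] by (simp add: eq_diff_eq add.commute)
    then have "occupied js * word (l # w) = occupied js * word w - occupied (js @ [j]) * word w"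
      using False occ by (simp add: l left_diff_distrib right_diff_distrib)
    moreover have "blinfun_apply \<phi> (occupied js * word w) =
      of_real (differences (state_moment \<phi>) (length js + count_letter True w) (count_letter False w))"
      using Cons l by simp
    ultimately show ?thesis using False IH by (simp add: blinfun.diff_right l count_letter_def)
  qed
qed

lemma symmetric_word:
  assumes "\<phi> \<in> symmetric_states a" "distinct (modes w)"
  shows "blinfun_apply \<phi> (word w) =
    (if diagonal w then of_real (differences (state_moment \<phi>) (count_letter True w) (count_letter False w)) else 0)"
  using symmetric_off_diagonal[OF assms] symmetric_diagonal[OF assms(1), of "[]" w] assms(2)
  by (simp add: occupied_def)

lemma state_moment_0: "\<phi> \<in> symmetric_states a \<Longrightarrow> state_moment \<phi> 0 = 1"
  by (simp add: state_moment_def occupied_def state_one symmetric_state)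

text \<open>The difference is the value of the state at the projection onto \<open>k\<close>
  occupied and \<open>l\<close> empty modes.\<close>

lemma differences_state_moment_nonneg:
  assumes "\<phi> \<in> symmetric_states a"
  shows "0 \<le> differences (state_moment \<phi>) k l"
proof -
  define w where "w = map (\<lambda>j. (True, True, j)) [0..<k] @ map (\<lambda>j. (False, False, j)) [k..<k + l]"
  have w: "distinct (modes w)" "diagonal w"
    by (auto simp: w_def modes_occupied diagonal_occupied)
  have "count_letter True w = k" "count_letter False w = l"
    by (simp_all add: count_letter_def w_def filter_map o_def)
  then have "blinfun_apply \<phi> (word w) = of_real (differences (state_moment \<phi>) k l)"
    using symmetric_word[OF assms w(1)] w(2) by simp
  then show ?thesis
    using nonneg_Reals_eq_of_real[OF state_diagonal_nonneg[OF symmetric_state[OF assms] w]] by simp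
qed

lemma symmetric_state_eqI:
  assumes "\<phi> \<in> symmetric_states a" "\<psi> \<in> symmetric_states a" "\<And>k. state_moment \<phi> k = state_moment \<psi> k"
  shows "\<phi> = \<psi>"
proof -
  have "state_moment \<phi> = state_moment \<psi>" using assms(3) by auto
  then have "blinfun_apply \<phi> = blinfun_apply \<psi>"
    by (intro bounded_linear_eqI blinfun.bounded_linear_right)
       (simp add: state_scaleC assms(1,2)[THEN symmetric_state] symmetric_word[OF assms(1)] symmetric_word[OF assms(2)])
  then show ?thesis by (simp add: blinfun_apply_inject)
qed

lemma state_moment_prod_state:
  assumes "l \<in> {0..1}"
  shows "state_moment (prod_state l) k = l ^ k"
proof -
  have "word_weight l (map (\<lambda>j. (True, True, j)) js) = l ^ length js" for js
    by (induction js) (auto simp: word_weight_def letter_weight_def)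
  then show ?thesis
    using assms by (simp add: state_moment_def occupied_def prod_state_word modes_occupied)
qed

section \<open>Mixtures of product states\<close>

text \<open>Needed beyond the decomposition theorem: it also turns rescaled and tilted measures back
  into symmetric states, for the cone and for the extreme points.\<close>

lemma mixture_exists:
  assumes M: "unit_measure M" and M1: "measure M UNIV = 1"
  shows "\<exists>\<psi>\<in>symmetric_states a. (\<forall>x. blinfun_apply \<psi> x = (LINT l|M. blinfun_apply (prod_state l) x))
    \<and> state_moment \<psi> = moment M"
proof -
  define F where "F x = (LINT l|M. blinfun_apply (prod_state l) x)" for x
  note int = unit_measure_integrable[OF M continuous_prod_state]
  have scaleC: "F (c *\<^sub>C x) = c * F x" for c x
    by (simp add: F_def state_scaleC[OF state_prod_state])
  have F: "bounded_linear F"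
  proof (rule bounded_linear_intro[where K = 1])
    show "F (x + y) = F x + F y" for x y by (simp add: F_def blinfun.add_right int)
    show "F (r *\<^sub>R x) = r *\<^sub>R F x" for r x by (simp add: scaleR_eq_scaleC scaleC scaleR_conv_of_real)
    show "norm (F x) \<le> norm x * 1" for x
      using unit_measure_norm_integral_le[OF M continuous_prod_state[of x] prod_state_norm_le] M1 by (simp add: F_def)
  qed
  define \<psi> where "\<psi> = Blinfun F"
  have \<psi>: "blinfun_apply \<psi> = F" unfolding \<psi>_def by (rule bounded_linear_Blinfun_apply[OF F])
  have real: "F y = of_real (LINT l|M. Re (blinfun_apply (prod_state l) y))"
    if "\<And>l. blinfun_apply (prod_state l) y \<in> \<real>\<^sub>\<ge>\<^sub>0" for y
  proof -
    have "F y = (LINT l|M. of_real (Re (blinfun_apply (prod_state l) y)))"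
      unfolding F_def by (rule arg_cong[where f = "integral\<^sup>L M"])
        (use nonneg_Reals_eq_of_real[OF that] in auto)
    then show ?thesis by simp
  qed
  have "F (x\<^sup>\<star> * x) \<in> \<real>\<^sub>\<ge>\<^sub>0" for x
    unfolding real[OF state_pos[OF state_prod_state]]
    using nonneg_Reals_eq_of_real[OF state_pos[OF state_prod_state]]
    by (auto intro!: integral_nonneg)
  moreover have "F 1 = 1"
    using M1 by (simp add: F_def state_one[OF state_prod_state] unit_measure_space[OF M])
  ultimately have "state \<psi>" unfolding state_def \<psi> using scaleC by auto
  moreover have "F (perm_action a g x) = F x" for g x
    by (simp add: F_def symmetric_invariant[OF prod_state_symmetric])
  ultimately have "\<psi> \<in> symmetric_states a"
    unfolding symmetric_states_def by (auto simp: \<psi>)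
  moreover have "state_moment \<psi> k = moment M k" for k
  proof -
    have "F (occupied [0..<k]) = of_real (LINT l|M. state_moment (prod_state l) k)"
      unfolding state_moment_def occupied_def
      by (intro real state_diagonal_nonneg state_prod_state) (simp_all add: modes_occupied diagonal_occupied)
    also have "(LINT l|M. state_moment (prod_state l) k) = (LINT l|M. l ^ k)"
    proof (rule integral_cong_AE)
      have "continuous_on UNIV (\<lambda>l. state_moment (prod_state l) k)"
        unfolding state_moment_def by (intro continuous_intros continuous_prod_state)
      then show "(\<lambda>l. state_moment (prod_state l) k) \<in> borel_measurable M"
        using unit_measure_integrable[OF M] borel_measurable_integrable by blast
      show "(\<lambda>l. l ^ k) \<in> borel_measurable M"
        by (intro borel_measurable_integrable unit_measure_integrable[OF M] continuous_intros)
      show "AE l in M. state_moment (prod_state l) k = l ^ k"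
        by (rule eventually_mono[OF unit_measure_AE[OF M]]) (rule state_moment_prod_state)
    qed
    finally show ?thesis by (simp add: state_moment_def \<psi> moment_def)
  qed
  ultimately show ?thesis by (intro bexI[of _ \<psi>]) (auto simp: \<psi> F_def)
qed

theorem symmetric_state_mixture:
  assumes "\<psi> \<in> symmetric_states a"
  shows "\<exists>M. unit_measure M \<and> measure M UNIV = 1 \<and> moment M = state_moment \<psi> \<and>
    (\<forall>x. blinfun_apply \<psi> x = (LINT l|M. blinfun_apply (prod_state l) x))"
proof -
  obtain M where M: "unit_measure M" "moment M = state_moment \<psi>"
    using hausdorff_moment[OF differences_state_moment_nonneg[OF assms] state_moment_0[OF assms]] by auto
  have M1: "measure M UNIV = 1"
    using state_moment_0[OF assms] fun_cong[OF M(2), of 0] by (simp add: moment_def unit_measure_space[OF M(1)])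
  from mixture_exists[OF M(1) M1] obtain \<psi>' where
    \<psi>': "\<psi>' \<in> symmetric_states a" "\<And>x. blinfun_apply \<psi>' x = (LINT l|M. blinfun_apply (prod_state l) x)"
      "state_moment \<psi>' = moment M"
    by blast
  have "\<psi> = \<psi>'" by (rule symmetric_state_eqI[OF assms \<psi>'(1)]) (simp add: \<psi>'(3) M(2))
  with M M1 \<psi>'(2) show ?thesis by blast
qed

text \<open>Contractivity is inherited from the product states under the integral.\<close>

lemma symmetric_state_norm_le:
  assumes "\<psi> \<in> symmetric_states a"
  shows "norm (blinfun_apply \<psi> x) \<le> norm x"
proof -
  obtain M where "unit_measure M" "measure M UNIV = 1"
    "\<And>x. blinfun_apply \<psi> x = (LINT l|M. blinfun_apply (prod_state l) x)"
    using symmetric_state_mixture[OF assms] by blast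
  then show ?thesis
    using unit_measure_norm_integral_le[OF _ continuous_prod_state[of x] prod_state_norm_le, of M] by simp
qed

end

section \<open>The order of measures on the unit interval\<close>

definition add_measure :: "'b measure \<Rightarrow> 'b measure \<Rightarrow> 'b measure" where
  "add_measure M N = measure_of (space M) (sets M) (\<lambda>A. emeasure M A + emeasure N A)"

lemma space_add_measure [simp]: "space (add_measure M N) = space M"
  and sets_add_measure [simp, measurable_cong]: "sets (add_measure M N) = sets M"
  by (auto simp: add_measure_def)

lemma emeasure_add_measure:
  assumes "sets N = sets M" "A \<in> sets M"
  shows "emeasure (add_measure M N) A = emeasure M A + emeasure N A"
  unfolding add_measure_def
proof (rule emeasure_measure_of_sigma)
  show "countably_additive (sets M) (\<lambda>A. emeasure M A + emeasure N A)"
    unfolding countably_additive_def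
    using assms(1) by (auto simp: suminf_add[symmetric] suminf_emeasure)
qed (use assms in \<open>auto simp: positive_def sets.sigma_algebra_axioms\<close>)

lemma nn_integral_add_measure:
  assumes sets: "sets N = sets M" and f: "f \<in> borel_measurable M"
  shows "(\<integral>\<^sup>+x. f x \<partial>add_measure M N) = (\<integral>\<^sup>+x. f x \<partial>M) + (\<integral>\<^sup>+x. f x \<partial>N)"
  using f
proof (induction rule: borel_measurable_induct)
  have sp: "space N = space M" by (rule sets_eq_imp_space_eq[OF sets])
  have m: "g \<in> borel_measurable (add_measure M N) \<longleftrightarrow> g \<in> borel_measurable M"
    "g \<in> borel_measurable N \<longleftrightarrow> g \<in> borel_measurable M" for g :: "'a \<Rightarrow> ennreal"
    using measurable_cong_sets[of "add_measure M N" M borel borel] measurable_cong_sets[of N M borel borel] sets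
    by auto
  {
    case (cong f g)
    then show ?case
      using nn_integral_cong[of "add_measure M N" f g] nn_integral_cong[of M f g] nn_integral_cong[of N f g]
      by (simp add: sp)
  next
    case (set A)
    then show ?case using sets by (simp add: emeasure_add_measure)
  next
    case (mult u c)
    then show ?case by (simp add: nn_integral_cmult m distrib_left)
  next
    case (add u v)
    then show ?case by (simp add: nn_integral_add m add_ac)
  next
    case (seq U)
    have "(\<integral>\<^sup>+x. (SUP i. U i x) \<partial>add_measure M N) = (SUP i. (\<integral>\<^sup>+x. U i x \<partial>M) + (\<integral>\<^sup>+x. U i x \<partial>N))"
      using seq by (subst nn_integral_monotone_convergence_SUP) (auto simp: m)
    also have "\<dots> = (SUP i. \<integral>\<^sup>+x. U i x \<partial>M) + (SUP i. \<integral>\<^sup>+x. U i x \<partial>N)"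
      by (intro ennreal_SUP_add) (auto intro!: incseq_nn_integral seq)
    also have "\<dots> = (\<integral>\<^sup>+x. (SUP i. U i x) \<partial>M) + (\<integral>\<^sup>+x. (SUP i. U i x) \<partial>N)"
      using seq by (simp add: nn_integral_monotone_convergence_SUP m)
    finally show ?case by (simp add: SUP_apply image_comp)
  }
qed

lemma unit_measure_add_measure:
  assumes "unit_measure M" "unit_measure N"
  shows "unit_measure (add_measure M N)"
proof -
  have s: "sets N = sets M" "- {0..1} \<in> sets M" "space M \<in> sets M"
    using assms by (auto simp: unit_measure_def)
  have "emeasure N (space M) \<noteq> \<infinity>" "emeasure M (space M) \<noteq> \<infinity>"
    using assms by (auto simp: unit_measure_def finite_measure.emeasure_finite)
  then show ?thesis
    using assms s by (auto simp: unit_measure_def emeasure_add_measure intro!: finite_measureI)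
qed

lemma moment_0: "unit_measure M \<Longrightarrow> moment M 0 = measure M UNIV"
  by (simp add: moment_def unit_measure_space)

lemma moment_nonneg: "unit_measure M \<Longrightarrow> 0 \<le> moment M k"
  unfolding moment_def by (rule unit_measure_integral_nonneg) auto

lemma nn_integral_moment:
  assumes "unit_measure M" shows "(\<integral>\<^sup>+x. ennreal (x ^ k) \<partial>M) = ennreal (moment M k)"
  unfolding moment_def
  by (intro nn_integral_eq_integral unit_measure_integrable[OF assms] continuous_intros
      eventually_mono[OF unit_measure_AE[OF assms]]) auto

lemma moment_add_measure:
  assumes M: "unit_measure M" and N: "unit_measure N"
  shows "moment (add_measure M N) k = moment M k + moment N k"
proof -
  have "sets N = sets M" using M N by (simp add: unit_measure_def)
  moreover have "(\<lambda>x. ennreal (x ^ k)) \<in> borel_measurable M"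
    by (intro measurable_compose[OF _ measurable_ennreal] borel_measurable_integrable
        unit_measure_integrable[OF M] continuous_intros)
  ultimately have "ennreal (moment (add_measure M N) k) = ennreal (moment M k) + ennreal (moment N k)"
    by (simp add: nn_integral_add_measure nn_integral_moment M N unit_measure_add_measure flip: nn_integral_moment)
  then show ?thesis
    by (simp add: moment_nonneg M N unit_measure_add_measure flip: ennreal_plus)
qed

text \<open>Outside the unit interval \<open>g\<close> may be negative; \<open>ennreal\<close> cuts
  it off there, on a null set. Constant \<open>g\<close> rescales points of the cone, affine
  \<open>g\<close> perturbs a state.\<close>

lemma unit_measure_density:
  assumes M: "unit_measure M" and g: "continuous_on UNIV g" "\<And>x. x \<in> {0..1} \<Longrightarrow> 0 \<le> g x"
  shows "unit_measure (density M (\<lambda>x. ennreal (g x)))"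
    and "moment (density M (\<lambda>x. ennreal (g x))) k = (LINT x|M. g x * x ^ k)"
proof -
  have gm: "g \<in> borel_measurable M"
    by (intro borel_measurable_integrable unit_measure_integrable[OF M] g)
  have pos: "AE x in M. 0 \<le> g x" by (rule eventually_mono[OF unit_measure_AE[OF M]]) (rule g(2))
  have "(\<integral>\<^sup>+x. ennreal (g x) \<partial>M) = ennreal (LINT x|M. g x)"
    by (rule nn_integral_eq_integral[OF unit_measure_integrable[OF M g(1)] pos])
  then have "emeasure (density M (\<lambda>x. ennreal (g x))) (space M) \<noteq> \<infinity>"
    using gm by (subst emeasure_density) (auto cong: nn_integral_cong)
  moreover have "emeasure (density M (\<lambda>x. ennreal (g x))) (- {0..1}) = 0"
  proof -
    have "- {0..1::real} \<in> null_sets M" using M by (auto simp: unit_measure_def)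
    then have "- {0..1::real} \<in> null_sets (density M (\<lambda>x. ennreal (g x)))"
      using gm by (auto simp: null_sets_density_iff intro: AE_not_in[THEN eventually_mono])
    then show ?thesis by auto
  qed
  ultimately show "unit_measure (density M (\<lambda>x. ennreal (g x)))"
    using unit_measure_sets[OF M] by (auto simp: unit_measure_def intro!: finite_measureI)
  have "(\<lambda>x. x ^ k) \<in> borel_measurable M"
    by (intro borel_measurable_integrable unit_measure_integrable[OF M] continuous_intros)
  then show "moment (density M (\<lambda>x. ennreal (g x))) k = (LINT x|M. g x * x ^ k)"
    unfolding moment_def using gm pos by (subst integral_density) auto
qed

text \<open>The supremum lies below the sum of the two measures, which bounds its mass and its
  support.\<close>

lemma unit_measure_sup:
  assumes M: "unit_measure M" and N: "unit_measure N"
  shows "unit_measure (sup_measure' M N)"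
proof -
  have s: "sets N = sets M" "sets M = sets borel" using M N by (auto simp: unit_measure_def)
  interpret S: finite_measure "add_measure M N"
    using unit_measure_add_measure[OF M N] by (rule unit_measure_finite)
  have le: "emeasure (sup_measure' M N) B \<le> emeasure (add_measure M N) B" if "B \<in> sets borel" for B
    using that s by (intro emeasure_sup_measure'_le2) (auto simp: emeasure_add_measure)
  have "emeasure (sup_measure' M N) UNIV < \<infinity>"
    using neq_top_trans[OF S.emeasure_finite[of UNIV] le[of UNIV]] by (simp add: less_top[symmetric])
  moreover have "emeasure (sup_measure' M N) (- {0..1}) = 0"
    using le[of "- {0..1}"] unit_measure_add_measure[OF M N] by (simp add: unit_measure_def)
  ultimately show ?thesis
    using s unit_measure_space[OF M] by (auto simp: unit_measure_def intro!: finite_measureI)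
qed

lemma unit_measure_diff:
  assumes M: "unit_measure M" and N: "unit_measure N"
    and le: "\<And>B. B \<in> sets borel \<Longrightarrow> emeasure N B \<le> emeasure M B"
  shows "unit_measure (diff_measure M N)" "add_measure (diff_measure M N) N = M"
proof -
  have s: "sets N = sets M" "sets M = sets borel" using M N by (auto simp: unit_measure_def)
  interpret M: finite_measure M by (rule unit_measure_finite[OF M])
  interpret N: finite_measure N by (rule unit_measure_finite[OF N])
  have em: "emeasure (diff_measure M N) B = emeasure M B - emeasure N B" if "B \<in> sets borel" for B
    using that s le by (intro emeasure_diff_measure) (auto intro: M.finite_measure_axioms N.finite_measure_axioms)
  show "unit_measure (diff_measure M N)"
    using M s unit_measure_space[OF M] by (auto simp: unit_measure_def em intro!: finite_measureI)
  show "add_measure (diff_measure M N) N = M"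
  proof (rule measure_eqI)
    fix B assume "B \<in> sets (add_measure (diff_measure M N) N)"
    then have "B \<in> sets borel" using s by simp
    then show "emeasure (add_measure (diff_measure M N) N) B = emeasure M B"
      using s le[of B] N.emeasure_finite[of B] by (simp add: emeasure_add_measure em diff_add_cancel_ennreal)
  qed simp
qed


section \<open>The cone over the symmetric states\<close>

context car
begin

lemma state_moment_add: "state_moment (\<phi> + \<psi>) k = state_moment \<phi> k + state_moment \<psi> k"
  and state_moment_scaleR: "state_moment (t *\<^sub>R \<phi>) k = t * state_moment \<phi> k"
  and state_moment_zero: "state_moment 0 k = 0"
  by (simp_all add: state_moment_def blinfun.add_left blinfun.scaleR_left blinfun.zero_left)

lemma convex_symmetric_states: "convex (symmetric_states a)"
proof (rule convexI)
  fix \<phi> \<psi> and u v :: real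
  assume \<phi>: "\<phi> \<in> symmetric_states a" and \<psi>: "\<psi> \<in> symmetric_states a" and uv: "0 \<le> u" "0 \<le> v" "u + v = 1"
  let ?\<theta> = "u *\<^sub>R \<phi> + v *\<^sub>R \<psi>"
  have ap: "blinfun_apply ?\<theta> x = of_real u * blinfun_apply \<phi> x + of_real v * blinfun_apply \<psi> x" for x
    by (simp add: blinfun.add_left blinfun.scaleR_left scaleR_conv_of_real)
  note s = symmetric_state[OF \<phi>] symmetric_state[OF \<psi>]
  have "state ?\<theta>"
    unfolding state_def
  proof (intro conjI allI)
    show "blinfun_apply ?\<theta> (c *\<^sub>C x) = c * blinfun_apply ?\<theta> x" for c x
      by (simp add: ap state_scaleC s algebra_simps)
    show "blinfun_apply ?\<theta> (x\<^sup>\<star> * x) \<in> \<real>\<^sub>\<ge>\<^sub>0" for x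
      unfolding ap using uv by (intro nonneg_Reals_add_I nonneg_Reals_mult_I state_pos s) simp_all
    show "blinfun_apply ?\<theta> 1 = 1"
      using uv(3) by (simp add: ap state_one s flip: of_real_add)
  qed
  moreover have "blinfun_apply ?\<theta> (perm_action a g x) = blinfun_apply ?\<theta> x" for g x
    by (simp add: ap symmetric_invariant[OF \<phi>] symmetric_invariant[OF \<psi>])
  ultimately show "?\<theta> \<in> symmetric_states a"
    unfolding symmetric_states_def by auto
qed

abbreviation "sym_cone \<equiv> cone_over (symmetric_states a)"

lemma sym_cone_add:
  assumes "u \<in> sym_cone" "v \<in> sym_cone" shows "u + v \<in> sym_cone"
proof -
  obtain t \<phi> s \<psi> where u: "u = (t *\<^sub>R \<phi>, t)" "0 \<le> t" "\<phi> \<in> symmetric_states a"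
    and v: "v = (s *\<^sub>R \<psi>, s)" "0 \<le> s" "\<psi> \<in> symmetric_states a"
    using assms unfolding cone_over_def by blast
  show ?thesis
  proof (cases "t + s = 0")
    case True
    then have "t = 0" "s = 0" using u v by auto
    then show ?thesis using u v assms by (simp add: zero_prod_def[symmetric])
  next
    case False
    then have ts: "t + s > 0" using u v by auto
    define \<theta> where "\<theta> = (t / (t + s)) *\<^sub>R \<phi> + (s / (t + s)) *\<^sub>R \<psi>"
    have "\<theta> \<in> symmetric_states a"
      unfolding \<theta>_def using convex_symmetric_states u v ts
      by (intro convexD) (auto simp: add_divide_distrib[symmetric])
    moreover have "u + v = ((t + s) *\<^sub>R \<theta>, t + s)"
      using ts u v by (simp add: \<theta>_def scaleR_add_right)
    ultimately show ?thesis
      unfolding cone_over_def using ts by (intro CollectI exI[of _ "t + s"] exI[of _ \<theta>]) auto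
  qed
qed

text \<open>Together with \<open>measure_sym_cone\<close> and \<open>sym_cone_eqI\<close> this
  identifies the cone with the finite measures on the unit interval, with the moments as common
  coordinates.\<close>

lemma sym_cone_measure:
  assumes "w \<in> sym_cone"
  shows "\<exists>M. unit_measure M \<and> moment M = state_moment (fst w)"
proof -
  obtain t \<phi> where w: "w = (t *\<^sub>R \<phi>, t)" "0 \<le> t" "\<phi> \<in> symmetric_states a"
    using assms unfolding cone_over_def by blast
  obtain M where M: "unit_measure M" "moment M = state_moment \<phi>"
    using symmetric_state_mixture[OF w(3)] by blast
  have "moment (density M (\<lambda>_. ennreal t)) k = state_moment (fst w) k" for k
    using unit_measure_density(2)[OF M(1), of "\<lambda>_. t"] w(2) fun_cong[OF M(2), of k]
    by (simp add: w(1) state_moment_scaleR moment_def)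
  moreover have "unit_measure (density M (\<lambda>_. ennreal t))"
    using unit_measure_density(1)[OF M(1), of "\<lambda>_. t"] w(2) by simp
  ultimately show ?thesis by blast
qed

lemma measure_sym_cone:
  assumes M: "unit_measure M"
  shows "\<exists>w\<in>sym_cone. state_moment (fst w) = moment M"
proof (cases "measure M UNIV = 0")
  case True
  have "continuous_on UNIV (\<lambda>x::real. x ^ k)" for k by (intro continuous_intros)
  from unit_measure_norm_integral_le[OF M this, of _ 1] True have "moment M k = 0" for k
    by (simp add: moment_def power_le_one)
  \<comment> \<open>The vertex of the cone: at height 0 any symmetric state can serve as the
    witness.\<close>
  then show ?thesis
    unfolding cone_over_def
    by (intro bexI[of _ "(0 *\<^sub>R prod_state 0, 0)"])
       (auto simp: state_moment_zero intro!: prod_state_symmetric)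
next
  case False
  define t where "t = measure M UNIV"
  have t: "t > 0" using False by (simp add: t_def less_le)
  define N where "N = density M (\<lambda>_. ennreal (1 / t))"
  have N: "unit_measure N" unfolding N_def using t by (intro unit_measure_density(1)[OF M]) auto
  have mN: "moment N k = moment M k / t" for k
    unfolding N_def using t by (subst unit_measure_density(2)[OF M]) (auto simp: moment_def)
  have "measure N UNIV = 1"
    using mN[of 0] t by (simp add: moment_0 N M t_def)
  then obtain \<psi> where \<psi>: "\<psi> \<in> symmetric_states a" "state_moment \<psi> = moment N"
    using mixture_exists[OF N] by blast
  have "(t *\<^sub>R \<psi>, t) \<in> sym_cone" unfolding cone_over_def using \<psi>(1) t by auto
  moreover have "state_moment (t *\<^sub>R \<psi>) = moment M"
    using t by (auto simp: state_moment_scaleR \<psi>(2) mN)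
  ultimately show ?thesis by force
qed

lemma sym_cone_eqI:
  assumes "u \<in> sym_cone" "v \<in> sym_cone" "\<And>k. state_moment (fst u) k = state_moment (fst v) k"
  shows "u = v"
proof -
  obtain t \<phi> s \<psi> where u: "u = (t *\<^sub>R \<phi>, t)" "0 \<le> t" "\<phi> \<in> symmetric_states a"
    and v: "v = (s *\<^sub>R \<psi>, s)" "0 \<le> s" "\<psi> \<in> symmetric_states a"
    using assms unfolding cone_over_def by blast
  have eq: "t * state_moment \<phi> k = s * state_moment \<psi> k" for k
    using assms(3)[of k] u v by (simp add: state_moment_scaleR)
  from eq[of 0] have "t = s" using u v by (simp add: state_moment_0)
  then show ?thesis
  proof (cases "t = 0")
    case False
    then have "\<phi> = \<psi>" using eq \<open>t = s\<close> u v by (intro symmetric_state_eqI) auto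
    then show ?thesis using u v \<open>t = s\<close> by simp
  qed (use u v in simp)
qed

text \<open>The cone order asks for the difference to lie in the cone, and the difference
  corresponds to the measure \<open>N - M\<close>, which exists as soon as \<open>M\<close> lies
  below \<open>N\<close> on every Borel set.\<close>

lemma sym_cone_le_iff:
  assumes u: "u \<in> sym_cone" "unit_measure M" "moment M = state_moment (fst u)"
    and v: "v \<in> sym_cone" "unit_measure N" "moment N = state_moment (fst v)"
  shows "cone_le sym_cone u v \<longleftrightarrow> (\<forall>B\<in>sets borel. emeasure M B \<le> emeasure N B)"
proof
  assume "cone_le sym_cone u v"
  then have w: "v - u \<in> sym_cone" by (simp add: cone_le_def)
  then obtain D where D: "unit_measure D" "moment D = state_moment (fst (v - u))"
    using sym_cone_measure by blast
  have "N = add_measure M D"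
  proof (rule unit_measure_eqI[OF v(2) unit_measure_add_measure[OF u(2) D(1)]])
    fix k
    have "state_moment (fst v) k = state_moment (fst u + fst (v - u)) k" by simp
    then show "moment N k = moment (add_measure M D) k"
      unfolding state_moment_add by (simp add: moment_add_measure[OF u(2) D(1)] D(2) u(3) v(3))
  qed
  then show "\<forall>B\<in>sets borel. emeasure M B \<le> emeasure N B"
    using unit_measure_sets[OF u(2)] unit_measure_sets[OF D(1)] by (auto simp: emeasure_add_measure)
next
  assume le: "\<forall>B\<in>sets borel. emeasure M B \<le> emeasure N B"
  then have D: "unit_measure (diff_measure N M)" "add_measure (diff_measure N M) M = N"
    using unit_measure_diff[OF v(2) u(2)] by auto
  obtain w where w: "w \<in> sym_cone" "state_moment (fst w) = moment (diff_measure N M)"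
    using measure_sym_cone[OF D(1)] by blast
  have "v = w + u"
  proof (rule sym_cone_eqI[OF v(1) sym_cone_add[OF w(1) u(1)]])
    fix k
    have "moment N k = moment (diff_measure N M) k + moment M k"
      using moment_add_measure[OF D(1) u(2)] D(2) by simp
    then show "state_moment (fst v) k = state_moment (fst (w + u)) k"
      by (simp add: state_moment_add w(2) flip: u(3) v(3))
  qed
  then show "cone_le sym_cone u v" using w(1) by (simp add: cone_le_def)
qed

lemma sym_cone_sup:
  assumes u: "u \<in> sym_cone" and v: "v \<in> sym_cone"
  shows "\<exists>s\<in>sym_cone. cone_le sym_cone u s \<and> cone_le sym_cone v s \<and>
    (\<forall>w\<in>sym_cone. cone_le sym_cone u w \<and> cone_le sym_cone v w \<longrightarrow> cone_le sym_cone s w)"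
proof -
  obtain M where M: "unit_measure M" "moment M = state_moment (fst u)" using sym_cone_measure[OF u] by blast
  obtain N where N: "unit_measure N" "moment N = state_moment (fst v)" using sym_cone_measure[OF v] by blast
  define S where "S = sup_measure' M N"
  have S: "unit_measure S" unfolding S_def by (rule unit_measure_sup[OF M(1) N(1)])
  obtain s where s: "s \<in> sym_cone" "moment S = state_moment (fst s)" using measure_sym_cone[OF S] by metis
  have sets: "sets M = sets borel" "sets N = sets borel" using M N by (auto simp: unit_measure_def)
  have "cone_le sym_cone u s" "cone_le sym_cone v s"
    unfolding sym_cone_le_iff[OF u M s(1) S s(2)] sym_cone_le_iff[OF v N s(1) S s(2)]
    using sets by (auto simp: S_def intro: le_emeasure_sup_measure'1 le_emeasure_sup_measure'2)
  moreover have "cone_le sym_cone s w"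
    if w: "w \<in> sym_cone" and le: "cone_le sym_cone u w" "cone_le sym_cone v w" for w
  proof -
    obtain W where W: "unit_measure W" "moment W = state_moment (fst w)" using sym_cone_measure[OF w] by blast
    show ?thesis
      unfolding sym_cone_le_iff[OF s(1) S s(2) w W]
    proof
      fix B :: "real set" assume "B \<in> sets borel"
      then show "emeasure S B \<le> emeasure W B"
        using le sets W(1) unfolding S_def sym_cone_le_iff[OF u M w W] sym_cone_le_iff[OF v N w W]
        by (intro emeasure_sup_measure'_le2) (auto simp: unit_measure_def)
    qed
  qed
  ultimately show ?thesis using s(1) by blast
qed

lemma lattice_cone_sym_cone: "lattice_cone sym_cone"
  unfolding lattice_cone_def
proof (intro ballI conjI)
  fix u v assume u: "u \<in> sym_cone" and v: "v \<in> sym_cone"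
  show "\<exists>s\<in>sym_cone. cone_le sym_cone u s \<and> cone_le sym_cone v s \<and>
    (\<forall>w\<in>sym_cone. cone_le sym_cone u w \<and> cone_le sym_cone v w \<longrightarrow> cone_le sym_cone s w)"
    by (rule sym_cone_sup[OF u v])
  then obtain s where s: "s \<in> sym_cone" "s - u \<in> sym_cone" "s - v \<in> sym_cone"
    "\<And>w. w \<in> sym_cone \<Longrightarrow> w - u \<in> sym_cone \<Longrightarrow> w - v \<in> sym_cone \<Longrightarrow> w - s \<in> sym_cone"
    unfolding cone_le_def by blast
  \<comment> \<open>The map sending \<open>x\<close> to \<open>u + v - x\<close> reverses the cone
    order and exchanges upper and lower bounds of \<open>u\<close> and \<open>v\<close>, so it
    carries the supremum to the infimum.\<close>
  have "u + v - s \<in> sym_cone" using sym_cone_add[OF u v] u v by (intro s(4)) auto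
  moreover have "u + v - s - w \<in> sym_cone"
    if "w \<in> sym_cone" "u - w \<in> sym_cone" "v - w \<in> sym_cone" for w
  proof -
    have "u + v - w - s \<in> sym_cone"
      using sym_cone_add[OF u that(3)] that by (intro s(4)) (auto simp: algebra_simps)
    then show ?thesis by (simp add: algebra_simps)
  qed
  ultimately show "\<exists>i\<in>sym_cone. cone_le sym_cone i u \<and> cone_le sym_cone i v \<and>
    (\<forall>w\<in>sym_cone. cone_le sym_cone w u \<and> cone_le sym_cone w v \<longrightarrow> cone_le sym_cone w i)"
    unfolding cone_le_def using s(2,3) by (intro bexI[of _ "u + v - s"]) auto
qed


section \<open>Compactness and extreme points\<close>

text \<open>Contractivity places the states in a product of discs, and the defining conditions are
  closed under pointwise limits. Conversely, the disc bounds make such a function a bounded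
  functional.\<close>

lemma compactin_symmetric_states: "compactin weak_star (symmetric_states a)"
proof (rule compactin_strong_operator_topology)
  define F where "F = {f :: 'a \<Rightarrow> complex. (\<forall>x. f x \<in> cball 0 (norm x)) \<and> (\<forall>x y. f (x + y) = f x + f y) \<and>
    (\<forall>c x. f (c *\<^sub>C x) = c * f x) \<and> (\<forall>x. f (x\<^sup>\<star> * x) \<in> \<real>\<^sub>\<ge>\<^sub>0) \<and> f 1 = 1 \<and>
    (\<forall>g x. f (perm_action a g x) = f x)}"
  have "blinfun_apply ` symmetric_states a = F"
  proof (intro equalityI subsetI)
    fix f assume "f \<in> blinfun_apply ` symmetric_states a"
    then obtain \<phi> where \<phi>: "\<phi> \<in> symmetric_states a" "f = blinfun_apply \<phi>" by blast
    then show "f \<in> F"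
      using symmetric_state[OF \<phi>(1)]
      by (auto simp: F_def symmetric_invariant symmetric_state_norm_le blinfun.add_right
          state_scaleC state_pos state_one)
  next
    fix f assume "f \<in> F"
    then have f: "\<And>x. norm (f x) \<le> norm x" "\<And>x y. f (x + y) = f x + f y" "\<And>c x. f (c *\<^sub>C x) = c * f x"
      "\<And>x. f (x\<^sup>\<star> * x) \<in> \<real>\<^sub>\<ge>\<^sub>0" "f 1 = 1" "\<And>g x. f (perm_action a g x) = f x"
      by (auto simp: F_def)
    then have "bounded_linear f"
      by (intro bounded_linear_intro[where K = 1]) (auto simp: scaleR_eq_scaleC scaleR_conv_of_real)
    then have bf: "blinfun_apply (Blinfun f) = f" by (rule bounded_linear_Blinfun_apply)
    then have "Blinfun f \<in> symmetric_states a"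
      using f by (auto simp: symmetric_states_def state_def)
    then show "f \<in> blinfun_apply ` symmetric_states a" using bf by (metis image_eqI)
  qed
  moreover have "compact F"
  proof -
    have "compactin (product_topology (\<lambda>_::'a. euclidean) UNIV) (PiE UNIV (\<lambda>x. cball (0::complex) (norm x)))"
      unfolding compactin_PiE by simp
    then have "compact {f :: 'a \<Rightarrow> complex. \<forall>x. f x \<in> cball 0 (norm x)}"
      by (simp add: euclidean_product_topology PiE_UNIV_domain Pi_def)
    moreover have "closed {f :: 'a \<Rightarrow> complex. (\<forall>x y. f (x + y) = f x + f y) \<and>
      (\<forall>c x. f (c *\<^sub>C x) = c * f x) \<and> (\<forall>x. f (x\<^sup>\<star> * x) \<in> \<real>\<^sub>\<ge>\<^sub>0) \<and> f 1 = 1 \<and>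
      (\<forall>g x. f (perm_action a g x) = f x)}"
      by (intro closed_Collect_conj closed_Collect_all closed_Collect_eq continuous_intros
          continuous_on_product_coordinates closed_vimage[OF closed_nonneg_Reals_complex, unfolded vimage_def])
    ultimately have "compact ({f :: 'a \<Rightarrow> complex. \<forall>x. f x \<in> cball 0 (norm x)} \<inter>
      {f :: 'a \<Rightarrow> complex. (\<forall>x y. f (x + y) = f x + f y) \<and>
      (\<forall>c x. f (c *\<^sub>C x) = c * f x) \<and> (\<forall>x. f (x\<^sup>\<star> * x) \<in> \<real>\<^sub>\<ge>\<^sub>0) \<and> f 1 = 1 \<and>
      (\<forall>g x. f (perm_action a g x) = f x)})"
      by (rule compact_Int_closed)
    moreover have "\<dots> = F" by (auto simp: F_def)
    ultimately show ?thesis by simp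
  qed
  ultimately show "compact (blinfun_apply ` symmetric_states a)" by simp
qed

text \<open>The variance of the representing measure.\<close>

definition state_variance :: "('a \<Rightarrow>\<^sub>L complex) \<Rightarrow> real" where
  "state_variance \<psi> = state_moment \<psi> 2 - (state_moment \<psi> 1)\<^sup>2"

lemma state_variance_integral:
  assumes "\<psi> \<in> symmetric_states a" "unit_measure M" "moment M = state_moment \<psi>"
  shows "(LINT x|M. (x - state_moment \<psi> 1)\<^sup>2) = state_variance \<psi>"
proof -
  let ?m = "state_moment \<psi> 1"
  note int = unit_measure_integrable[OF assms(2)]
  have 1: "(LINT x|M. x) = ?m" "(LINT x|M. x\<^sup>2) = state_moment \<psi> 2" "measure M (space M) = 1"
    using fun_cong[OF assms(3), of 1] fun_cong[OF assms(3), of 2] fun_cong[OF assms(3), of 0]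
      moment_0[OF assms(2)] state_moment_0[OF assms(1)] unit_measure_space[OF assms(2)]
    by (auto simp: moment_def)
  have "(LINT x|M. (x - ?m)\<^sup>2) = (LINT x|M. x\<^sup>2 - 2 * ?m * x + ?m\<^sup>2)"
    by (rule arg_cong[where f = "integral\<^sup>L M"]) (auto simp: power2_eq_square algebra_simps)
  also have "\<dots> = state_moment \<psi> 2 - 2 * ?m * ?m + ?m\<^sup>2"
  proof -
    have "integrable M (\<lambda>x. x\<^sup>2)" "integrable M (\<lambda>x. 2 * ?m * x)" "integrable M (\<lambda>x. ?m\<^sup>2)"
      by (intro int continuous_intros)+
    then show ?thesis using 1 by simp
  qed
  finally show ?thesis by (simp add: state_variance_def power2_eq_square)
qed

lemma state_variance_nonneg:
  assumes "\<psi> \<in> symmetric_states a" shows "0 \<le> state_variance \<psi>"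
proof -
  obtain M where M: "unit_measure M" "moment M = state_moment \<psi>"
    using symmetric_state_mixture[OF assms] by blast
  show ?thesis
    unfolding state_variance_integral[OF assms M, symmetric]
    by (rule unit_measure_integral_nonneg[OF M(1)]) simp
qed

text \<open>Zero variance concentrates the representing measure at its mean, so the moments are the
  powers of the mean.\<close>

lemma state_variance_zero:
  assumes "\<psi> \<in> symmetric_states a" "state_variance \<psi> = 0"
  shows "\<psi> = prod_state (state_moment \<psi> 1)" "state_moment \<psi> 1 \<in> {0..1}"
    "state_moment \<psi> k = state_moment \<psi> 1 ^ k"
proof -
  let ?m = "state_moment \<psi> 1"
  obtain M where M: "unit_measure M" "moment M = state_moment \<psi>" "measure M UNIV = 1"
    using symmetric_state_mixture[OF assms(1)] by blast
  interpret prob_space M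
    using M(3) unit_measure_space[OF M(1)] unit_measure_finite[OF M(1)]
    by (intro prob_spaceI) (simp add: finite_measure.emeasure_eq_measure)
  have int: "integrable M (\<lambda>x. (x - ?m)\<^sup>2)"
    by (intro unit_measure_integrable[OF M(1)] continuous_intros)
  have "AE x in M. (x - ?m)\<^sup>2 = 0"
    using integral_nonneg_eq_0_iff_AE[OF int] state_variance_integral[OF assms(1) M(1,2)] assms(2)
    by simp
  then have AE: "AE x in M. x = ?m" by simp
  have "AE x in M. ?m \<in> {0..1}"
    using AE unit_measure_AE[OF M(1)] by eventually_elim simp
  then show m: "?m \<in> {0..1}" by simp
  have mom: "state_moment \<psi> k = ?m ^ k" for k
  proof -
    have "moment M k = (LINT x|M. ?m ^ k)"
      unfolding moment_def
    proof (rule integral_cong_AE)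
      show "(\<lambda>x. x ^ k) \<in> borel_measurable M"
        by (intro borel_measurable_integrable unit_measure_integrable[OF M(1)] continuous_intros)
      show "AE x in M. x ^ k = ?m ^ k" using AE by eventually_elim simp
    qed simp
    then show ?thesis by (simp add: M(2) prob_space)
  qed
  then show "state_moment \<psi> k = ?m ^ k" .
  show "\<psi> = prod_state ?m"
    by (rule symmetric_state_eqI[OF assms(1) prod_state_symmetric])
      (unfold state_moment_prod_state[OF m], rule mom)
qed

lemma state_variance_prod_state: "l \<in> {0..1} \<Longrightarrow> state_variance (prod_state l) = 0"
  by (simp add: state_variance_def state_moment_prod_state)

lemma state_moment_1_unit:
  assumes "\<psi> \<in> symmetric_states a"
  shows "state_moment \<psi> 1 \<in> {0..1}"
proof -
  obtain M where M: "unit_measure M" "moment M = state_moment \<psi>" "measure M UNIV = 1"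
    using symmetric_state_mixture[OF assms] by blast
  have "norm (LINT x|M. x ^ 1) \<le> 1 * measure M UNIV"
    by (intro unit_measure_norm_integral_le[OF M(1)] continuous_intros) auto
  then have "\<bar>moment M 1\<bar> \<le> 1" using M(3) by (simp add: moment_def)
  then show ?thesis using moment_nonneg[OF M(1), of 1] by (simp add: M(2))
qed

text \<open>
  If \<open>M\<close> represents an extreme state with mean \<open>m\<close>, then \<open>(1 + (x - m)) M\<close> and \<open>(1 - (x - m)) M\<close>
  represent the same state.
\<close>

lemma extreme_imp_variance_zero:
  assumes "\<psi> extreme_point_of symmetric_states a"
  shows "state_variance \<psi> = 0"
proof -
  have \<psi>: "\<psi> \<in> symmetric_states a" using assms by (simp add: extreme_point_of_def)
  let ?m = "state_moment \<psi> 1"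
  obtain M where M: "unit_measure M" "moment M = state_moment \<psi>"
    using symmetric_state_mixture[OF \<psi>] by blast
  have m: "?m \<in> {0..1}" by (rule state_moment_1_unit[OF \<psi>])
  have ex: "\<exists>\<psi>'\<in>symmetric_states a. \<forall>k. state_moment \<psi>' k =
      state_moment \<psi> k + e * (state_moment \<psi> (Suc k) - ?m * state_moment \<psi> k)"
    if e: "\<bar>e\<bar> \<le> 1" for e
  proof -
    define g where "g x = 1 + e * (x - ?m)" for x
    have g: "continuous_on UNIV g" unfolding g_def by (intro continuous_intros)
    have g0: "0 \<le> g x" if "x \<in> {0..1}" for x
    proof -
      have "\<bar>e * (x - ?m)\<bar> \<le> 1"
        using e that m unfolding abs_mult by (intro mult_le_one) auto
      then show ?thesis by (simp add: g_def abs_le_iff)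
    qed
    define N where "N = density M (\<lambda>x. ennreal (g x))"
    have N: "unit_measure N" unfolding N_def by (rule unit_measure_density(1)[OF M(1) g g0])
    have mN: "moment N k = state_moment \<psi> k + e * (state_moment \<psi> (Suc k) - ?m * state_moment \<psi> k)" for k
    proof -
      have "moment N k = (LINT x|M. g x * x ^ k)"
        unfolding N_def by (rule unit_measure_density(2)[OF M(1) g g0])
      also have "\<dots> = (LINT x|M. x ^ k + (e * x ^ Suc k - e * ?m * x ^ k))"
        by (rule arg_cong[where f = "integral\<^sup>L M"]) (auto simp: g_def algebra_simps)
      also have "\<dots> = moment M k + (e * moment M (Suc k) - e * ?m * moment M k)"
      proof -
        have "integrable M (\<lambda>x. x ^ k)" "integrable M (\<lambda>x. e * x ^ Suc k)" "integrable M (\<lambda>x. e * ?m * x ^ k)"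
          by (intro unit_measure_integrable[OF M(1)] continuous_intros)+
        then show ?thesis by (simp add: moment_def del: power_Suc)
      qed
      finally show ?thesis by (simp add: M(2) algebra_simps)
    qed
    have "measure N UNIV = 1"
      using mN[of 0] by (simp add: moment_0[OF N] state_moment_0[OF \<psi>])
    from mixture_exists[OF N this] obtain \<psi>' where "\<psi>' \<in> symmetric_states a" "state_moment \<psi>' = moment N"
      by blast
    then show ?thesis using mN by (intro bexI[of _ \<psi>']) simp_all
  qed
  obtain \<alpha> where \<alpha>: "\<alpha> \<in> symmetric_states a"
    "\<And>k. state_moment \<alpha> k = state_moment \<psi> k + 1 * (state_moment \<psi> (Suc k) - ?m * state_moment \<psi> k)"
    using ex[of 1] by auto
  obtain \<beta> where \<beta>: "\<beta> \<in> symmetric_states a"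
    "\<And>k. state_moment \<beta> k = state_moment \<psi> k + (- 1) * (state_moment \<psi> (Suc k) - ?m * state_moment \<psi> k)"
    using ex[of "- 1"] by auto
  have eq: "\<psi> = (1 - 1/2) *\<^sub>R \<alpha> + (1/2) *\<^sub>R \<beta>"
  proof (rule symmetric_state_eqI[OF \<psi>])
    show "(1 - 1/2) *\<^sub>R \<alpha> + (1/2) *\<^sub>R \<beta> \<in> symmetric_states a"
      using convex_symmetric_states \<alpha>(1) \<beta>(1) by (intro convexD) auto
    show "state_moment \<psi> k = state_moment ((1 - 1/2) *\<^sub>R \<alpha> + (1/2) *\<^sub>R \<beta>) k" for k
      unfolding state_moment_add state_moment_scaleR by (simp add: \<alpha>(2) \<beta>(2) field_simps)
  qed
  have "\<alpha> = \<beta>"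
  proof (rule ccontr)
    assume "\<alpha> \<noteq> \<beta>"
    then have "\<psi> \<in> open_segment \<alpha> \<beta>"
      unfolding in_segment by (intro conjI exI[of _ "1/2"] eq) simp_all
    then show False using assms \<alpha>(1) \<beta>(1) unfolding extreme_point_of_def by blast
  qed
  \<comment> \<open>The two means differ by twice the variance.\<close>
  then have "state_moment \<alpha> 1 = state_moment \<beta> 1" by simp
  then show ?thesis
    unfolding \<alpha>(2) \<beta>(2) by (simp add: state_variance_def power2_eq_square numeral_2_eq_2)
qed

text \<open>The variance of a mixture is the mixture of the variances plus a multiple of the squared
  difference of the means. If it vanishes, both components have variance zero and the same mean,
  hence are the same product state.\<close>

lemma variance_zero_imp_extreme:
  assumes \<psi>: "\<psi> \<in> symmetric_states a" and var: "state_variance \<psi> = 0"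
  shows "\<psi> extreme_point_of symmetric_states a"
  unfolding extreme_point_of_def
proof (intro conjI ballI notI)
  fix \<alpha> \<beta> assume \<alpha>: "\<alpha> \<in> symmetric_states a" and \<beta>: "\<beta> \<in> symmetric_states a" and "\<psi> \<in> open_segment \<alpha> \<beta>"
  then obtain u where ne: "\<alpha> \<noteq> \<beta>" and u: "0 < u" "u < 1" "\<psi> = (1 - u) *\<^sub>R \<alpha> + u *\<^sub>R \<beta>"
    by (auto simp: in_segment)
  let ?d = "state_moment \<alpha> 1 - state_moment \<beta> 1"
  have "state_variance \<psi> = (1 - u) * state_variance \<alpha> + u * state_variance \<beta> + (1 - u) * u * ?d\<^sup>2"
    unfolding state_variance_def u(3) state_moment_add state_moment_scaleR
    by (simp add: power2_eq_square algebra_simps)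
  moreover have "0 \<le> (1 - u) * state_variance \<alpha>" "0 \<le> u * state_variance \<beta>" "0 \<le> (1 - u) * u * ?d\<^sup>2"
    using u state_variance_nonneg[OF \<alpha>] state_variance_nonneg[OF \<beta>] by auto
  ultimately have "(1 - u) * state_variance \<alpha> = 0" "u * state_variance \<beta> = 0" "(1 - u) * u * ?d\<^sup>2 = 0"
    using var by linarith+
  then have "state_variance \<alpha> = 0" "state_variance \<beta> = 0" "state_moment \<alpha> 1 = state_moment \<beta> 1"
    using u by auto
  then show False using ne state_variance_zero(1)[OF \<alpha>] state_variance_zero(1)[OF \<beta>] by metis
qed (rule \<psi>)


section \<open>Maximal measures\<close>

abbreviation "sym_top \<equiv> subtopology weak_star (symmetric_states a)"

abbreviation "sym_borel \<equiv> sigma (symmetric_states a) {U. openin sym_top U}"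

lemma topspace_sym_top [simp]: "topspace sym_top = symmetric_states a"
  by (simp add: strong_operator_topology_topspace)

lemma sym_open_subset: "{U. openin sym_top U} \<subseteq> Pow (symmetric_states a)"
  using openin_subset[of sym_top] by auto

lemma space_sym_borel [simp]: "space sym_borel = symmetric_states a"
  by (rule space_measure_of[OF sym_open_subset])

lemma sets_sym_borel: "sets sym_borel = sigma_sets (symmetric_states a) {U. openin sym_top U}"
  by (rule sets_measure_of[OF sym_open_subset])

lemma continuous_map_sym_eval: "continuous_map sym_top euclidean (\<lambda>\<psi>. blinfun_apply \<psi> x)"
  by (intro continuous_map_from_subtopology strong_operator_topology_continuous_evaluation)

lemma continuous_map_state_moment: "continuous_map sym_top euclideanreal (\<lambda>\<psi>. state_moment \<psi> k)"
  unfolding state_moment_def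
  using continuous_map_compose[OF continuous_map_sym_eval, of euclideanreal Re]
  by (simp add: o_def continuous_on_Re)

lemma continuous_map_sym_measurable:
  fixes f :: "_ \<Rightarrow> 'b::topological_space"
  assumes "continuous_map sym_top euclidean f"
  shows "f \<in> borel_measurable sym_borel"
proof (rule borel_measurableI)
  fix S :: "'b set" assume "open S"
  then have "openin sym_top {x \<in> topspace sym_top. f x \<in> S}"
    by (intro openin_continuous_map_preimage[OF assms]) auto
  then show "f -` S \<inter> space sym_borel \<in> sets sym_borel"
    by (auto simp: sets_sym_borel vimage_def Collect_conj_eq Int_commute intro: sigma_sets.Basic)
qed

lemma continuous_map_prod_state: "continuous_map euclideanreal sym_top prod_state"
  by (intro continuous_map_into_subtopology)
     (auto simp: continuous_on_strong_operator_topo_iff_coordinatewise continuous_prod_state prod_state_symmetric)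

lemma measurable_prod_state: "prod_state \<in> measurable borel sym_borel"
proof (rule measurable_measure_of[OF sym_open_subset])
  fix U assume "U \<in> {U. openin sym_top U}"
  then have "openin euclideanreal {x \<in> topspace euclideanreal. prod_state x \<in> U}"
    by (intro openin_continuous_map_preimage[OF continuous_map_prod_state]) auto
  then show "prod_state -` U \<inter> space borel \<in> sets borel"
    by (simp add: vimage_def)
qed (auto simp: prod_state_symmetric)

definition boundary_measure :: "real measure \<Rightarrow> ('a \<Rightarrow>\<^sub>L complex) measure" where
  "boundary_measure M = distr M sym_borel prod_state"

lemma sets_boundary_measure [simp]: "sets (boundary_measure M) = sets sym_borel"
  and space_boundary_measure [simp]: "space (boundary_measure M) = symmetric_states a"
  by (simp_all add: boundary_measure_def)

lemma measurable_prod_state': "unit_measure M \<Longrightarrow> prod_state \<in> measurable M sym_borel"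
  using measurable_prod_state measurable_cong_sets[OF unit_measure_sets refl] by blast

text \<open>Inner regularity comes from the real line: a compact subset of the preimage of
  \<open>B\<close> has compact image inside \<open>B\<close>, because \<open>prod_state\<close> is
  continuous.\<close>

lemma radon_boundary_measure:
  assumes M: "unit_measure M"
  shows "radon_measure sym_top (boundary_measure M)"
  unfolding radon_measure_def
proof (intro conjI ballI)
  interpret M: finite_measure M by (rule unit_measure_finite[OF M])
  show "finite_measure (boundary_measure M)"
    unfolding boundary_measure_def by (rule M.finite_measure_distr[OF measurable_prod_state'[OF M]])
  show "sets (boundary_measure M) = sets (sigma (topspace sym_top) {U. openin sym_top U})" by simp
  fix B assume "B \<in> sets (boundary_measure M)"
  then have B: "B \<in> sets sym_borel" by simp
  let ?P = "prod_state -` B"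
  have em: "emeasure (boundary_measure M) A = emeasure M (prod_state -` A)" if "A \<in> sets sym_borel" for A
    unfolding boundary_measure_def
    using emeasure_distr[OF measurable_prod_state'[OF M] that] by (simp add: unit_measure_space[OF M])
  have P: "?P \<in> sets borel" using measurable_sets[OF measurable_prod_state B] by simp
  \<comment> \<open>Evaluations separate states, so the topology is Hausdorff and compact sets are
    Borel.\<close>
  have comp: "compactin sym_top C \<Longrightarrow> C \<in> sets sym_borel" for C
  proof -
    assume "compactin sym_top C"
    moreover have "Hausdorff_space sym_top"
      unfolding Hausdorff_space_def
    proof (intro allI impI)
      fix \<phi> \<psi> assume "\<phi> \<in> topspace sym_top \<and> \<psi> \<in> topspace sym_top \<and> \<phi> \<noteq> \<psi>"
      then obtain x where "blinfun_apply \<phi> x \<noteq> blinfun_apply \<psi> x" and mem: "\<phi> \<in> topspace sym_top" "\<psi> \<in> topspace sym_top"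
        by (auto intro: blinfun_eqI)
      then obtain U V where UV: "open U" "open V" "blinfun_apply \<phi> x \<in> U" "blinfun_apply \<psi> x \<in> V" "U \<inter> V = {}"
        by (meson hausdorff)
      have "openin sym_top {\<theta> \<in> topspace sym_top. blinfun_apply \<theta> x \<in> W}" if "open W" for W
        using that by (intro openin_continuous_map_preimage[OF continuous_map_sym_eval]) auto
      with UV mem show "\<exists>U V. openin sym_top U \<and> openin sym_top V \<and> \<phi> \<in> U \<and> \<psi> \<in> V \<and> disjnt U V"
        by (intro exI[of _ "{\<theta> \<in> topspace sym_top. blinfun_apply \<theta> x \<in> U}"]
            exI[of _ "{\<theta> \<in> topspace sym_top. blinfun_apply \<theta> x \<in> V}"]) (auto simp: disjnt_def)
    qed
    ultimately have "closedin sym_top C" by (simp add: compactin_imp_closedin)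
    then have "openin sym_top (symmetric_states a - C)" "C \<subseteq> symmetric_states a"
      using closedin_def[of sym_top C] by auto
    then have "symmetric_states a - (symmetric_states a - C) \<in> sets sym_borel"
      unfolding sets_sym_borel by (intro sigma_sets.Compl sigma_sets.Basic) auto
    then show "C \<in> sets sym_borel" using \<open>C \<subseteq> _\<close> by (simp add: double_diff)
  qed
  show "emeasure (boundary_measure M) B = (SUP C\<in>{C. compactin sym_top C \<and> C \<subseteq> B}. emeasure (boundary_measure M) C)"
  proof (rule antisym)
    have "emeasure (boundary_measure M) B = (SUP K\<in>{K. K \<subseteq> ?P \<and> compact K}. emeasure M K)"
      unfolding em[OF B] using P unit_measure_sets[OF M] M.emeasure_finite
      by (intro inner_regular) auto
    also have "\<dots> \<le> (SUP C\<in>{C. compactin sym_top C \<and> C \<subseteq> B}. emeasure (boundary_measure M) C)"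
    proof (rule SUP_mono)
      fix K assume "K \<in> {K. K \<subseteq> ?P \<and> compact K}"
      then have K: "K \<subseteq> ?P" "compactin euclideanreal K" by auto
      then have C: "compactin sym_top (prod_state ` K)"
        by (intro image_compactin[OF _ continuous_map_prod_state])
      have "emeasure M K \<le> emeasure (boundary_measure M) (prod_state ` K)"
        unfolding em[OF comp[OF C]]
        using measurable_sets[OF measurable_prod_state comp[OF C]] unit_measure_sets[OF M]
        by (intro emeasure_mono) auto
      then show "\<exists>C\<in>{C. compactin sym_top C \<and> C \<subseteq> B}. emeasure M K \<le> emeasure (boundary_measure M) C"
        using C K by (intro bexI[of _ "prod_state ` K"]) auto
    qed
    finally show "emeasure (boundary_measure M) B \<le> (SUP C\<in>{C. compactin sym_top C \<and> C \<subseteq> B}. emeasure (boundary_measure M) C)" .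
    show "(SUP C\<in>{C. compactin sym_top C \<and> C \<subseteq> B}. emeasure (boundary_measure M) C) \<le> emeasure (boundary_measure M) B"
      using B by (intro SUP_least emeasure_mono) auto
  qed
qed

lemma integral_boundary_measure:
  fixes f :: "_ \<Rightarrow> 'b::{banach, second_countable_topology}"
  assumes "unit_measure M" "continuous_map sym_top euclidean f"
  shows "(LINT \<psi>|boundary_measure M. f \<psi>) = (LINT l|M. f (prod_state l))"
  unfolding boundary_measure_def
  by (rule integral_distr[OF measurable_prod_state'[OF assms(1)] continuous_map_sym_measurable[OF assms(2)]])

lemma radon_integrable:
  fixes f :: "_ \<Rightarrow> real"
  assumes \<nu>: "radon_measure sym_top \<nu>" and f: "continuous_map sym_top euclideanreal f"
  shows "integrable \<nu> f"
proof -
  have sets: "sets \<nu> = sets sym_borel" and fin: "finite_measure \<nu>" using \<nu> by (simp_all add: radon_measure_def)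
  have sp: "space \<nu> = symmetric_states a" using sets_eq_imp_space_eq[OF sets] by simp
  have "compact (f ` symmetric_states a)"
    using image_compactin[OF _ f, of "symmetric_states a"] compactin_symmetric_states
    by (simp add: compactin_subtopology)
  then obtain B where B: "\<And>\<psi>. \<psi> \<in> symmetric_states a \<Longrightarrow> norm (f \<psi>) \<le> B"
    using compact_imp_bounded[of "f ` symmetric_states a"] unfolding bounded_iff by (metis image_eqI)
  have "f \<in> borel_measurable \<nu>"
    using continuous_map_sym_measurable[OF f] measurable_cong_sets[OF sets refl] by blast
  then show ?thesis
    using B sp by (intro finite_measure.integrable_const_bound[OF fin, where B = B] AE_I2) auto
qed

section \<open>Maximality of the boundary measures\<close>

text \<open>Affine test functions force \<open>\<nu>\<close> to have the averaged moments of
  \<open>M\<close>; the negative variance forces it onto the product states. There the mean inverts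
  \<open>prod_state\<close>, so \<open>\<nu>\<close> is recovered from its image under the mean, and
  that image is \<open>M\<close>.\<close>

lemma radon_choquet_le_boundary_eq:
  assumes M: "unit_measure M" and \<nu>: "radon_measure sym_top \<nu>"
    and le: "choquet_le weak_star (symmetric_states a) (boundary_measure M) \<nu>"
  shows "\<nu> = boundary_measure M"
proof -
  have sets: "sets \<nu> = sets sym_borel" and fin: "finite_measure \<nu>" using \<nu> by (simp_all add: radon_measure_def)
  have sp: "space \<nu> = symmetric_states a" using sets_eq_imp_space_eq[OF sets] by simp
  note leD = le[unfolded choquet_le_def, rule_format, OF conjI]
  have m_meas: "(\<lambda>\<psi>. state_moment \<psi> k) \<in> borel_measurable \<nu>" for k
    using radon_integrable[OF \<nu> continuous_map_state_moment] by (rule borel_measurable_integrable)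
  have bm: "(LINT \<psi>|boundary_measure M. state_moment \<psi> k) = moment M k" for k
  proof -
    have "(LINT l|M. state_moment (prod_state l) k) = (LINT l|M. l ^ k)"
    proof (rule integral_cong_AE)
      show "(\<lambda>l. state_moment (prod_state l) k) \<in> borel_measurable M"
        using measurable_compose[OF measurable_prod_state'[OF M] continuous_map_sym_measurable[OF continuous_map_state_moment]] .
      show "(\<lambda>l. l ^ k) \<in> borel_measurable M"
        by (intro borel_measurable_integrable unit_measure_integrable[OF M] continuous_intros)
      show "AE l in M. state_moment (prod_state l) k = l ^ k"
        by (rule eventually_mono[OF unit_measure_AE[OF M]]) (rule state_moment_prod_state)
    qed
    then show ?thesis by (simp add: integral_boundary_measure[OF M continuous_map_state_moment] moment_def)
  qed
  have mom: "(LINT \<psi>|\<nu>. state_moment \<psi> k) = moment M k" for k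
  proof (rule antisym)
    \<comment> \<open>The factors 1 and -1 give both inequalities for each affine function.\<close>
    have aff: "convex_on (symmetric_states a) (\<lambda>\<psi>. c * state_moment \<psi> k)" for c
      unfolding convex_on_def state_moment_add state_moment_scaleR
      by (simp add: convex_symmetric_states distrib_left mult.left_commute)
    have cont: "continuous_map sym_top euclideanreal (\<lambda>\<psi>. c * state_moment \<psi> k)" for c
      by (rule continuous_map_real_mult[OF _ continuous_map_state_moment]) simp
    show "moment M k \<le> (LINT \<psi>|\<nu>. state_moment \<psi> k)"
      using leD[OF cont[of 1] aff[of 1]] by (simp add: bm)
    show "(LINT \<psi>|\<nu>. state_moment \<psi> k) \<le> moment M k"
      using leD[OF cont[of "- 1"] aff[of "- 1"]] by (simp add: bm)
  qed
  have cV: "continuous_map sym_top euclideanreal state_variance"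
    unfolding state_variance_def
    by (intro continuous_map_diff continuous_map_real_pow continuous_map_state_moment)
  then have cV': "continuous_map sym_top euclideanreal (\<lambda>\<psi>. - state_variance \<psi>)"
    by (intro continuous_map_minus)
  have "convex_on (symmetric_states a) (\<lambda>\<psi>. - state_variance \<psi>)"
  proof (rule convex_onI)
    fix t :: real and \<alpha> \<beta> assume t: "0 < t" "t < 1"
    have "state_variance ((1 - t) *\<^sub>R \<alpha> + t *\<^sub>R \<beta>) = (1 - t) * state_variance \<alpha> + t * state_variance \<beta>
      + (1 - t) * t * (state_moment \<alpha> 1 - state_moment \<beta> 1)\<^sup>2"
      unfolding state_variance_def state_moment_add state_moment_scaleR
      by (simp add: power2_eq_square algebra_simps)
    moreover have "0 \<le> (1 - t) * t * (state_moment \<alpha> 1 - state_moment \<beta> 1)\<^sup>2" using t by simp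
    ultimately show "- state_variance ((1 - t) *\<^sub>R \<alpha> + t *\<^sub>R \<beta>) \<le> (1 - t) * - state_variance \<alpha> + t * - state_variance \<beta>"
      by simp
  qed (rule convex_symmetric_states)
  from leD[OF cV' this] have "(LINT \<psi>|boundary_measure M. - state_variance \<psi>) \<le> (LINT \<psi>|\<nu>. - state_variance \<psi>)" .
  moreover have "(LINT \<psi>|boundary_measure M. - state_variance \<psi>) = 0"
    unfolding integral_boundary_measure[OF M cV']
    by (intro integral_eq_zero_AE eventually_mono[OF unit_measure_AE[OF M]]) (simp add: state_variance_prod_state)
  ultimately have "(LINT \<psi>|\<nu>. state_variance \<psi>) \<le> 0" by simp
  moreover have V0: "AE \<psi> in \<nu>. 0 \<le> state_variance \<psi>"
    by (rule AE_I2) (simp add: sp state_variance_nonneg)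
  ultimately have "(LINT \<psi>|\<nu>. state_variance \<psi>) = 0"
    using integral_nonneg_AE[OF V0] by simp
  then have AE0: "AE \<psi> in \<nu>. state_variance \<psi> = 0"
    using integral_nonneg_eq_0_iff_AE[OF radon_integrable[OF \<nu> cV] V0] by simp
  moreover have AE1: "AE \<psi> in \<nu>. \<psi> \<in> symmetric_states a" by (rule AE_I2) (simp add: sp)
  ultimately have AE: "AE \<psi> in \<nu>. \<psi> \<in> symmetric_states a \<and> state_variance \<psi> = 0" by eventually_elim simp
  \<comment> \<open>On states of zero variance the powers of the mean are the moments, so the
    moments of this image are the averaged moments of \<open>\<nu>\<close>.\<close>
  define N where "N = distr \<nu> borel (\<lambda>\<psi>. state_moment \<psi> 1)"
  have N: "unit_measure N"
  proof -
    have "(\<lambda>\<psi>. state_moment \<psi> 1) -` (- {0..1}) \<inter> space \<nu> = {}"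
      using state_moment_1_unit by (auto simp: sp)
    then have "emeasure N (- {0..1}) = 0"
      unfolding N_def by (subst emeasure_distr[OF m_meas]) auto
    then show ?thesis
      unfolding unit_measure_def N_def using finite_measure.finite_measure_distr[OF fin m_meas] by simp
  qed
  have "moment N k = moment M k" for k
  proof -
    have "moment N k = (LINT \<psi>|\<nu>. state_moment \<psi> 1 ^ k)"
      unfolding moment_def N_def by (subst integral_distr[OF m_meas]) auto
    also have "\<dots> = (LINT \<psi>|\<nu>. state_moment \<psi> k)"
    proof (rule integral_cong_AE)
      show "AE \<psi> in \<nu>. state_moment \<psi> 1 ^ k = state_moment \<psi> k"
        using AE by eventually_elim (use state_variance_zero(3) in metis)
    qed (use m_meas in auto)
    finally show ?thesis by (simp add: mom)
  qed
  then have NM: "N = M" by (rule unit_measure_eqI[OF N M])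
  show ?thesis
  proof (rule measure_eqI)
    show "sets \<nu> = sets (boundary_measure M)" by (simp add: sets)
    fix B assume "B \<in> sets \<nu>"
    then have B: "B \<in> sets sym_borel" by (simp add: sets)
    have P: "prod_state -` B \<in> sets borel" using measurable_sets[OF measurable_prod_state B] by simp
    have "emeasure (boundary_measure M) B = emeasure N (prod_state -` B)"
      unfolding boundary_measure_def NM
      using emeasure_distr[OF measurable_prod_state'[OF M] B] by (simp add: unit_measure_space[OF M])
    also have "\<dots> = emeasure \<nu> ((\<lambda>\<psi>. state_moment \<psi> 1) -` (prod_state -` B) \<inter> space \<nu>)"
      unfolding N_def by (rule emeasure_distr[OF m_meas P])
    also have "\<dots> = emeasure \<nu> B"
    proof (rule emeasure_eq_AE)
      show "AE \<psi> in \<nu>. \<psi> \<in> (\<lambda>\<psi>. state_moment \<psi> 1) -` (prod_state -` B) \<inter> space \<nu> \<longleftrightarrow> \<psi> \<in> B"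
        using AE by eventually_elim (use state_variance_zero(1) in \<open>auto simp: sp\<close>)
      show "(\<lambda>\<psi>. state_moment \<psi> 1) -` (prod_state -` B) \<inter> space \<nu> \<in> sets \<nu>"
        by (rule measurable_sets[OF m_meas P])
      show "B \<in> sets \<nu>" by fact
    qed
    finally show "emeasure \<nu> B = emeasure (boundary_measure M) B" ..
  qed
qed


section \<open>Jensen's inequality and uniqueness\<close>

lemma bernstein_weight_nonneg:
  "\<psi> \<in> symmetric_states a \<Longrightarrow> 0 \<le> bernstein_weight (state_moment \<psi>) n k"
  by (simp add: bernstein_weight_def differences_state_moment_nonneg)

lemma bernstein_weight_sum:
  "\<psi> \<in> symmetric_states a \<Longrightarrow> (\<Sum>k\<le>n. bernstein_weight (state_moment \<psi>) n k) = 1"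
  using bernstein_weight_factorial_moment[of 0 n "state_moment \<psi>"] state_moment_0 by simp

lemma continuous_on_prod_state_compose:
  assumes "continuous_map sym_top euclideanreal f"
  shows "continuous_on UNIV (\<lambda>l. f (prod_state l))"
  using continuous_map_compose[OF continuous_map_prod_state assms] by (simp add: o_def)

text \<open>
  Jensen's inequality, from the finite convex combinations of product states with Bernstein
  weights, which converge to \<open>\<psi>\<close>.
\<close>

lemma convex_le_boundary_integral:
  assumes f: "continuous_map sym_top euclideanreal f" "convex_on (symmetric_states a) f"
    and \<psi>: "\<psi> \<in> symmetric_states a" and M: "unit_measure M" "moment M = state_moment \<psi>"
    "\<And>x. blinfun_apply \<psi> x = (LINT l|M. blinfun_apply (prod_state l) x)"
  shows "f \<psi> \<le> (LINT l|M. f (prod_state l))"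
proof -
  define w where "w n k = bernstein_weight (state_moment \<psi>) n k" for n k
  have w0: "0 \<le> w n k" and w1: "(\<Sum>k\<le>n. w n k) = 1" for n k
    using bernstein_weight_nonneg[OF \<psi>] bernstein_weight_sum[OF \<psi>] by (auto simp: w_def)
  define u where "u n = (\<Sum>k\<le>n. w n k *\<^sub>R prod_state (k / n))" for n
  have uK: "u n \<in> symmetric_states a" for n
    unfolding u_def by (rule convex_sum[OF _ convex_symmetric_states w1]) (auto simp: w0 prod_state_symmetric)
  have conv: "(\<lambda>n. \<Sum>k\<le>n. g (k / n) * w n k) \<longlonglongrightarrow> (LINT l|M. g l)" if "continuous_on UNIV g" for g
    using bernstein_integral_tendsto[OF that M(1)] by (simp add: w_def M(2))
  have "(\<lambda>n. blinfun_apply (u n) x) \<longlonglongrightarrow> blinfun_apply \<psi> x" for x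
  proof -
    have c: "continuous_on UNIV (\<lambda>l. Re (blinfun_apply (prod_state l) x))"
      "continuous_on UNIV (\<lambda>l. Im (blinfun_apply (prod_state l) x))"
      by (intro continuous_intros continuous_prod_state)+
    have int: "integrable M (\<lambda>l. blinfun_apply (prod_state l) x)"
      by (rule unit_measure_integrable[OF M(1) continuous_prod_state])
    have ap: "blinfun_apply (u n) x = (\<Sum>k\<le>n. w n k *\<^sub>R blinfun_apply (prod_state (k / n)) x)" for n
      by (simp add: u_def blinfun.sum_left blinfun.scaleR_left)
    have "(\<lambda>n. Re (blinfun_apply (u n) x)) \<longlonglongrightarrow> Re (blinfun_apply \<psi> x)"
      "(\<lambda>n. Im (blinfun_apply (u n) x)) \<longlonglongrightarrow> Im (blinfun_apply \<psi> x)"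
      using conv[OF c(1)] conv[OF c(2)] int by (simp_all add: ap M(3) mult.commute)
    then show ?thesis by (simp add: tendsto_complex_iff)
  qed
  then have "limitin sym_top u \<psi> sequentially"
    by (simp add: limitin_subtopology \<psi> uK limitin_strong_operator_topology)
  from continuous_map_limit[OF f(1) this] have lim: "(\<lambda>n. f (u n)) \<longlonglongrightarrow> f \<psi>"
    by (simp add: o_def)
  have "f (u n) \<le> (\<Sum>k\<le>n. f (prod_state (k / n)) * w n k)" for n
    unfolding u_def
    using convex_on_sum[OF _ _ f(2) w1[of n] w0, of "\<lambda>k. prod_state (k / n)"]
    by (simp add: prod_state_symmetric mult.commute)
  then show ?thesis
    by (intro LIMSEQ_le[OF lim conv[OF continuous_on_prod_state_compose[OF f(1)]]]) auto
qed

lemma radon_integrable_eval: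
  assumes \<nu>: "radon_measure sym_top \<nu>"
  shows "integrable \<nu> (\<lambda>\<psi>. blinfun_apply \<psi> x)"
proof -
  have sets: "sets \<nu> = sets sym_borel" and fin: "finite_measure \<nu>" using \<nu> by (simp_all add: radon_measure_def)
  have sp: "space \<nu> = symmetric_states a" using sets_eq_imp_space_eq[OF sets] by simp
  have "(\<lambda>\<psi>. blinfun_apply \<psi> x) \<in> borel_measurable \<nu>"
    using continuous_map_sym_measurable[OF continuous_map_sym_eval] measurable_cong_sets[OF sets refl] by blast
  then show ?thesis
    by (intro finite_measure.integrable_const_bound[OF fin, where B = "norm x"] AE_I2)
       (simp_all add: sp symmetric_state_norm_le)
qed

text \<open>Bernstein weights are linear in the moments, so representing \<open>\<phi>\<close> at
  elements of the algebra already represents them.\<close>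

lemma radon_integral_bernstein_weight:
  assumes \<mu>: "radon_measure sym_top \<mu>" and rep: "\<And>x. blinfun_apply \<phi> x = (LINT \<psi>|\<mu>. blinfun_apply \<psi> x)"
  shows "integrable \<mu> (\<lambda>\<psi>. bernstein_weight (state_moment \<psi>) n k)"
    "(LINT \<psi>|\<mu>. bernstein_weight (state_moment \<psi>) n k) = bernstein_weight (state_moment \<phi>) n k"
proof -
  have "integrable \<mu> (\<lambda>\<psi>. differences (state_moment \<psi>) k l) \<and>
    (LINT \<psi>|\<mu>. differences (state_moment \<psi>) k l) = differences (state_moment \<phi>) k l" for k l
  proof (induction l arbitrary: k)
    case 0
    show ?case
      using radon_integrable[OF \<mu> continuous_map_state_moment, of k] radon_integrable_eval[OF \<mu>]
      by (simp add: state_moment_def rep)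
  next
    case (Suc l)
    show ?case using Suc[of k] Suc[of "Suc k"] by simp
  qed
  then show "integrable \<mu> (\<lambda>\<psi>. bernstein_weight (state_moment \<psi>) n k)"
    "(LINT \<psi>|\<mu>. bernstein_weight (state_moment \<psi>) n k) = bernstein_weight (state_moment \<phi>) n k"
    by (simp_all add: bernstein_weight_def)
qed

text \<open>Pointwise, \<open>f \<psi>\<close> is at most the integral of \<open>h\<close> against
  the representing measure of \<open>\<psi>\<close>. Integrating this directly would need
  measurability of that integral in \<open>\<psi>\<close>. Instead it is replaced by the Bernstein
  sum \<open>g\<close>, uniformly in \<open>\<psi>\<close> up to \<open>e / 2\<close>;
  \<open>g\<close> is affine in the moments, so its integral against \<open>\<mu>\<close> is
  \<open>g \<phi>\<close>.\<close>

lemma choquet_le_boundary_measure: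
  assumes \<mu>: "radon_measure sym_top \<mu>" "prob_space \<mu>"
    and rep: "\<And>x. blinfun_apply \<phi> x = (LINT \<psi>|\<mu>. blinfun_apply \<psi> x)"
    and M: "unit_measure M" "moment M = state_moment \<phi>" "measure M UNIV = 1"
  shows "choquet_le weak_star (symmetric_states a) \<mu> (boundary_measure M)"
  unfolding choquet_le_def
proof (intro allI impI, elim conjE)
  fix f assume f: "continuous_map sym_top euclideanreal f" "convex_on (symmetric_states a) f"
  interpret prob_space \<mu> by (rule \<mu>(2))
  have sp: "space \<mu> = symmetric_states a"
    using \<mu>(1) sets_eq_imp_space_eq[of \<mu> sym_borel] by (simp add: radon_measure_def)
  define h where "h l = f (prod_state l)" for l
  have h: "continuous_on UNIV h" unfolding h_def by (rule continuous_on_prod_state_compose[OF f(1)])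
  have "(LINT \<psi>|\<mu>. f \<psi>) \<le> (LINT l|M. h l)"
  proof (rule field_le_epsilon)
    fix e :: real assume "e > 0"
    then obtain n where n: "\<And>M. unit_measure M \<Longrightarrow>
      \<bar>(LINT x|M. h x) - (\<Sum>k\<le>n. h (k / n) * bernstein_weight (moment M) n k)\<bar> \<le> e / 2 * measure M UNIV"
      using bernstein_integral_approx[OF h, of "e / 2"] by auto
    define g where "g \<psi> = (\<Sum>k\<le>n. h (k / n) * bernstein_weight (state_moment \<psi>) n k)" for \<psi>
    have g: "integrable \<mu> g" "(LINT \<psi>|\<mu>. g \<psi>) = g \<phi>"
      unfolding g_def using radon_integral_bernstein_weight[OF \<mu>(1) rep] by simp_all
    have "f \<psi> \<le> g \<psi> + e / 2" if \<psi>: "\<psi> \<in> symmetric_states a" for \<psi>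
    proof -
      obtain N where N: "unit_measure N" "measure N UNIV = 1" "moment N = state_moment \<psi>"
        "\<And>x. blinfun_apply \<psi> x = (LINT l|N. blinfun_apply (prod_state l) x)"
        using symmetric_state_mixture[OF \<psi>] by blast
      have "f \<psi> \<le> (LINT l|N. h l)"
        unfolding h_def by (rule convex_le_boundary_integral[OF f \<psi> N(1,3,4)])
      also have "\<dots> \<le> g \<psi> + e / 2" using n[OF N(1), unfolded N(2,3)] unfolding g_def by linarith
      finally show ?thesis .
    qed
    then have "(LINT \<psi>|\<mu>. f \<psi>) \<le> (LINT \<psi>|\<mu>. g \<psi> + e / 2)"
      by (intro integral_mono radon_integrable[OF \<mu>(1) f(1)]) (auto simp: g sp)
    also have "\<dots> = g \<phi> + e / 2" using g by (simp add: prob_space)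
    also have "\<dots> \<le> (LINT l|M. h l) + e" using n[OF M(1), unfolded M(2,3)] unfolding g_def by linarith
    finally show "(LINT \<psi>|\<mu>. f \<psi>) \<le> (LINT l|M. h l) + e" .
  qed
  then show "(LINT \<psi>|\<mu>. f \<psi>) \<le> (LINT \<psi>|boundary_measure M. f \<psi>)"
    by (simp add: integral_boundary_measure[OF M(1) f(1)] h_def)
qed

lemma prob_space_boundary_measure:
  assumes "unit_measure M" "measure M UNIV = 1"
  shows "prob_space (boundary_measure M)"
proof -
  have "prob_space M"
    using assms unit_measure_space[OF assms(1)] unit_measure_finite[OF assms(1)]
    by (intro prob_spaceI) (simp add: finite_measure.emeasure_eq_measure)
  then show ?thesis
    unfolding boundary_measure_def by (rule prob_space.prob_space_distr[OF _ measurable_prod_state'[OF assms(1)]])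
qed

lemma maximal_representing_boundary_measure:
  assumes M: "unit_measure M" "measure M UNIV = 1"
    and rep: "\<And>x. blinfun_apply \<phi> x = (LINT l|M. blinfun_apply (prod_state l) x)"
  shows "maximal_representing_measure a \<phi> (boundary_measure M)"
  unfolding maximal_representing_measure_def maximal_radon_measure_def
  using prob_space_boundary_measure[OF M] radon_boundary_measure[OF M(1)]
    radon_choquet_le_boundary_eq[OF M(1)] integral_boundary_measure[OF M(1) continuous_map_sym_eval] rep
  by auto

text \<open>A maximal representing measure lies below the boundary measure in the Choquet ordering,
  so maximality makes the two equal.\<close>

lemma maximal_representing_measure_unique:
  assumes M: "unit_measure M" "measure M UNIV = 1" "moment M = state_moment \<phi>"
    and \<mu>: "maximal_representing_measure a \<phi> \<mu>"
  shows "\<mu> = boundary_measure M"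
  using \<mu> choquet_le_boundary_measure[of \<mu> \<phi> M] M radon_boundary_measure[OF M(1)]
  unfolding maximal_representing_measure_def maximal_radon_measure_def by auto

text \<open>The extreme points form the zero set of the continuous function
  \<open>state_variance\<close>; this settles their measurability, and product states lie in
  it.\<close>

lemma emeasure_boundary_measure_extreme:
  assumes M: "unit_measure M" "measure M UNIV = 1"
  shows "emeasure (boundary_measure M) {\<psi>. \<psi> extreme_point_of symmetric_states a} = 1"
proof -
  have eq: "{\<psi>. \<psi> extreme_point_of symmetric_states a} = state_variance -` {0} \<inter> space sym_borel"
    using extreme_imp_variance_zero variance_zero_imp_extreme by (auto simp: extreme_point_of_def)
  have "continuous_map sym_top euclideanreal state_variance"
    unfolding state_variance_def
    by (intro continuous_map_diff continuous_map_real_pow continuous_map_state_moment)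
  then have meas: "{\<psi>. \<psi> extreme_point_of symmetric_states a} \<in> sets sym_borel"
    unfolding eq by (intro measurable_sets[OF continuous_map_sym_measurable]) auto
  interpret prob_space M
    using M unit_measure_space[OF M(1)] unit_measure_finite[OF M(1)]
    by (intro prob_spaceI) (simp add: finite_measure.emeasure_eq_measure)
  have "emeasure (boundary_measure M) {\<psi>. \<psi> extreme_point_of symmetric_states a}
    = emeasure M (prod_state -` {\<psi>. \<psi> extreme_point_of symmetric_states a} \<inter> space M)"
    unfolding boundary_measure_def by (rule emeasure_distr[OF measurable_prod_state'[OF M(1)] meas])
  also have "\<dots> = 1"
  proof (rule emeasure_eq_1_AE)
    show "prod_state -` {\<psi>. \<psi> extreme_point_of symmetric_states a} \<inter> space M \<in> sets M"
      by (rule measurable_sets[OF measurable_prod_state'[OF M(1)] meas])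
    show "AE l in M. l \<in> prod_state -` {\<psi>. \<psi> extreme_point_of symmetric_states a} \<inter> space M"
      by (rule eventually_mono[OF unit_measure_AE[OF M(1)]])
         (auto simp: eq prod_state_symmetric state_variance_prod_state unit_measure_space[OF M(1)])
  qed
  finally show ?thesis .
qed

end

theorem theorem5p5:
  fixes a :: "nat \<Rightarrow> 'a::cstar_algebra"
  assumes "is_CAR a"
  shows "choquet_simplex weak_star (symmetric_states a) \<and>
    (\<forall>\<phi>\<in>symmetric_states a.
       (\<exists>!\<mu>. maximal_representing_measure a \<phi> \<mu>) \<and>
       (\<forall>\<mu>. maximal_representing_measure a \<phi> \<mu> \<longrightarrow>
          emeasure \<mu> {\<psi>. \<psi> extreme_point_of symmetric_states a} = 1))"
proof -
  interpret car a by unfold_locales (rule assms)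
  show ?thesis
  proof (intro conjI ballI)
    show "choquet_simplex weak_star (symmetric_states a)"
      unfolding choquet_simplex_def
      using compactin_symmetric_states convex_symmetric_states lattice_cone_sym_cone by blast
    fix \<phi> assume "\<phi> \<in> symmetric_states a"
    then obtain M where M: "unit_measure M" "measure M UNIV = 1" "moment M = state_moment \<phi>"
      "\<And>x. blinfun_apply \<phi> x = (LINT l|M. blinfun_apply (prod_state l) x)"
      using symmetric_state_mixture by blast
    note unique = maximal_representing_measure_unique[OF M(1-3)]
    show "\<exists>!\<mu>. maximal_representing_measure a \<phi> \<mu>"
      using maximal_representing_boundary_measure[OF M(1,2,4)] unique by (rule ex1I)
    show "\<forall>\<mu>. maximal_representing_measure a \<phi> \<mu> \<longrightarrow>
        emeasure \<mu> {\<psi>. \<psi> extreme_point_of symmetric_states a} = 1"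
      using unique emeasure_boundary_measure_extreme[OF M(1,2)] by blast
  qed
qed

end
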